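(* Let $P$ be an $r$-differential poset such that: (i) the down maps $D_n:\mathbb{Z}P_n\to\mathbb{Z}P_{n-1}$ are surjective for all $n\ge1$; (ii) there exists $l\ge0$ such that $\Delta p_n\ge\Delta p_{n-1-\delta_{r,1}}+1$ for every $n\ge l+1$ (where $\delta_{r,1}=1$ if $r=1$ and $0$ otherwise); (iii) the maps $DU_n$ have rational canonical form over $\mathbb{Z}$ for all $n\in\{0,1,\dots,l\}$. Then $DU_n$ has rational canonical form over $\mathbb{Z}$ for all $n\ge0$; equivalently, $[DU_n]+xI_{p_n}$ has Smith normal form over $\mathbb{Z}[x]$ for all $n\ge0$.
   Context: For a positive integer $r$, a poset $P$ is $r$-differential if: (D1) $P$ is graded, locally finite, has all rank sizes finite and a unique minimum element; (D2) if two distinct elements of $P$ both cover exactly $k$ common elements, then exactly $k$ elements cover them both; (D3) if an element covers $k$ elements then it is covered by exactly $k+r$ elements. $P_n$ is the $n$-th rank (empty for $n<0$), $p_n=|P_n|$, $\Delta p_n=p_n-p_{n-1}$, and $\mathbb{Z}P_n\cong\mathbb{Z}^{p_n}$ is the free $\mathbb{Z}$-module with basis $P_n$. $U_n:\mathbb{Z}P_n\to\mathbb{Z}P_{n+1}$ sends an element to the sum of all elements covering it; $D_n:\mathbb{Z}P_n\to\mathbb{Z}P_{n-1}$ sends an element to the sum of all elements it covers; $DU_n=D_{n+1}U_n$, with matrix $[DU_n]$ in the standard basis. An endomorphism $\varphi$ of a free $\mathbb{Z}$-module $M$ of finite rank has rational canonical form over $\mathbb{Z}$ if, viewing $M$ as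 a $\mathbb{Z}[x]$-module with $x$ acting by $\varphi$, $M=V_1\oplus\cdots\oplus V_k$ with $V_i$ cyclic $\mathbb{Z}[x]$-submodules, $\operatorname{Ann}(V_i)=(a_i(x))$, each $a_i$ monic non-constant in $\mathbb{Z}[x]$, and $a_1\mid a_2\mid\cdots\mid a_k$. A matrix over a commutative ring $R$ has Smith normal form over $R$ if it can be multiplied on both sides by invertible matrices over $R$ to obtain a diagonal matrix whose diagonal entries satisfy $s_1\mid s_2\mid\cdots$. *)

theory Defs
  imports "Jordan_Normal_Form.Matrix" "HOL-Computational_Algebra.Polynomial"
begin

definition covby :: "'a set \<Rightarrow> ('a \<Rightarrow> 'a \<Rightarrow> bool) \<Rightarrow> 'a \<Rightarrow> 'a \<Rightarrow> bool" where
  "covby P leq x y \<longleftrightarrow> x \<in> P \<and> y \<in> P \<and> leq x y \<and> x \<noteq> y \<and>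
     (\<forall>z\<in>P. leq x z \<and> leq z y \<longrightarrow> z = x \<or> z = y)"

definition partial_order_on' :: "'a set \<Rightarrow> ('a \<Rightarrow> 'a \<Rightarrow> bool) \<Rightarrow> bool" where
  "partial_order_on' P leq \<longleftrightarrow>
     (\<forall>x\<in>P. leq x x) \<and>
     (\<forall>x\<in>P. \<forall>y\<in>P. leq x y \<and> leq y x \<longrightarrow> x = y) \<and>
     (\<forall>x\<in>P. \<forall>y\<in>P. \<forall>z\<in>P. leq x y \<and> leq y z \<longrightarrow> leq x z)"

definition rank_set :: "'a set \<Rightarrow> ('a \<Rightarrow> nat) \<Rightarrow> nat \<Rightarrow> 'a set" where
  "rank_set P rk n = {x \<in> P. rk x = n}"

definition rank_size :: "'a set \<Rightarrow> ('a \<Rightarrow> nat) \<Rightarrow> int \<Rightarrow> int" where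
  "rank_size P rk n = (if n < 0 then 0 else int (card (rank_set P rk (nat n))))"

definition delta_rank_size :: "'a set \<Rightarrow> ('a \<Rightarrow> nat) \<Rightarrow> int \<Rightarrow> int" where
  "delta_rank_size P rk n = rank_size P rk n - rank_size P rk (n - 1)"

definition D1 :: "'a set \<Rightarrow> ('a \<Rightarrow> 'a \<Rightarrow> bool) \<Rightarrow> ('a \<Rightarrow> nat) \<Rightarrow> bool" where
  "D1 P leq rk \<longleftrightarrow>
     partial_order_on' P leq \<and>
     (\<exists>z\<in>P. (\<forall>x\<in>P. leq z x) \<and> rk z = 0) \<and>
     (\<forall>x y. covby P leq x y \<longrightarrow> rk y = rk x + 1) \<and>
     (\<forall>x\<in>P. \<forall>y\<in>P. finite {z\<in>P. leq x z \<and> leq z y}) \<and>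
     (\<forall>n. finite (rank_set P rk n))"

definition D2 :: "'a set \<Rightarrow> ('a \<Rightarrow> 'a \<Rightarrow> bool) \<Rightarrow> bool" where
  "D2 P leq \<longleftrightarrow> (\<forall>x\<in>P. \<forall>y\<in>P. \<forall>k. x \<noteq> y \<longrightarrow>
     card {z. covby P leq z x \<and> covby P leq z y} = k \<longrightarrow>
     card {z. covby P leq x z \<and> covby P leq y z} = k)"

definition D3 :: "nat \<Rightarrow> 'a set \<Rightarrow> ('a \<Rightarrow> 'a \<Rightarrow> bool) \<Rightarrow> bool" where
  "D3 r P leq \<longleftrightarrow> (\<forall>x\<in>P. \<forall>k. card {z. covby P leq z x} = k \<longrightarrow>
     card {z. covby P leq x z} = k + r)"

definition differential_poset :: "nat \<Rightarrow> 'a set \<Rightarrow> ('a \<Rightarrow> 'a \<Rightarrow> bool) \<Rightarrow> ('a \<Rightarrow> nat) \<Rightarrow> bool" where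
  "differential_poset r P leq rk \<longleftrightarrow> r \<ge> 1 \<and> D1 P leq rk \<and> D2 P leq \<and> D3 r P leq"

text \<open>ZP_n is realised as the integer-valued functions supported on P_n.\<close>
definition fsupp :: "'a set \<Rightarrow> ('a \<Rightarrow> int) set" where
  "fsupp S = {f. \<forall>x. x \<notin> S \<longrightarrow> f x = 0}"

definition ZP :: "'a set \<Rightarrow> ('a \<Rightarrow> nat) \<Rightarrow> nat \<Rightarrow> ('a \<Rightarrow> int) set" where
  "ZP P rk n = fsupp (rank_set P rk n)"

text \<open>U_n : ZP_n \<rightarrow> ZP_(n+1): an element goes to the sum of the elements covering it.\<close>
definition Umap :: "'a set \<Rightarrow> ('a \<Rightarrow> 'a \<Rightarrow> bool) \<Rightarrow> ('a \<Rightarrow> nat) \<Rightarrow> nat \<Rightarrow> ('a \<Rightarrow> int) \<Rightarrow> ('a \<Rightarrow> int)" where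
  "Umap P leq rk n f = (\<lambda>z. if z \<in> rank_set P rk (Suc n)
      then (\<Sum>y\<in>{y \<in> rank_set P rk n. covby P leq y z}. f y) else 0)"

text \<open>D_n : ZP_n \<rightarrow> ZP_(n-1) for n \<ge> 1: an element goes to the sum of the elements it covers.\<close>
definition Dmap :: "'a set \<Rightarrow> ('a \<Rightarrow> 'a \<Rightarrow> bool) \<Rightarrow> ('a \<Rightarrow> nat) \<Rightarrow> nat \<Rightarrow> ('a \<Rightarrow> int) \<Rightarrow> ('a \<Rightarrow> int)" where
  "Dmap P leq rk n g = (\<lambda>y. if n \<ge> 1 \<and> y \<in> rank_set P rk (n - 1)
      then (\<Sum>z\<in>{z \<in> rank_set P rk n. covby P leq y z}. g z) else 0)"

definition DUmap :: "'a set \<Rightarrow> ('a \<Rightarrow> 'a \<Rightarrow> bool) \<Rightarrow> ('a \<Rightarrow> nat) \<Rightarrow> nat \<Rightarrow> ('a \<Rightarrow> int) \<Rightarrow> ('a \<Rightarrow> int)" where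
  "DUmap P leq rk n = Dmap P leq rk (Suc n) \<circ> Umap P leq rk n"

definition poly_act :: "(('a \<Rightarrow> int) \<Rightarrow> ('a \<Rightarrow> int)) \<Rightarrow> int poly \<Rightarrow> ('a \<Rightarrow> int) \<Rightarrow> ('a \<Rightarrow> int)" where
  "poly_act phi q v = (\<lambda>x. \<Sum>j\<le>degree q. coeff q j * (phi ^^ j) v x)"

definition is_Zx_submodule :: "('a \<Rightarrow> int) set \<Rightarrow> (('a \<Rightarrow> int) \<Rightarrow> ('a \<Rightarrow> int)) \<Rightarrow> ('a \<Rightarrow> int) set \<Rightarrow> bool" where
  "is_Zx_submodule M phi V \<longleftrightarrow> V \<subseteq> M \<and> (\<lambda>_. 0) \<in> V \<and>
     (\<forall>v\<in>V. \<forall>w\<in>V. (\<lambda>x. v x + w x) \<in> V) \<and>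
     (\<forall>v\<in>V. \<forall>c::int. (\<lambda>x. c * v x) \<in> V) \<and>
     (\<forall>v\<in>V. phi v \<in> V)"

definition is_cyclic_Zx_submodule :: "('a \<Rightarrow> int) set \<Rightarrow> (('a \<Rightarrow> int) \<Rightarrow> ('a \<Rightarrow> int)) \<Rightarrow> ('a \<Rightarrow> int) set \<Rightarrow> bool" where
  "is_cyclic_Zx_submodule M phi V \<longleftrightarrow> is_Zx_submodule M phi V \<and>
     (\<exists>v\<in>V. V = {poly_act phi q v | q. True})"

definition annihilator :: "(('a \<Rightarrow> int) \<Rightarrow> ('a \<Rightarrow> int)) \<Rightarrow> ('a \<Rightarrow> int) set \<Rightarrow> int poly set" where
  "annihilator phi V = {q. \<forall>w\<in>V. poly_act phi q w = (\<lambda>_. 0)}"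

definition has_rcf_Z :: "('a \<Rightarrow> int) set \<Rightarrow> (('a \<Rightarrow> int) \<Rightarrow> ('a \<Rightarrow> int)) \<Rightarrow> bool" where
  "has_rcf_Z M phi \<longleftrightarrow> (\<exists>k::nat. \<exists>V :: nat \<Rightarrow> ('a \<Rightarrow> int) set. \<exists>a :: nat \<Rightarrow> int poly.
     (\<forall>i<k. is_cyclic_Zx_submodule M phi (V i)) \<and>
     (\<forall>m\<in>M. \<exists>!vs :: nat \<Rightarrow> ('a \<Rightarrow> int).
        (\<forall>i<k. vs i \<in> V i) \<and> (\<forall>i\<ge>k. vs i = (\<lambda>_. 0)) \<and>
        m = (\<lambda>x. \<Sum>i<k. vs i x)) \<and>
     (\<forall>i<k. annihilator phi (V i) = {q. a i dvd q}) \<and>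
     (\<forall>i<k. lead_coeff (a i) = 1 \<and> degree (a i) \<ge> 1) \<and>
     (\<forall>i. Suc i < k \<longrightarrow> a i dvd a (Suc i)))"

definition rank_enum :: "'a set \<Rightarrow> ('a \<Rightarrow> nat) \<Rightarrow> nat \<Rightarrow> 'a list" where
  "rank_enum P rk n = (SOME xs. distinct xs \<and> set xs = rank_set P rk n)"

definition DU_matrix :: "'a set \<Rightarrow> ('a \<Rightarrow> 'a \<Rightarrow> bool) \<Rightarrow> ('a \<Rightarrow> nat) \<Rightarrow> nat \<Rightarrow> int mat" where
  "DU_matrix P leq rk n = (let es = rank_enum P rk n in
     mat (length es) (length es)
       (\<lambda>(i, j). DUmap P leq rk n (\<lambda>x. if x = es ! j then 1 else 0) (es ! i)))"

definition char_mat_plus :: "int mat \<Rightarrow> int poly mat" where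
  "char_mat_plus A = mat (dim_row A) (dim_col A)
     (\<lambda>(i, j). [:A $$ (i, j):] + (if i = j then [:0, 1:] else 0))"

definition has_snf :: "'b :: comm_ring_1 mat \<Rightarrow> bool" where
  "has_snf A \<longleftrightarrow> (\<exists>L R. L \<in> carrier_mat (dim_row A) (dim_row A) \<and>
     R \<in> carrier_mat (dim_col A) (dim_col A) \<and>
     invertible_mat L \<and> invertible_mat R \<and>
     diagonal_mat (L * A * R) \<and>
     (\<forall>i. Suc i < min (dim_row A) (dim_col A) \<longrightarrow>
        (L * A * R) $$ (i, i) dvd (L * A * R) $$ (Suc i, Suc i)))"

end

theory Submission
  imports Defs "HOL-Library.Function_Algebras" "HOL-Computational_Algebra.Primes"
    "Jordan_Normal_Form.Determinant"
begin

text \<open>The map \<open>D\<close> turns \<open>ZP\<^sub>n\<close> with \<open>x\<close> acting by \<open>UD\<close> into an extension of \<open>ZP\<^sub>n\<^sub>-\<^sub>1\<close>, with \<open>x\<close> acting by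
  \<open>DU\<close>, by the kernel \<open>K\<close> of \<open>D\<close>, on which \<open>x\<close> acts as zero. Given a decomposition of \<open>ZP\<^sub>n\<^sub>-\<^sub>1\<close> into cyclic
  modules generated by \<open>v\<^sub>i\<close> with annihilators \<open>(a\<^sub>i)\<close>, lift \<open>v\<^sub>i\<close> to \<open>w\<^sub>i\<close>. Then \<open>a\<^sub>i w\<^sub>i\<close> lies in \<open>K\<close> and can be
  changed by \<open>a\<^sub>i(0) K\<close>. Since \<open>U\<close> is injective modulo every prime \<open>p\<close>, those \<open>a\<^sub>i w\<^sub>i\<close> with \<open>p\<close> dividing
  \<open>a\<^sub>i(0)\<close> are independent modulo \<open>p\<close>, and so, when there is room, the lifts can be chosen such that the
  last \<open>rank K\<close> of the \<open>a\<^sub>i w\<^sub>i\<close> form a basis of \<open>K\<close> and the others vanish. This decomposes \<open>ZP\<^sub>n\<close> with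
  annihilators \<open>x a\<^sub>i\<close> and \<open>a\<^sub>i\<close>, and \<open>DU = UD + r\<close> shifts \<open>x\<close>. There is room because every \<open>a\<^sub>i\<close> is a product of
  distinct factors \<open>x - r j\<close>, at most \<open>\<Delta>p\<^sub>n\<^sub>-\<^sub>j\<close> of the \<open>a\<^sub>i\<close> vanish at \<open>r j\<close>, and \<open>\<Delta>p\<^sub>n\<^sub>-\<^sub>j \<le> \<Delta>p\<^sub>n\<close> whenever
  \<open>r j \<noteq> 1\<close>; strict growth then excludes equality except for \<open>r = 1\<close> and \<open>j = 3\<close>, where the units modulo \<open>3\<close>
  are \<open>1\<close> and \<open>-1\<close> and no room is needed.\<close>

text \<open>The ring \<open>\<int>[x]\<close> is not a principal ideal domain, so the generators
  have to be built by hand. The obstruction is a determinant: if all constant coefficients in play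
  are divisible by N, changing the lifts leaves the determinant of the resulting vectors, taken in a
  basis of the kernel, unchanged modulo N, while a basis needs 1 or -1. This is harmless if the
  smallest of them is 1 or 3 up to sign, since independence modulo 3 already forces a unit modulo 3.
  Injectivity of \<open>U\<close> modulo a prime is dual to surjectivity of \<open>D\<close>,
  because the two maps are transposes in the standard bases. The term \<delta> in hypothesis (ii)
  has this origin. The inequality between rank differences j ranks apart comes from a prime divisor
  of r j, so it is silent for r j = 1. For r > 1 one can compare across j - 1 ranks with the
  difference just below the new one. For r = 1 and j = 2 that would be a jump by 1; the comparison
  is therefore made across j - 2 ranks with the difference one rank further down, and then only j =
  3 is a jump by 1.\<close>

section \<open>Bases of free abelian groups\<close>

text \<open>Vectors live in a commutative ring only so that \<open>of_int c * v\<close> can serve as the action of \<open>\<int>\<close>: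
  the type \<open>'a \<Rightarrow> int\<close> is one under pointwise operations.\<close>

definition zbasis :: "'v::comm_ring_1 set \<Rightarrow> 'i set \<Rightarrow> ('i \<Rightarrow> 'v) \<Rightarrow> bool" where
  "zbasis K I b \<longleftrightarrow> finite I \<and> K = range (\<lambda>c. \<Sum>i\<in>I. of_int (c i) * b i) \<and>
     (\<forall>c. (\<Sum>i\<in>I. of_int (c i) * b i) = 0 \<longrightarrow> (\<forall>i\<in>I. c i = 0))"

lemma zbasis_obtain:
  assumes "zbasis K I b" "y \<in> K"
  obtains c where "y = (\<Sum>i\<in>I. of_int (c i) * b i)"
  using assms unfolding zbasis_def by auto

lemma zbasis_indep:
  assumes "zbasis K I b" "(\<Sum>i\<in>I. of_int (c i) * b i) = 0" "i \<in> I"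
  shows "c i = 0"
  using assms unfolding zbasis_def by blast

lemma zbasis_comb:
  assumes "zbasis K I b"
  shows "(\<Sum>i\<in>I. of_int (c i) * b i) \<in> K"
  using assms unfolding zbasis_def by blast

lemma zbasis_finite: "zbasis K I b \<Longrightarrow> finite I"
  unfolding zbasis_def by blast

lemma zbasis_add:
  assumes "zbasis K I b" "x \<in> K" "y \<in> K"
  shows "x + y \<in> K"
proof -
  obtain c where c: "x = (\<Sum>i\<in>I. of_int (c i) * b i)" using zbasis_obtain assms by metis
  obtain d where d: "y = (\<Sum>i\<in>I. of_int (d i) * b i)" using zbasis_obtain assms by metis
  have "x + y = (\<Sum>i\<in>I. of_int (c i + d i) * b i)"
    unfolding c d by (simp add: sum.distrib algebra_simps)
  then show ?thesis using zbasis_comb[OF assms(1)] by metis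
qed

lemma zbasis_scale:
  assumes "zbasis K I b" "x \<in> K"
  shows "of_int n * x \<in> K"
proof -
  obtain c where c: "x = (\<Sum>i\<in>I. of_int (c i) * b i)" using zbasis_obtain assms by metis
  have "of_int n * x = (\<Sum>i\<in>I. of_int (n * c i) * b i)"
    unfolding c by (simp add: sum_distrib_left algebra_simps)
  then show ?thesis using zbasis_comb[OF assms(1)] by metis
qed

lemma zbasis_zero: "zbasis K I b \<Longrightarrow> 0 \<in> K"
  using zbasis_comb[of K I b "\<lambda>_. 0"] by simp

lemma zbasis_sum:
  assumes "zbasis K I b" "\<And>j. j \<in> J \<Longrightarrow> f j \<in> K"
  shows "(\<Sum>j\<in>J. f j) \<in> K"
  using assms(2)
  by (induction J rule: infinite_finite_induct) (auto simp: zbasis_zero[OF assms(1)] intro: zbasis_add[OF assms(1)])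

lemma zbasis_mem:
  assumes "zbasis K I b" "i \<in> I"
  shows "b i \<in> K"
proof -
  have "(\<Sum>j\<in>I. of_int (if j = i then 1 else 0) * b j) = (\<Sum>j\<in>I. if j = i then b j else 0)"
    by (rule sum.cong) auto
  also have "\<dots> = b i" using assms zbasis_finite[OF assms(1)] by simp
  finally show ?thesis using zbasis_comb[OF assms(1)] by metis
qed

section \<open>Unimodular changes of basis\<close>

lemma zbasis_change_pair:
  assumes B: "zbasis K I b" and ij: "i \<in> I" "j \<in> I" "i \<noteq> j"
    and det: "p * s - q * r = (1::int)"
  shows "zbasis K I (b(i := of_int p * b i + of_int q * b j, j := of_int r * b i + of_int s * b j))"
    (is "zbasis K I ?b")
proof -
  have fin: "finite I" using B zbasis_finite by blast
  define comb where "comb = (\<lambda>b c. (\<Sum>l\<in>I. of_int (c l) * b l :: 'a))"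
  \<comment> \<open>Coordinates transform by the transpose of the matrix with rows
    \<open>p q\<close> and \<open>r s\<close>; \<open>g\<close> applies its inverse, which is
    integral because the determinant is 1.\<close>
  define h where "h = (\<lambda>c :: 'b \<Rightarrow> int. c(i := c i * p + c j * r, j := c i * q + c j * s))"
  define g where "g = (\<lambda>c :: 'b \<Rightarrow> int. c(i := s * c i - r * c j, j := p * c j - q * c i))"
  have I: "I = insert i (insert j (I - {i, j}))" using ij by auto
  have split: "comb b c = of_int (c i) * b i + of_int (c j) * b j + (\<Sum>l\<in>I-{i,j}. of_int (c l) * b l)" for b c
    unfolding comb_def using fin ij by (subst I) (simp add: add.assoc)
  have comb_h: "comb ?b c = comb b (h c)" for c
  proof -
    have "(\<Sum>l\<in>I-{i,j}. of_int (c l) * ?b l) = (\<Sum>l\<in>I-{i,j}. of_int (h c l) * b l)"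
      by (rule sum.cong) (auto simp: h_def)
    then show ?thesis unfolding split using ij by (simp add: h_def algebra_simps)
  qed
  have gh: "g (h c) = c" for c
  proof
    fix l
    have "s * (c i * p + c j * r) - r * (c i * q + c j * s) = c i * (p * s - q * r)"
      "p * (c i * q + c j * s) - q * (c i * p + c j * r) = c j * (p * s - q * r)"
      by (simp_all add: algebra_simps)
    then show "g (h c) l = c l" unfolding g_def h_def using ij det by simp
  qed
  have hg: "h (g c) = c" for c
  proof
    fix l
    have "(s * c i - r * c j) * p + (p * c j - q * c i) * r = c i * (p * s - q * r)"
      "(s * c i - r * c j) * q + (p * c j - q * c i) * s = c j * (p * s - q * r)"
      by (simp_all add: algebra_simps)
    then show "h (g c) l = c l" unfolding g_def h_def using ij det by simp
  qed
  have K: "K = range (comb b)" using B unfolding zbasis_def comb_def by blast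
  have "range (comb ?b) = range (comb b)"
    unfolding comb_h by (auto simp: image_iff) (metis hg)
  moreover have "c l = 0" if c: "comb ?b c = 0" and l: "l \<in> I" for c l
  proof -
    have z: "h c l' = 0" if "l' \<in> I" for l'
      using zbasis_indep[OF B _ that, of "h c"] c comb_h unfolding comb_def by metis
    have "g (h c) l = 0" using z l ij unfolding g_def by auto
    then show ?thesis using gh by simp
  qed
  ultimately show ?thesis using fin K unfolding zbasis_def comb_def by auto
qed

text \<open>Source of the determinant 1 matrices in the eliminations below: a Bezout identity
  divided by the gcd, which \<open>y \<noteq> 0\<close> makes nonzero.\<close>

lemma bezout_quotients:
  fixes x y :: int
  assumes "y \<noteq> 0"
  obtains g u w x' y' where "x = g * x'" "y = g * y'" "u * x' + w * y' = 1"
proof -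
  obtain u w where uw: "u * x + w * y = gcd x y" using bezout_int by blast
  obtain x' where x': "x = gcd x y * x'" by (meson dvdE gcd_dvd1)
  obtain y' where y': "y = gcd x y * y'" by (meson dvdE gcd_dvd2)
  have "gcd x y * (u * x' + w * y') = u * (gcd x y * x') + w * (gcd x y * y')" by (simp add: algebra_simps)
  also have "\<dots> = gcd x y * 1" using uw x' y' by simp
  finally have "u * x' + w * y' = 1" using assms by simp
  then show ?thesis using that x' y' by blast
qed

text \<open>Euclidean elimination on the coordinates of \<open>y\<close>: they are cleared one after
  the other, and the gcds are collected at \<open>i\<close>.\<close>

lemma zbasis_align_vector:
  assumes B: "zbasis K I b" and i: "i \<in> I" and y: "y \<in> K"
  obtains b' g where "zbasis K I b'" "y = of_int g * b' i"
proof -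
  have fin: "finite (I - {i})" using B zbasis_finite by blast
  have "\<exists>b' c. zbasis K I b' \<and> y = (\<Sum>l\<in>I. of_int (c l) * b' l) \<and> (\<forall>l\<in>J. c l = 0)"
    if "J \<subseteq> I - {i}" for J
    using finite_subset[OF that fin] that
  proof (induction J rule: finite_induct)
    case empty
    then show ?case using B y zbasis_obtain by (metis empty_iff)
  next
    case (insert j J)
    then obtain b' c where b': "zbasis K I b'" and yc: "y = (\<Sum>l\<in>I. of_int (c l) * b' l)" and c0: "\<forall>l\<in>J. c l = 0"
      by auto
    have j: "j \<in> I" "i \<noteq> j" "i \<notin> J" using insert by auto
    show ?case
    proof (cases "c j = 0")
      case True
      then show ?thesis using b' yc c0 by blast
    next
      case False
      then obtain g u w p q where pq: "c i = g * p" "c j = g * q"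
        and one: "u * p + w * q = 1" using bezout_quotients by metis
      \<comment> \<open>The first new vector is the part of \<open>y\<close> in the plane of
        \<open>b' i\<close> and \<open>b' j\<close> divided by \<open>g\<close>; the second
        completes it to determinant \<open>u * p + w * q\<close>.\<close>
      let ?b = "b'(i := of_int p * b' i + of_int q * b' j, j := of_int (-w) * b' i + of_int u * b' j)"
      let ?c = "c(i := g, j := 0)"
      have B': "zbasis K I ?b"
        by (rule zbasis_change_pair[OF b' i j(1,2)]) (use one in \<open>simp add: algebra_simps\<close>)
      have I: "I = Set.insert i (Set.insert j (I - {i, j}))" using i j by auto
      have fin: "finite I" using b' zbasis_finite by blast
      have split: "(\<Sum>l\<in>I. f l) = f i + f j + (\<Sum>l\<in>I-{i,j}. f l)" for f :: "'b \<Rightarrow> 'a"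
        using fin j by (subst I) (simp add: add.assoc)
      have "(\<Sum>l\<in>I-{i,j}. of_int (?c l) * ?b l) = (\<Sum>l\<in>I-{i,j}. of_int (c l) * b' l)"
        by (rule sum.cong) auto
      moreover have "of_int g * (of_int p * b' i + of_int q * b' j) = of_int (c i) * b' i + of_int (c j) * b' j"
        by (simp add: pq algebra_simps)
      ultimately have "y = (\<Sum>l\<in>I. of_int (?c l) * ?b l)" unfolding yc split using j by simp
      moreover have "\<forall>l\<in>Set.insert j J. ?c l = 0" using c0 j by auto
      ultimately show ?thesis using B' by (intro exI[of _ ?b] exI[of _ ?c] conjI)
    qed
  qed
  then obtain b' c where b': "zbasis K I b'" "y = (\<Sum>l\<in>I. of_int (c l) * b' l)" "\<forall>l\<in>I-{i}. c l = 0" by blast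
  have "y = of_int (c i) * b' i"
    unfolding b'(2) using b'(3) i zbasis_finite[OF B] by (subst sum.remove[of I i]) auto
  then show ?thesis using b'(1) that by blast
qed

text \<open>Dual of \<open>zbasis_align_vector\<close>: the elimination runs on the values of a
  functional at the basis vectors.\<close>

lemma zbasis_align_functional:
  fixes f :: "'v::comm_ring_1 \<Rightarrow> int"
  assumes B: "zbasis K I b" and i: "i \<in> I"
    and f: "\<And>x y. f (x + y) = f x + f y" "\<And>c x. f (of_int c * x) = c * f x"
  obtains b' where "zbasis K I b'" "\<And>l. l \<in> I \<Longrightarrow> l \<noteq> i \<Longrightarrow> f (b' l) = 0"
proof -
  have fin: "finite (I - {i})" using B zbasis_finite by blast
  have "\<exists>b'. zbasis K I b' \<and> (\<forall>l\<in>J. f (b' l) = 0)"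
    if "J \<subseteq> I - {i}" for J
    using finite_subset[OF that fin] that
  proof (induction J rule: finite_induct)
    case empty
    then show ?case using B by auto
  next
    case (insert j J)
    then obtain b' where b': "zbasis K I b'" and c0: "\<forall>l\<in>J. f (b' l) = 0"
      by auto
    have j: "j \<in> I" "i \<noteq> j" "i \<notin> J" using insert by auto
    show ?case
    proof (cases "f (b' j) = 0")
      case True
      then show ?thesis using b' c0 by blast
    next
      case False
      then obtain g u w p q where pq: "f (b' i) = g * p" "f (b' j) = g * q"
        and one: "u * p + w * q = 1" using bezout_quotients by metis
      let ?b = "b'(i := of_int u * b' i + of_int w * b' j, j := of_int (-q) * b' i + of_int p * b' j)"
      have B': "zbasis K I ?b"
        by (rule zbasis_change_pair[OF b' i j(1,2)]) (use one in \<open>simp add: algebra_simps\<close>)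
      have "f (of_int (-q) * b' i + of_int p * b' j) = (-q) * f (b' i) + p * f (b' j)"
        unfolding f(1) f(2) ..
      also have "\<dots> = 0" by (simp add: pq)
      finally have "f (?b j) = 0" by simp
      then have "\<forall>l\<in>Set.insert j J. f (?b l) = 0" using c0 j by auto
      then show ?thesis using B' by (intro exI[of _ ?b] conjI)
    qed
  qed
  from this[of "I - {i}"] obtain b' where "zbasis K I b'" "\<forall>l\<in>I-{i}. f (b' l) = 0" by auto
  then show ?thesis using that[of b'] by simp
qed

text \<open>In an aligned basis \<open>f\<close> sees only the coordinate at \<open>i\<close>. Its
  factor \<open>f (b' i)\<close> is nonzero because of \<open>g\<close>, so the other basis vectors
  span the kernel.\<close>

lemma zbasis_kernel_functional:
  fixes f :: "'v::comm_ring_1 \<Rightarrow> int"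
  assumes B: "zbasis K I b"
    and f: "\<And>x y. f (x + y) = f x + f y" "\<And>c x. f (of_int c * x) = c * f x"
    and g: "g \<in> K" "f g \<noteq> 0"
  obtains i b' where "i \<in> I" "zbasis {y \<in> K. f y = 0} (I - {i}) b'"
proof -
  have f0: "f 0 = 0" using f(2)[of 0 0] by simp
  have fs: "f (\<Sum>l\<in>A. h l) = (\<Sum>l\<in>A. f (h l))" for A and h :: "'b \<Rightarrow> 'v"
    by (induction A rule: infinite_finite_induct) (auto simp: f f0)
  obtain c0 where c0: "g = (\<Sum>i\<in>I. of_int (c0 i) * b i)" using zbasis_obtain[OF B g(1)] .
  then obtain i where i: "i \<in> I" using g f0 by fastforce
  obtain b' where b': "zbasis K I b'" and z: "\<And>l. l \<in> I \<Longrightarrow> l \<noteq> i \<Longrightarrow> f (b' l) = 0"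
    using zbasis_align_functional[OF B i f] by blast
  have fin: "finite I" using B zbasis_finite by blast
  have val: "f (\<Sum>l\<in>I. of_int (c l) * b' l) = c i * f (b' i)" for c
    unfolding fs f(2) using fin i z by (subst sum.remove[of I i]) auto
  have ne: "f (b' i) \<noteq> 0" 
  proof
    assume "f (b' i) = 0"
    moreover obtain c where "g = (\<Sum>l\<in>I. of_int (c l) * b' l)" using zbasis_obtain[OF b' g(1)] .
    ultimately show False using val g(2) by simp
  qed
  have ext: "(\<Sum>l\<in>I-{i}. of_int (c l) * b' l) = (\<Sum>l\<in>I. of_int ((c(i := 0)) l) * b' l)" for c
    using fin i by (auto simp: sum.remove[of I i] intro!: sum.cong)
  have "{y \<in> K. f y = 0} = range (\<lambda>c. \<Sum>l\<in>I-{i}. of_int (c l) * b' l)"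
  proof (intro equalityI subsetI)
    fix y assume y: "y \<in> {y \<in> K. f y = 0}"
    then have "y \<in> K" by simp
    then obtain c where c: "y = (\<Sum>l\<in>I. of_int (c l) * b' l)" by (rule zbasis_obtain[OF b'])
    then have "c i = 0" using val ne y by auto
    then have "c(i := 0) = c" by auto
    then show "y \<in> range (\<lambda>c. \<Sum>l\<in>I-{i}. of_int (c l) * b' l)" using ext[of c] c by (intro range_eqI[of _ _ c]) simp
  next
    fix y assume "y \<in> range (\<lambda>c. \<Sum>l\<in>I-{i}. of_int (c l) * b' l)"
    then obtain c where "y = (\<Sum>l\<in>I. of_int ((c(i := 0)) l) * b' l)" using ext by auto
    then show "y \<in> {y \<in> K. f y = 0}" using val zbasis_comb[OF b'] by simp
  qed
  moreover have "c l = 0" if "(\<Sum>l\<in>I-{i}. of_int (c l) * b' l) = 0" "l \<in> I - {i}" for c l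
    using zbasis_indep[OF b', of "c(i := 0)" l] ext[of c] that by auto
  ultimately have "zbasis {y \<in> K. f y = 0} (I - {i}) b'"
    unfolding zbasis_def using fin by (intro conjI allI impI ballI) simp_all
  then show ?thesis by (rule that[OF i])
qed

text \<open>The functionals are imposed one at a time. The dual element of the next one lies in the
  kernel of the earlier ones, where that functional is therefore not zero; so each lowers the rank
  by exactly 1.\<close>

lemma zbasis_kernel:
  fixes f :: "'t \<Rightarrow> 'v::comm_ring_1 \<Rightarrow> int"
  assumes B: "zbasis K I (b :: 'i \<Rightarrow> 'v)" and T: "finite T"
    and f: "\<And>t x y. f t (x + y) = f t x + f t y" "\<And>t c x. f t (of_int c * x) = c * f t x"
    and dual: "\<And>t. t \<in> T \<Longrightarrow> \<exists>g\<in>K. f t g \<noteq> 0 \<and> (\<forall>s\<in>T. s \<noteq> t \<longrightarrow> f s g = 0)"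
  shows "\<exists>(J :: 'i set) b'. zbasis {y \<in> K. \<forall>t\<in>T. f t y = 0} J b' \<and> card J + card T = card I"
  using T dual
proof (induction T rule: finite_induct)
  case empty
  then show ?case using B by (intro exI[of _ I] exI[of _ b]) auto
next
  case (insert t T)
  have "\<exists>(J :: 'i set) b'. zbasis {y \<in> K. \<forall>t\<in>T. f t y = 0} J b' \<and> card J + card T = card I"
    using insert.prems by (intro insert.IH) (meson insertI2)
  then obtain J :: "'i set" and b' where J: "zbasis {y \<in> K. \<forall>t\<in>T. f t y = 0} J b'" "card J + card T = card I" by blast
  obtain g where g: "g \<in> K" "f t g \<noteq> 0" "\<forall>s\<in>Set.insert t T. s \<noteq> t \<longrightarrow> f s g = 0"
    using insert.prems[of t] by blast
  then have "g \<in> {y \<in> K. \<forall>t\<in>T. f t y = 0}" using insert.hyps by auto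
  then obtain i b'' where i: "i \<in> J" "zbasis {y \<in> {y \<in> K. \<forall>t\<in>T. f t y = 0}. f t y = 0} (J - {i}) b''"
    by (rule zbasis_kernel_functional[OF J(1) f]) (use g(2) in auto)
  have e: "{y \<in> {y \<in> K. \<forall>t\<in>T. f t y = 0}. f t y = 0} = {y \<in> K. \<forall>s\<in>Set.insert t T. f s y = 0}" by auto
  have "card (J - {i}) + 1 = card J" using i(1) zbasis_finite[OF J(1)] by (metis Suc_eq_plus1 card.remove)
  then have "card (J - {i}) + card (Set.insert t T) = card I" using J(2) insert.hyps by simp
  then show ?case using i(2) unfolding e by (intro exI conjI)
qed

text \<open>Pigeonhole instead of linear algebra over a residue field: taking coordinates modulo
  \<open>q\<close> sends the \<open>q ^ card J\<close> coefficient families injectively into the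
  \<open>q ^ card I\<close> residue families.\<close>

lemma independent_mod_card_le:
  fixes K :: "'v::comm_ring_1 set" and q :: int
  assumes B: "zbasis K I b" and J: "finite J" and q: "q > 1" and fK: "\<And>j. j \<in> J \<Longrightarrow> f j \<in> K"
    and indep: "\<And>c z j. z \<in> K \<Longrightarrow> (\<Sum>j\<in>J. of_int (c j) * f j) = of_int q * z \<Longrightarrow> j \<in> J \<Longrightarrow> q dvd c j"
  shows "card J \<le> card I"
proof -
  have fin: "finite I" using B zbasis_finite by blast
  have "\<forall>j\<in>J. \<exists>m. f j = (\<Sum>i\<in>I. of_int (m i) * b i)"
  proof
    fix j assume "j \<in> J"
    then obtain m where "f j = (\<Sum>i\<in>I. of_int (m i) * b i)" by (rule zbasis_obtain[OF B fK])
    then show "\<exists>m. f j = (\<Sum>i\<in>I. of_int (m i) * b i)" by (intro exI[of _ m])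
  qed
  then obtain m where m: "\<And>j. j \<in> J \<Longrightarrow> f j = (\<Sum>i\<in>I. of_int (m j i) * b i)" by metis
  define F where "F = (\<lambda>c. \<lambda>i\<in>I. (\<Sum>j\<in>J. c j * m j i) mod q)"
  have "inj_on F (J \<rightarrow>\<^sub>E {0..<q})"
  proof (rule inj_onI)
    fix c d assume c: "c \<in> J \<rightarrow>\<^sub>E {0..<q}" and d: "d \<in> J \<rightarrow>\<^sub>E {0..<q}" and eq: "F c = F d"
    have "\<exists>t. (\<Sum>j\<in>J. (c j - d j) * m j i) = q * t" if "i \<in> I" for i
    proof -
      have "(\<Sum>j\<in>J. c j * m j i) mod q = (\<Sum>j\<in>J. d j * m j i) mod q"
        using fun_cong[OF eq, of i] that unfolding F_def by simp
      then have "q dvd (\<Sum>j\<in>J. c j * m j i) - (\<Sum>j\<in>J. d j * m j i)" by (simp add: mod_eq_dvd_iff)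
      then show ?thesis by (simp add: sum_subtractf left_diff_distrib dvd_def)
    qed
    then obtain t where t: "\<And>i. i \<in> I \<Longrightarrow> (\<Sum>j\<in>J. (c j - d j) * m j i) = q * t i" by metis
    have "(\<Sum>j\<in>J. of_int (c j - d j) * f j) = (\<Sum>j\<in>J. \<Sum>i\<in>I. of_int ((c j - d j) * m j i) * b i)"
      by (rule sum.cong) (simp_all add: m sum_distrib_left mult.assoc)
    also have "\<dots> = (\<Sum>i\<in>I. of_int (\<Sum>j\<in>J. (c j - d j) * m j i) * b i)"
      by (subst sum.swap) (simp add: sum_distrib_right)
    also have "\<dots> = (\<Sum>i\<in>I. of_int (q * t i) * b i)" by (rule sum.cong) (simp_all only: t)
    also have "\<dots> = of_int q * (\<Sum>i\<in>I. of_int (t i) * b i)" by (simp add: sum_distrib_left mult.assoc)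
    finally have dv: "q dvd c j - d j" if "j \<in> J" for j
      by (rule indep[OF zbasis_comb[OF B, of t] _ that])
    show "c = d"
    proof (rule PiE_ext[OF c d])
      fix j assume j: "j \<in> J"
      have "c j mod q = d j mod q" using dv[OF j] by (simp add: mod_eq_dvd_iff)
      moreover have "0 \<le> c j" "c j < q" "0 \<le> d j" "d j < q" using PiE_mem[OF c j] PiE_mem[OF d j] by auto
      ultimately show "c j = d j" by simp
    qed
  qed
  moreover have "F ` (J \<rightarrow>\<^sub>E {0..<q}) \<subseteq> (I \<rightarrow>\<^sub>E {0..<q})" unfolding F_def using q by auto
  moreover have "finite (I \<rightarrow>\<^sub>E {0..<q})" using fin by (intro finite_PiE) auto
  ultimately have "card (J \<rightarrow>\<^sub>E {0..<q}) \<le> card (I \<rightarrow>\<^sub>E {0..<q})" by (rule card_inj_on_le)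
  then have "nat q ^ card J \<le> nat q ^ card I" using fin J by (simp add: card_PiE)
  then show ?thesis using q by (subst (asm) power_increasing_iff) auto
qed

text \<open>The recursion step of the completion: \<open>K\<close> is the sum of \<open>K1\<close>
  and the line of \<open>e t\<close>, and the other vectors are basis vectors of \<open>K1\<close>
  changed by multiples of \<open>e t\<close>, a unitriangular change.\<close>

lemma zbasis_insert:
  assumes B: "zbasis K I b" and B1: "zbasis K1 J d" and t: "t \<notin> J" and sub: "K1 \<subseteq> K"
    and dec: "\<And>x. x \<in> K \<Longrightarrow> \<exists>z\<in>K1. \<exists>n. x = z + of_int n * e t"
    and uniq: "\<And>z n. z \<in> K1 \<Longrightarrow> z + of_int n * e t = 0 \<Longrightarrow> n = 0"
    and et: "e t \<in> K" and ej: "\<And>j. j \<in> J \<Longrightarrow> e j = d j + of_int (C j) * e t"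
  shows "zbasis K (insert t J) e"
proof -
  have fin: "finite J" using B1 zbasis_finite by blast
  have comb: "(\<Sum>i\<in>insert t J. of_int (c i) * e i) =
    (\<Sum>j\<in>J. of_int (c j) * d j) + of_int (c t + (\<Sum>j\<in>J. c j * C j)) * e t" for c
  proof -
    have "(\<Sum>j\<in>J. of_int (c j) * e j) = (\<Sum>j\<in>J. of_int (c j) * d j + of_int (c j * C j) * e t)"
      by (rule sum.cong) (simp_all add: ej algebra_simps)
    then show ?thesis using fin t by (simp add: sum.distrib sum_distrib_left algebra_simps)
  qed
  have 1: "x \<in> range (\<lambda>c. \<Sum>i\<in>insert t J. of_int (c i) * e i)" if "x \<in> K" for x
  proof -
    obtain z n where z: "z \<in> K1" "x = z + of_int n * e t" using dec \<open>x \<in> K\<close> by blast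
    obtain c where c: "z = (\<Sum>j\<in>J. of_int (c j) * d j)" using zbasis_obtain B1 z(1) by blast
    let ?c = "c(t := n - (\<Sum>j\<in>J. c j * C j))"
    have "(\<Sum>j\<in>J. ?c j * C j) = (\<Sum>j\<in>J. c j * C j)" "(\<Sum>j\<in>J. of_int (?c j) * d j) = z"
      unfolding c using t by (auto intro!: sum.cong)
    then have "x = (\<Sum>i\<in>insert t J. of_int (?c i) * e i)" unfolding comb z(2) by simp
    then show ?thesis by (intro range_eqI[of _ _ ?c])
  qed
  have 2: "(\<Sum>i\<in>insert t J. of_int (c i) * e i) \<in> K" for c
    unfolding comb using zbasis_comb[OF B1, of c] sub by (intro zbasis_add[OF B] zbasis_scale[OF B et]) blast
  have 3: "c i = 0" if c: "(\<Sum>i\<in>insert t J. of_int (c i) * e i) = 0" and i: "i \<in> insert t J" for c i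
  proof -
    have n: "c t + (\<Sum>j\<in>J. c j * C j) = 0"
      using uniq[OF zbasis_comb[OF B1, of c]] c unfolding comb by blast
    then have "(\<Sum>j\<in>J. of_int (c j) * d j) = 0" using c unfolding comb by simp
    then have z: "c j = 0" if "j \<in> J" for j using zbasis_indep[OF B1 _ that] by blast
    then have "c t = 0" using n by simp
    then show ?thesis using z i by auto
  qed
  have "K = range (\<lambda>c. \<Sum>i\<in>insert t J. of_int (c i) * e i)"
    using 1 2 by (intro equalityI subsetI) (auto simp del: sum.insert)
  then show ?thesis unfolding zbasis_def using fin 3 by (intro conjI allI impI ballI) simp_all
qed

lemma zbasis_singleton_unit:
  assumes B: "zbasis K {i} b" and u: "u * u = (1::int)" and e: "e j = of_int u * b i"
  shows "zbasis K {j} e"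
proof -
  have "range (\<lambda>c :: 'b \<Rightarrow> int. of_int (c i) * b i) = range (\<lambda>c :: 'c \<Rightarrow> int. of_int (c j) * e j)"
  proof (intro equalityI subsetI; clarify)
    fix c :: "'b \<Rightarrow> int"
    have "of_int (c i) * b i = of_int (c i * (u * u)) * b i" using u by simp
    also have "\<dots> = of_int ((\<lambda>_. c i * u) j) * e j" unfolding e by (simp add: mult.assoc)
    finally show "of_int (c i) * b i \<in> range (\<lambda>c :: 'c \<Rightarrow> int. of_int (c j) * e j)"
      by (intro range_eqI[of _ _ "\<lambda>_. c i * u"]) simp
  next
    fix c :: "'c \<Rightarrow> int"
    have "of_int (c j) * e j = of_int ((\<lambda>_. c j * u) i) * b i" unfolding e by (simp add: mult.assoc)
    then show "of_int (c j) * e j \<in> range (\<lambda>c :: 'b \<Rightarrow> int. of_int (c i) * b i)"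
      by (intro range_eqI[of _ _ "\<lambda>_. c j * u"]) simp
  qed
  moreover have "c j = 0" if "of_int (c j) * e j = 0" for c :: "'c \<Rightarrow> int"
  proof -
    have "c j * u = 0"
      using zbasis_indep[OF B, of "\<lambda>_. c j * u" i] that unfolding e by (simp add: mult.assoc)
    then show ?thesis using u by auto
  qed
  ultimately show ?thesis using B unfolding zbasis_def by simp
qed

text \<open>The vectors are processed from the last one, whose modulus is the largest; it is made primitive
  and split off. As long as two dimensions remain there is room to do so; in dimension one the
  coordinate is only determined modulo the first modulus, and it can be made a unit because
  every unit modulo 3 is congruent to \<open>1\<close> or \<open>-1\<close>.\<close>

lemma zbasis_completion:
  fixes v :: "nat \<Rightarrow> 'v::comm_ring_1" and N :: "nat \<Rightarrow> int"
  assumes "zbasis K (I :: 'i set) b" "card I = m"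
    and "\<And>i. i \<in> {s..<s+m} \<Longrightarrow> v i \<in> K"
    and "\<And>i j. i \<in> {s..<s+m} \<Longrightarrow> j \<in> {s..<s+m} \<Longrightarrow> i \<le> j \<Longrightarrow> N i dvd N j"
    and "m > 0 \<Longrightarrow> \<bar>N s\<bar> = 1 \<or> \<bar>N s\<bar> = 3"
    and "\<And>q c z i. prime q \<Longrightarrow> z \<in> K \<Longrightarrow> (\<Sum>i\<in>{s..<s+m}. of_int (c i) * v i) = of_int q * z \<Longrightarrow>
      (\<And>i. i \<in> {s..<s+m} \<Longrightarrow> \<not> q dvd N i \<Longrightarrow> c i = 0) \<Longrightarrow> i \<in> {s..<s+m} \<Longrightarrow> q dvd c i"
  shows "\<exists>y. (\<forall>i\<in>{s..<s+m}. y i \<in> K) \<and> zbasis K {s..<s+m} (\<lambda>i. v i + of_int (N i) * y i)"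
  using assms
proof (induction m arbitrary: K I b v)
  case 0
  then have "I = {}" using zbasis_finite by fastforce
  then show ?case using 0 unfolding zbasis_def by auto
next
  case (Suc m)
  note B = Suc.prems(1) and vK = Suc.prems(3) and chain = Suc.prems(4) and indep = Suc.prems(6)
  show ?case
  proof (cases "m = 0")
    case True
    have set1: "{s..<s + Suc m} = {s}" using True by auto
    obtain i where I: "I = {i}" using Suc.prems(2) True by (metis One_nat_def card_1_singletonE)
    have Bi: "zbasis K {i} b" using B I by simp
    obtain c where c: "v s = of_int (c i) * b i" using zbasis_obtain[OF Bi, of "v s"] vK set1 by auto
    have "\<exists>t u. c i + N s * t = u \<and> u * u = 1"
    proof (cases "\<bar>N s\<bar> = 1")
      case True
      then have "N s * N s = 1" by (metis abs_mult_self_eq mult_1)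
      then have "c i + N s * (N s * (1 - c i)) = 1" by (simp add: mult.assoc[symmetric])
      then show ?thesis by (metis mult_1)
    next
      case False
      then have N3: "N s = 3 \<or> N s = - 3" using Suc.prems(5) by auto
      \<comment> \<open>Otherwise \<open>v s\<close> is 3 times an element of \<open>K\<close>, and
        independence modulo 3 would make 3 divide the coefficient 1.\<close>
      have "\<not> 3 dvd c i"
      proof
        assume "3 dvd c i"
        then obtain d where d: "c i = 3 * d" by auto
        have "(3::int) dvd 1"
          using indep[of 3 "of_int d * b i" "\<lambda>_. 1" s] zbasis_scale[OF Bi zbasis_mem[OF Bi]] N3
          unfolding set1 by (auto simp: c d mult.assoc)
        then show False by simp
      qed
      then have "(\<exists>t. c i + 3 * t = 1) \<or> (\<exists>t. c i + 3 * t = -1)" by presburger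
      then obtain t where "c i + 3 * t = 1 \<or> c i + 3 * t = -1" by blast
      then have "c i + N s * (if N s = 3 then t else - t) = 1 \<or> c i + N s * (if N s = 3 then t else - t) = -1"
        using N3 by auto
      then show ?thesis by (elim disjE) (rule exI, rule exI, rule conjI, assumption, simp)+
    qed
    then obtain t u where tu: "c i + N s * t = u" "u * u = 1" by blast
    have "v s + of_int (N s) * (of_int t * b i) = of_int u * b i"
      unfolding c tu(1)[symmetric] by (simp add: algebra_simps)
    then have "zbasis K {s} (\<lambda>j. v j + of_int (N j) * (of_int t * b i))"
      by (intro zbasis_singleton_unit[OF Bi tu(2)])
    moreover have "of_int t * b i \<in> K" using zbasis_scale[OF Bi zbasis_mem[OF Bi]] by simp
    ultimately show ?thesis unfolding set1 by (intro exI[of _ "\<lambda>_. of_int t * b i"]) auto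
  next
    case False
    define t where "t = s + m"
    have range_Suc: "{s..<s + Suc m} = insert t {s..<s+m}" unfolding t_def by auto
    have tK: "v t \<in> K" using vK range_Suc by blast
    have finI: "finite I" using B zbasis_finite by blast
    obtain i where i: "i \<in> I" using Suc.prems(2) by fastforce
    \<comment> \<open>The second direction \<open>j\<close> is the room that rank at least 2
      provides.\<close>
    have "card (I - {i}) = m" using i finI Suc.prems(2) by simp
    then obtain j where j: "j \<in> I" "i \<noteq> j" using False by (metis Diff_iff card.empty ex_in_conv singletonI)
    obtain b1 g where B1: "zbasis K I b1" and vt: "v t = of_int g * b1 i"
      using zbasis_align_vector[OF B i tK] by metis
    have b1K: "b1 i \<in> K" "b1 j \<in> K" using zbasis_mem[OF B1] i j by auto
    have "coprime g (N t)"
    proof (rule ccontr)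
      assume "\<not> coprime g (N t)"
      then have "\<bar>gcd g (N t)\<bar> \<noteq> 1" by (simp add: coprime_iff_gcd_eq_1)
      then obtain q where "prime q" "q dvd gcd g (N t)" using prime_factor_int by blast
      then have q: "prime q" "q dvd g" "q dvd N t" by auto
      then obtain h where h: "g = q * h" by auto
      have "(\<Sum>l\<in>{s..<s+Suc m}. of_int (if l = t then 1 else 0) * v l) = (\<Sum>l\<in>{s..<s+Suc m}. if l = t then v l else 0)"
        by (rule sum.cong) auto
      also have "\<dots> = of_int q * (of_int h * b1 i)" using vt h range_Suc by (simp add: mult.assoc)
      finally have eq: "(\<Sum>l\<in>{s..<s+Suc m}. of_int (if l = t then 1 else 0) * v l) = of_int q * (of_int h * b1 i)" .
      have "q dvd (if t = t then 1 else 0)"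
        by (rule indep[OF q(1) zbasis_scale[OF B1 b1K(1)] eq]) (use q range_Suc in auto)
      then show False using q(1) by (simp add: not_prime_unit)
    qed
    then obtain u w where uw: "u * g + w * N t = 1" by (metis bezout_int coprime_iff_gcd_eq_1)
    \<comment> \<open>The allowed change \<open>v t + of_int (N t) * b1 j\<close> of
      \<open>v t\<close> has the coprime coordinates \<open>g\<close> and \<open>N t\<close>, so it
      is primitive and can be made a member of a basis.\<close>
    define b2 where "b2 = b1(i := of_int g * b1 i + of_int (N t) * b1 j, j := of_int (-w) * b1 i + of_int u * b1 j)"
    have B2: "zbasis K I b2" unfolding b2_def
      by (rule zbasis_change_pair[OF B1 i j]) (use uw in \<open>simp add: algebra_simps\<close>)
    have b2i: "b2 i = v t + of_int (N t) * b1 j" unfolding b2_def using j vt by simp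
    define K1 where "K1 = range (\<lambda>c. \<Sum>l\<in>I-{i}. of_int (c l) * b2 l)"
    have split: "(\<Sum>l\<in>I. of_int (c l) * b2 l) = (\<Sum>l\<in>I-{i}. of_int (c l) * b2 l) + of_int (c i) * b2 i" for c
      using i finI by (simp add: sum.remove add.commute)
    have upd: "(\<Sum>l\<in>I-{i}. of_int ((c(i := n)) l) * b2 l) = (\<Sum>l\<in>I-{i}. of_int (c l) * b2 l)" for c n
      by (rule sum.cong) auto
    have uniq: "n = 0 \<and> (\<forall>l\<in>I-{i}. c l = 0)" if "(\<Sum>l\<in>I-{i}. of_int (c l) * b2 l) + of_int n * b2 i = 0" for c n
    proof -
      have "(\<Sum>l\<in>I. of_int ((c(i := n)) l) * b2 l) = 0" using that unfolding split upd by simp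
      then have z: "(c(i := n)) l = 0" if "l \<in> I" for l by (rule zbasis_indep[OF B2 _ that])
      have "c l = 0" if "l \<in> I - {i}" for l using z[of l] that by simp
      then show ?thesis using z[OF i] by simp
    qed
    have BK1: "zbasis K1 (I - {i}) b2"
      unfolding zbasis_def K1_def using finI uniq[of _ 0] by auto
    have subK: "K1 \<subseteq> K"
      unfolding K1_def by (auto intro!: zbasis_sum[OF B2] zbasis_scale[OF B2] zbasis_mem[OF B2])
    have dec: "\<exists>z\<in>K1. \<exists>n. x = z + of_int n * b2 i" if "x \<in> K" for x
      proof -
      obtain c where "x = (\<Sum>l\<in>I. of_int (c l) * b2 l)" using zbasis_obtain[OF B2 \<open>x \<in> K\<close>] .
      then show ?thesis unfolding split K1_def by blast
    qed
    then have "\<forall>l\<in>{s..<s+m}. \<exists>z n. z \<in> K1 \<and> v l = z + of_int n * b2 i" using vK range_Suc by blast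
    \<comment> \<open>From here on \<open>w l\<close> is the component of \<open>v l\<close> in
      \<open>K1\<close>, taken along \<open>b2 i\<close>; the recursion runs on these
      components.\<close>
    then obtain w n where wn: "\<And>l. l \<in> {s..<s+m} \<Longrightarrow> w l \<in> K1 \<and> v l = w l + of_int (n l) * b2 i" by metis
    have "\<exists>y. (\<forall>i\<in>{s..<s+m}. y i \<in> K1) \<and> zbasis K1 {s..<s+m} (\<lambda>i. w i + of_int (N i) * y i)"
    proof (rule Suc.IH[OF BK1])
      show "card (I - {i}) = m" by fact
      show "w l \<in> K1" if "l \<in> {s..<s+m}" for l using wn that by blast
      show "N i dvd N j" if "i \<in> {s..<s+m}" "j \<in> {s..<s+m}" "i \<le> j" for i j using chain that range_Suc by blast
      show "\<bar>N s\<bar> = 1 \<or> \<bar>N s\<bar> = 3" using Suc.prems(5) by simp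
    next
      fix q c z l
      assume q: "prime q" and z: "z \<in> K1" and eq: "(\<Sum>i\<in>{s..<s+m}. of_int (c i) * w i) = of_int q * z"
        and c0: "\<And>i. i \<in> {s..<s+m} \<Longrightarrow> \<not> q dvd N i \<Longrightarrow> c i = 0" and l: "l \<in> {s..<s+m}"
      show "q dvd c l"
      proof (cases "c l = 0")
        case False
        then have "q dvd N l" using c0 l by blast
        then have qt: "q dvd N t" using chain[of l t] l range_Suc by (auto simp: t_def intro: dvd_trans)
        then obtain h where h: "N t = q * h" by auto
        \<comment> \<open>The parts along \<open>b2 i\<close> are compensated by the coefficient
          \<open>- C\<close> at \<open>t\<close>: \<open>b2 i\<close> and \<open>v t\<close> differ
          by a multiple of \<open>N t\<close>, hence of \<open>q\<close>, so the whole sum becomes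
          divisible by \<open>q\<close>.\<close>
        define C where "C = (\<Sum>i\<in>{s..<s+m}. c i * n i)"
        have "(\<Sum>i\<in>{s..<s+m}. of_int (c i) * v i) = of_int q * z + of_int C * b2 i"
        proof -
          have "(\<Sum>l\<in>{s..<s+m}. of_int (c l) * v l) = (\<Sum>l\<in>{s..<s+m}. of_int (c l) * w l + of_int (c l * n l) * b2 i)"
            by (rule sum.cong) (simp_all add: wn algebra_simps)
          then show ?thesis unfolding C_def by (simp add: sum.distrib eq sum_distrib_right)
        qed
        moreover have "(\<Sum>l\<in>{s..<s+m}. of_int ((c(t := - C)) l) * v l) = (\<Sum>l\<in>{s..<s+m}. of_int (c l) * v l)"
          unfolding t_def by (rule sum.cong) auto
        ultimately have sum: "(\<Sum>l\<in>{s..<s+Suc m}. of_int ((c(t := - C)) l) * v l) = of_int q * (z + of_int (C * h) * b1 j)"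
          unfolding range_Suc b2i h by (simp add: t_def algebra_simps)
        have zK: "z + of_int (C * h) * b1 j \<in> K"
          using z subK zbasis_add[OF B2] zbasis_scale[OF B2 b1K(2)] by blast
        have "q dvd (c(t := - C)) l"
        proof (rule indep[OF q zK sum])
          show "(c(t := - C)) i = 0" if "i \<in> {s..<s+Suc m}" "\<not> q dvd N i" for i
            using that c0 qt unfolding range_Suc by auto
          show "l \<in> {s..<s+Suc m}" using l by simp
        qed
        then show ?thesis using l by (simp add: t_def)
      qed simp
    qed
    then obtain y where y: "\<forall>i\<in>{s..<s+m}. y i \<in> K1" and By: "zbasis K1 {s..<s+m} (\<lambda>i. w i + of_int (N i) * y i)"
      by blast
    let ?y = "y(t := b1 j)"
    let ?e = "\<lambda>l. v l + of_int (N l) * ?y l"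
    have et: "?e t = b2 i" using b2i by simp
    have "zbasis K (insert t {s..<s+m}) ?e"
    proof (rule zbasis_insert[OF B2 By _ subK])
      show "t \<notin> {s..<s+m}" unfolding t_def by simp
      show "\<exists>z\<in>K1. \<exists>n. x = z + of_int n * ?e t" if "x \<in> K" for x using dec[OF that] et by simp
      show "n = 0" if "z \<in> K1" "z + of_int n * ?e t = 0" for z n
        using that uniq unfolding et K1_def by blast
      show "?e t \<in> K" unfolding et using zbasis_mem[OF B2 i] .
      show "?e l = w l + of_int (N l) * y l + of_int (n l) * ?e t" if "l \<in> {s..<s+m}" for l
        unfolding et using that wn[OF that] by (auto simp: t_def algebra_simps)
    qed
    moreover have "\<forall>l\<in>{s..<s+Suc m}. ?y l \<in> K" using y subK b1K range_Suc by auto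
    ultimately show ?thesis unfolding range_Suc by blast
  qed
qed

section \<open>Polynomials in an endomorphism\<close>

text \<open>As simplification rules these also expand unapplied functions into abstractions.\<close>

declare zero_fun_apply [simp del] plus_fun_apply [simp del] times_fun_apply [simp del] one_fun_apply [simp del]

lemma of_int_fun_apply: "(of_int c :: 'a \<Rightarrow> int) x = c"
proof -
  have nat: "(of_nat n :: 'a \<Rightarrow> int) x = int n" for n
    by (induction n) (auto simp: zero_fun_apply plus_fun_apply one_fun_apply)
  show ?thesis
  proof (cases c)
    case (nonneg n)
    then show ?thesis by (simp add: nat)
  next
    case (neg n)
    then have "(of_int c :: 'a \<Rightarrow> int) = - (1 + of_nat n)" by simp
    then show ?thesis using nat neg by (simp add: plus_fun_apply one_fun_apply)
  qed
qed

text \<open>As a simplification rule it would turn the scalar \<open>of_int (int r)\<close> into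
  \<open>of_nat r\<close>, which the facts about \<open>of_int\<close> scalars do not match.\<close>

declare of_int_of_nat_eq [simp del]

lemmas fun_apply = zero_fun_apply plus_fun_apply times_fun_apply one_fun_apply of_int_fun_apply

lemma sum_fun_apply: "(\<Sum>i\<in>A. f i) x = (\<Sum>i\<in>A. (f i x :: 'b :: comm_monoid_add))"
  by (induction A rule: infinite_finite_induct) (auto simp: fun_apply)

section \<open>Integer-linear maps and submodules\<close>

definition zlinear :: "('v::comm_ring_1 \<Rightarrow> 'w::comm_ring_1) \<Rightarrow> bool" where
  "zlinear f \<longleftrightarrow> (\<forall>x y. f (x + y) = f x + f y) \<and> (\<forall>c x. f (of_int c * x) = of_int c * f x)"

lemma zlinear_add: "zlinear f \<Longrightarrow> f (x + y) = f x + f y"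
  and zlinear_scale: "zlinear f \<Longrightarrow> f (of_int c * x) = of_int c * f x"
  unfolding zlinear_def by blast+

lemma zlinear_zero: "zlinear f \<Longrightarrow> f 0 = 0"
  using zlinear_scale[of f 0 0] by simp

lemma zlinear_diff: "zlinear f \<Longrightarrow> f (x - y) = f x - f y"
  using zlinear_add[of f x "of_int (-1) * y"] zlinear_scale[of f "-1" y] by simp

lemma zlinear_sum: "zlinear f \<Longrightarrow> f (\<Sum>i\<in>A. g i) = (\<Sum>i\<in>A. f (g i))"
  by (induction A rule: infinite_finite_induct) (auto simp: zlinear_zero zlinear_add)

definition zsubmodule :: "'v::comm_ring_1 set \<Rightarrow> bool" where
  "zsubmodule M \<longleftrightarrow> 0 \<in> M \<and> (\<forall>x\<in>M. \<forall>y\<in>M. x + y \<in> M) \<and> (\<forall>c. \<forall>x\<in>M. of_int c * x \<in> M)"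

lemma zsubmodule_zero: "zsubmodule M \<Longrightarrow> 0 \<in> M"
  and zsubmodule_add: "zsubmodule M \<Longrightarrow> x \<in> M \<Longrightarrow> y \<in> M \<Longrightarrow> x + y \<in> M"
  and zsubmodule_scale: "zsubmodule M \<Longrightarrow> x \<in> M \<Longrightarrow> of_int c * x \<in> M"
  unfolding zsubmodule_def by blast+

lemma zsubmodule_diff: "zsubmodule M \<Longrightarrow> x \<in> M \<Longrightarrow> y \<in> M \<Longrightarrow> x - y \<in> M"
  using zsubmodule_add[of M x "of_int (-1) * y"] zsubmodule_scale[of M y "-1"] by simp

lemma zsubmodule_sum: "zsubmodule M \<Longrightarrow> (\<And>i. i \<in> A \<Longrightarrow> f i \<in> M) \<Longrightarrow> (\<Sum>i\<in>A. f i) \<in> M"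
  by (induction A rule: infinite_finite_induct) (auto simp: zsubmodule_zero zsubmodule_add)

lemma zsubmodule_fsupp: "zsubmodule (fsupp S)"
  unfolding zsubmodule_def fsupp_def by (auto simp: fun_apply)

section \<open>The action of integer polynomials\<close>

lemma poly_act_eq_sum:
  assumes "degree q \<le> n"
  shows "poly_act phi q v = (\<Sum>j\<le>n. of_int (coeff q j) * (phi ^^ j) v)"
proof
  fix x
  have "(\<Sum>j\<le>degree q. coeff q j * (phi ^^ j) v x) = (\<Sum>j\<le>n. coeff q j * (phi ^^ j) v x)"
    using assms by (intro sum.mono_neutral_left) (auto simp: coeff_eq_0)
  then show "poly_act phi q v x = (\<Sum>j\<le>n. of_int (coeff q j) * (phi ^^ j) v) x"
    unfolding poly_act_def by (simp add: sum_fun_apply fun_apply)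
qed

lemma poly_act_pCons:
  assumes "zlinear phi"
  shows "poly_act phi (pCons c q) v = of_int c * v + phi (poly_act phi q v)"
proof -
  have "poly_act phi (pCons c q) v = (\<Sum>j\<le>Suc (degree q). of_int (coeff (pCons c q) j) * (phi ^^ j) v)"
    by (rule poly_act_eq_sum) (rule degree_pCons_le)
  also have "\<dots> = of_int c * v + (\<Sum>j\<le>degree q. of_int (coeff q j) * phi ((phi ^^ j) v))"
    by (simp add: sum.atMost_Suc_shift del: sum.atMost_Suc)
  also have "(\<Sum>j\<le>degree q. of_int (coeff q j) * phi ((phi ^^ j) v)) = phi (poly_act phi q v)"
    unfolding poly_act_eq_sum[OF order_refl] zlinear_sum[OF assms] zlinear_scale[OF assms] ..
  finally show ?thesis .
qed

lemma poly_act_0 [simp]: "poly_act phi 0 v = 0"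
  unfolding poly_act_def by (auto simp: fun_apply)

lemma poly_act_add: "poly_act phi (p + q) v = poly_act phi p v + poly_act phi q v"
proof -
  let ?n = "max (degree p) (degree q)"
  have "degree (p + q) \<le> ?n" by (rule degree_add_le_max)
  then show ?thesis
    by (simp add: poly_act_eq_sum[of _ ?n] sum.distrib[symmetric] algebra_simps)
qed

lemma poly_act_smult: "poly_act phi (smult c q) v = of_int c * poly_act phi q v"
  by (simp add: poly_act_eq_sum[of _ "degree q"] degree_smult_le sum_distrib_left mult.assoc)

lemma poly_act_diff: "poly_act phi (p - q) v = poly_act phi p v - poly_act phi q v"
  using poly_act_add[of phi p "smult (-1) q" v] poly_act_smult[of phi "-1" q v] by simp

lemma poly_act_sum: "poly_act phi (\<Sum>i\<in>A. f i) v = (\<Sum>i\<in>A. poly_act phi (f i) v)"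
  by (induction A rule: infinite_finite_induct) (auto simp: poly_act_add)

lemma poly_act_const: "poly_act phi [:c:] v = of_int c * v"
  by (simp add: poly_act_eq_sum[of _ 0])

lemma poly_act_one [simp]: "poly_act phi 1 v = v"
  using poly_act_const[of phi 1 v] by (simp add: one_pCons)

lemma poly_act_x: "zlinear phi \<Longrightarrow> poly_act phi [:0, 1:] v = phi v"
  by (simp add: poly_act_pCons poly_act_const zlinear_zero)

lemma zlinear_poly_act:
  assumes "zlinear phi"
  shows "zlinear (poly_act phi q)"
proof (induction q)
  case 0
  show ?case unfolding zlinear_def by simp
next
  case (pCons c q)
  have "poly_act phi (pCons c q) (x + y) = poly_act phi (pCons c q) x + poly_act phi (pCons c q) y" for x y
    by (simp add: poly_act_pCons[OF assms] zlinear_add[OF assms] zlinear_add[OF pCons.IH] algebra_simps)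
  moreover have "poly_act phi (pCons c q) (of_int n * x) = of_int n * poly_act phi (pCons c q) x" for n x
    by (simp add: poly_act_pCons[OF assms] zlinear_scale[OF assms] zlinear_scale[OF pCons.IH] distrib_left mult.left_commute)
  ultimately show ?case unfolding zlinear_def by blast
qed

lemma poly_act_mult:
  assumes "zlinear phi"
  shows "poly_act phi (p * q) v = poly_act phi p (poly_act phi q v)"
proof (induction p)
  case (pCons c p)
  have "pCons c p * q = smult c q + pCons 0 (p * q)" by simp
  then show ?case
    by (simp add: poly_act_add poly_act_smult poly_act_pCons[OF assms] pCons.IH)
qed simp

lemma poly_act_commute:
  assumes "zlinear phi"
  shows "poly_act phi p (poly_act phi q v) = poly_act phi q (poly_act phi p v)"
  by (simp add: poly_act_mult[OF assms, symmetric] mult.commute)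

lemma poly_act_closed:
  assumes "zlinear phi" "zsubmodule M" "\<And>v. v \<in> M \<Longrightarrow> phi v \<in> M" "v \<in> M"
  shows "poly_act phi q v \<in> M"
  by (induction q) (auto simp: poly_act_pCons[OF assms(1)] assms zsubmodule_zero zsubmodule_add zsubmodule_scale)

lemma poly_act_intertwine:
  assumes "zlinear phi" "zlinear psi" "zlinear f" "zsubmodule M" "\<And>v. v \<in> M \<Longrightarrow> phi v \<in> M"
    and "\<And>v. v \<in> M \<Longrightarrow> f (phi v) = psi (f v)" and "v \<in> M"
  shows "f (poly_act phi q v) = poly_act psi q (f v)"
proof (induction q)
  case 0
  then show ?case using assms(3) by (simp add: zlinear_zero)
next
  case (pCons c q)
  have "poly_act phi q v \<in> M" by (rule poly_act_closed[OF assms(1,4,5,7)])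
  then show ?case
    by (simp add: poly_act_pCons[OF assms(1)] poly_act_pCons[OF assms(2)] zlinear_add[OF assms(3)]
        zlinear_scale[OF assms(3)] assms(6) pCons.IH)
qed

lemma poly_act_shift:
  assumes "zlinear phi" "zlinear psi" "zsubmodule M" "\<And>v. v \<in> M \<Longrightarrow> phi v \<in> M"
    and "\<And>v. v \<in> M \<Longrightarrow> psi v = phi v + of_int r * v" and "v \<in> M"
  shows "poly_act psi q v = poly_act phi (q \<circ>\<^sub>p [:r, 1:]) v"
proof (induction q)
  case (pCons c q)
  have "poly_act phi (q \<circ>\<^sub>p [:r, 1:]) v \<in> M" by (rule poly_act_closed[OF assms(1,3,4,6)])
  moreover have "poly_act phi [:r, 1:] w = phi w + of_int r * w" for w
    by (simp add: poly_act_pCons[OF assms(1)] poly_act_const zlinear_zero[OF assms(1)])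
  ultimately show ?case
    by (simp only: pcompose_pCons poly_act_add poly_act_mult[OF assms(1)] poly_act_const
        poly_act_pCons[OF assms(2)] pCons.IH assms(5))
qed simp

text \<open>\<open>M\<close> is the direct sum of the cyclic modules generated by the \<open>v i\<close>, with annihilators \<open>(a i)\<close>.
  Unlike in \<^const>\<open>has_rcf_Z\<close>, constant \<open>a i\<close>, that is zero summands, are allowed.\<close>

definition cyclic_decomp ::
  "('a \<Rightarrow> int) set \<Rightarrow> (('a \<Rightarrow> int) \<Rightarrow> ('a \<Rightarrow> int)) \<Rightarrow> nat \<Rightarrow> (nat \<Rightarrow> 'a \<Rightarrow> int) \<Rightarrow> (nat \<Rightarrow> int poly) \<Rightarrow> bool" where
  "cyclic_decomp M phi k v a \<longleftrightarrow>
     (\<forall>i<k. v i \<in> M \<and> poly_act phi (a i) (v i) = 0 \<and> lead_coeff (a i) = 1) \<and>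
     (\<forall>i. Suc i < k \<longrightarrow> a i dvd a (Suc i)) \<and>
     (\<forall>m\<in>M. \<exists>q. m = (\<Sum>i<k. poly_act phi (q i) (v i))) \<and>
     (\<forall>q. (\<Sum>i<k. poly_act phi (q i) (v i)) = 0 \<longrightarrow> (\<forall>i<k. a i dvd q i))"

lemma cyclic_decompD:
  assumes "cyclic_decomp M phi k v a"
  shows "i < k \<Longrightarrow> v i \<in> M" "i < k \<Longrightarrow> poly_act phi (a i) (v i) = 0" "i < k \<Longrightarrow> lead_coeff (a i) = 1"
    "(\<Sum>i<k. poly_act phi (q i) (v i)) = 0 \<Longrightarrow> i < k \<Longrightarrow> a i dvd q i"
  using assms unfolding cyclic_decomp_def by blast+

lemma cyclic_decomp_obtain:
  assumes "cyclic_decomp M phi k v a" "m \<in> M"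
  obtains q where "m = (\<Sum>i<k. poly_act phi (q i) (v i))"
  using assms unfolding cyclic_decomp_def by blast

lemma cyclic_decomp_chain:
  assumes "cyclic_decomp M phi k v a" "i \<le> j" "j < k"
  shows "a i dvd a j"
  using assms(2,3)
proof (induction j rule: dec_induct)
  case (step n)
  then have "a i dvd a n" "a n dvd a (Suc n)" using assms(1) unfolding cyclic_decomp_def by auto
  then show ?case by (rule dvd_trans)
qed simp

lemma cyclic_decomp_annihilates:
  assumes C: "cyclic_decomp M phi k v a" and i: "i < k" and q: "poly_act phi q (v i) = 0"
  shows "a i dvd q"
proof -
  have "(\<Sum>j<k. poly_act phi (if j = i then q else 0) (v j)) = 0"
    by (rule sum.neutral) (auto simp: q)
  then have "a i dvd (if i = i then q else 0)" by (rule cyclic_decompD(4)[OF C _ i])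
  then show ?thesis by simp
qed

lemma sum_lessThan_add: "(\<Sum>i<t+k. f i) = (\<Sum>i<t. f i) + (\<Sum>i<k. f (t + i) :: 'b :: comm_monoid_add)" for t k :: nat
  by (induction k) (auto simp: add.assoc)

text \<open>The induction step needs as many generators as the kernel has rank. Zero summands in
  front, with annihilator 1, make up the number; their lifts may be arbitrary kernel
  elements.\<close>

lemma cyclic_decomp_pad:
  assumes C: "cyclic_decomp M phi k v a" and M: "zsubmodule M" and phi: "zlinear phi"
  shows "cyclic_decomp M phi (t + k) (\<lambda>i. if i < t then 0 else v (i - t)) (\<lambda>i. if i < t then 1 else a (i - t))"
proof -
  have z: "poly_act phi q 0 = 0" for q using zlinear_zero[OF zlinear_poly_act[OF phi]] .
  have s: "(\<Sum>i<t+k. poly_act phi (q i) (if i < t then 0 else v (i - t))) = (\<Sum>i<k. poly_act phi (q (t + i)) (v i))" for q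
    unfolding sum_lessThan_add by (simp add: z)
  have "\<exists>q. m = (\<Sum>i<t+k. poly_act phi (q i) (if i < t then 0 else v (i - t)))" if m: "m \<in> M" for m
  proof -
    obtain q where "m = (\<Sum>i<k. poly_act phi (q i) (v i))" using cyclic_decomp_obtain[OF C m] .
    then show ?thesis unfolding s by (intro exI[of _ "\<lambda>i. q (i - t)"]) simp
  qed
  moreover have "(if i < t then 1 else a (i - t)) dvd q i"
    if "(\<Sum>i<t+k. poly_act phi (q i) (if i < t then 0 else v (i - t))) = 0" "i < t + k" for q i
    using cyclic_decompD(4)[OF C, of "\<lambda>i. q (t + i)" "i - t"] that unfolding s by auto
  moreover have "(if i < t then 1 else a (i - t)) dvd (if Suc i < t then 1 else a (Suc i - t))" if "Suc i < t + k" for i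
    using cyclic_decomp_chain[OF C, of "i - t" "Suc i - t"] that by auto
  moreover have "(if i < t then 0 else v (i - t)) \<in> M \<and>
      poly_act phi (if i < t then 1 else a (i - t)) (if i < t then 0 else v (i - t)) = 0 \<and>
      lead_coeff (if i < t then 1 else a (i - t)) = 1" if "i < t + k" for i
    using cyclic_decompD(1-3)[OF C, of "i - t"] that zsubmodule_zero[OF M] by auto
  ultimately show ?thesis unfolding cyclic_decomp_def by blast
qed

lemma cyclic_decomp_drop:
  assumes C: "cyclic_decomp M phi (t + k) v a" and one: "\<And>i. i < t \<Longrightarrow> a i = 1" and phi: "zlinear phi"
  shows "cyclic_decomp M phi k (\<lambda>i. v (t + i)) (\<lambda>i. a (t + i))"
proof -
  have v0: "v i = 0" if "i < t" for i using cyclic_decompD(2)[OF C, of i] one[OF that] that by simp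
  have z: "poly_act phi q 0 = 0" for q using zlinear_zero[OF zlinear_poly_act[OF phi]] .
  have s: "(\<Sum>i<t+k. poly_act phi (q i) (v i)) = (\<Sum>i<k. poly_act phi (q (t + i)) (v (t + i)))" for q
    unfolding sum_lessThan_add by (simp add: z v0)
  have "\<exists>q. m = (\<Sum>i<k. poly_act phi (q i) (v (t + i)))" if m: "m \<in> M" for m
  proof -
    obtain q where "m = (\<Sum>i<t+k. poly_act phi (q i) (v i))" using cyclic_decomp_obtain[OF C m] .
    then show ?thesis unfolding s by (intro exI[of _ "\<lambda>i. q (t + i)"])
  qed
  moreover have "a (t + i) dvd q i"
    if "(\<Sum>i<k. poly_act phi (q i) (v (t + i))) = 0" "i < k" for q i
    using cyclic_decompD(4)[OF C, of "\<lambda>i. q (i - t)" "t + i"] that unfolding s by auto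
  moreover have "a (t + i) dvd a (t + Suc i)" if "Suc i < k" for i
    using cyclic_decomp_chain[OF C, of "t + i" "t + Suc i"] that by auto
  moreover have "v (t + i) \<in> M \<and> poly_act phi (a (t + i)) (v (t + i)) = 0 \<and> lead_coeff (a (t + i)) = 1" if "i < k" for i
    using cyclic_decompD(1-3)[OF C, of "t + i"] that by auto
  ultimately show ?thesis unfolding cyclic_decomp_def by blast
qed

lemma down_closed_eq_lessThan:
  fixes S :: "nat set"
  assumes "finite S" and d: "\<And>i j. j \<in> S \<Longrightarrow> i \<le> j \<Longrightarrow> i \<in> S"
  shows "S = {..<card S}"
proof -
  define m where "m = (LEAST i. i \<notin> S)"
  have "\<exists>i. i \<notin> S" using assms(1) ex_new_if_finite infinite_UNIV_nat by blast
  then have m: "m \<notin> S" unfolding m_def by (rule LeastI_ex)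
  have "S = {..<m}"
  proof (intro equalityI subsetI)
    fix i assume "i \<in> S"
    then show "i \<in> {..<m}" using d[of i m] m by (cases "m \<le> i") auto
  next
    fix i assume "i \<in> {..<m}"
    then show "i \<in> S" using not_less_Least[of i "\<lambda>i. i \<notin> S"] unfolding m_def by auto
  qed
  then show ?thesis by simp
qed

text \<open>A monic constant is 1, and the divisor chain puts all of these in an initial segment,
  which \<open>cyclic_decomp_drop\<close> removes.\<close>

lemma cyclic_decomp_nonconstant:
  assumes C: "cyclic_decomp M phi k v a" and phi: "zlinear phi"
  obtains k' v' a' where "cyclic_decomp M phi k' v' a'" "\<And>i. i < k' \<Longrightarrow> degree (a' i) \<ge> 1"
proof -
  have down: "a i = 1" if "i \<le> j" "j < k" "a j = 1" for i j
  proof -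
    have "a i dvd 1" using cyclic_decomp_chain[OF C that(1,2)] that(3) by simp
    then obtain c where "a i = [:c:]" "c dvd 1" by (auto simp: is_unit_poly_iff)
    moreover have "lead_coeff (a i) = 1" using cyclic_decompD(3)[OF C] that by simp
    ultimately show ?thesis by (simp add: one_pCons)
  qed
  define S where "S = {i \<in> {..<k}. a i = 1}"
  define t where "t = card S"
  have "S = {..<t}"
    unfolding t_def by (rule down_closed_eq_lessThan) (use down in \<open>auto simp: S_def\<close>)
  then have St: "i < k \<and> a i = 1 \<longleftrightarrow> i < t" for i unfolding S_def by auto
  have "t \<le> k" unfolding t_def S_def using card_mono[of "{..<k}" "{i \<in> {..<k}. a i = 1}"] by auto
  then obtain k' where k: "k = t + k'" using le_Suc_ex by blast
  have "cyclic_decomp M phi k' (\<lambda>i. v (t + i)) (\<lambda>i. a (t + i))"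
    using C St phi unfolding k by (intro cyclic_decomp_drop) auto
  moreover have "degree (a (t + i)) \<ge> 1" if "i < k'" for i
  proof (rule ccontr)
    assume "\<not> degree (a (t + i)) \<ge> 1"
    then have "degree (a (t + i)) = 0" by simp
    then obtain c where "a (t + i) = [:c:]" by (rule degree_eq_zeroE)
    moreover have "lead_coeff (a (t + i)) = 1" using cyclic_decompD(3)[OF C] that k by simp
    ultimately have "a (t + i) = 1" by (simp add: one_pCons)
    then have "t + i < t" using St[of "t + i"] that k by simp
    then show False by simp
  qed
  ultimately show ?thesis by (rule that)
qed

section \<open>Comparison with \<open>has_rcf_Z\<close>\<close>

lemma fun_sum_eq: "(\<lambda>x. \<Sum>i\<in>A. (f i x :: int)) = (\<Sum>i\<in>A. f i)"
  by (auto simp: sum_fun_apply)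

lemma has_rcf_Z_imp_cyclic_decomp:
  assumes rcf: "has_rcf_Z M phi" and M: "zsubmodule M" and phi: "zlinear phi"
  shows "\<exists>k v a. cyclic_decomp M phi k v a"
proof -
  obtain k V a where cyc': "\<forall>i<k. is_cyclic_Zx_submodule M phi (V i)"
    and uniq': "\<forall>m\<in>M. \<exists>!vs. (\<forall>i<k. vs i \<in> V i) \<and> (\<forall>i\<ge>k. vs i = (\<lambda>_. 0)) \<and> m = (\<lambda>x. \<Sum>i<k. vs i x)"
    and ann': "\<forall>i<k. annihilator phi (V i) = {q. a i dvd q}"
    and lead: "\<forall>i<k. lead_coeff (a i) = 1 \<and> degree (a i) \<ge> 1"
    and chain: "\<forall>i. Suc i < k \<longrightarrow> a i dvd a (Suc i)"
    using rcf unfolding has_rcf_Z_def by (elim exE conjE) (rule that)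
  note cyc = cyc'[rule_format] and uniq = bspec[OF uniq'] and ann = ann'[rule_format]
  have "\<forall>i\<in>{..<k}. \<exists>w. w \<in> V i \<and> V i = {poly_act phi q w | q. True}"
    using cyc unfolding is_cyclic_Zx_submodule_def Bex_def lessThan_iff by (intro ballI) blast
  then obtain v where v: "\<And>i. i < k \<Longrightarrow> v i \<in> V i \<and> V i = {poly_act phi q (v i) | q. True}"
    unfolding Ball_def by (metis lessThan_iff)
  have VM: "V i \<subseteq> M" if "i < k" for i
    using cyc[OF that] unfolding is_cyclic_Zx_submodule_def is_Zx_submodule_def by blast
  have span: "\<exists>q. m = (\<Sum>i<k. poly_act phi (q i) (v i))" if m: "m \<in> M" for m
  proof -
    obtain vs where vs: "\<forall>i<k. vs i \<in> V i" "m = (\<lambda>x. \<Sum>i<k. vs i x)" using uniq[OF m] by blast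
    have "\<forall>i\<in>{..<k}. \<exists>q. vs i = poly_act phi q (v i)" using vs(1) v by fastforce
    then obtain q where "\<And>i. i < k \<Longrightarrow> vs i = poly_act phi (q i) (v i)" unfolding Ball_def by (metis lessThan_iff)
    then have "m = (\<Sum>i<k. poly_act phi (q i) (v i))" unfolding vs(2) fun_sum_eq by (intro sum.cong) auto
    then show ?thesis by blast
  qed
  have rel: "a i dvd q i" if eq: "(\<Sum>i<k. poly_act phi (q i) (v i)) = 0" and i: "i < k" for q i
  proof -
    let ?vs = "\<lambda>i. if i < k then poly_act phi (q i) (v i) else (\<lambda>_. 0)"
    have z: "(0 :: 'a \<Rightarrow> int) = (\<lambda>_. 0)" by (auto simp: fun_apply)
    have 1: "(\<forall>i<k. ?vs i \<in> V i) \<and> (\<forall>i\<ge>k. ?vs i = (\<lambda>_. 0)) \<and> 0 = (\<lambda>x. \<Sum>i<k. ?vs i x)"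
    proof (intro conjI allI impI)
      show "?vs i \<in> V i" if "i < k" for i using v[OF that] that by auto
      show "?vs i = (\<lambda>_. 0)" if "k \<le> i" for i using that by simp
      have "(\<Sum>i<k. ?vs i) = (\<Sum>i<k. poly_act phi (q i) (v i))" by (rule sum.cong) auto
      then show "0 = (\<lambda>x. \<Sum>i<k. ?vs i x)" using eq unfolding fun_sum_eq by simp
    qed
    have 2: "(\<forall>i<k. (\<lambda>_. 0) \<in> V i) \<and> (\<forall>i\<ge>k. (\<lambda>_ :: 'a. (0::int)) = (\<lambda>_. 0)) \<and> 0 = (\<lambda>x :: 'a. \<Sum>i<k. (0::int))"
      using cyc unfolding is_cyclic_Zx_submodule_def is_Zx_submodule_def by (auto simp: z)
    \<comment> \<open>The family \<open>?vs\<close> and the zero family both decompose 0, so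
      uniqueness identifies them.\<close>
    note unique = the1_equality[OF uniq[OF zsubmodule_zero[OF M]]]
    have "?vs = (\<lambda>_ _. 0)" by (rule trans[OF unique[OF 1, symmetric] unique[OF 2]])
    then have "?vs i = (\<lambda>_. 0)" by (rule fun_cong)
    then have qv: "poly_act phi (q i) (v i) = 0" using i z by simp
    have "poly_act phi (q i) w = (\<lambda>_. 0)" if "w \<in> V i" for w
    proof -
      obtain p where "w = poly_act phi p (v i)" using v[OF i] \<open>w \<in> V i\<close> by blast
      then have "poly_act phi (q i) w = poly_act phi p 0" using poly_act_commute[OF phi] qv by metis
      then show ?thesis using zlinear_zero[OF zlinear_poly_act[OF phi]] z by simp
    qed
    then have "q i \<in> annihilator phi (V i)" unfolding annihilator_def by blast
    then show ?thesis using ann[OF i] by blast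
  qed
  have kill: "poly_act phi (a i) (v i) = 0" if "i < k" for i
  proof -
    have "a i \<in> annihilator phi (V i)" using ann[OF that] by simp
    then show ?thesis using v[OF that] unfolding annihilator_def by (auto simp: zero_fun_def)
  qed
  have vM: "v i \<in> M" if "i < k" for i using v VM that by blast
  have "cyclic_decomp M phi k v a"
    unfolding cyclic_decomp_def by (intro conjI allI impI ballI) (simp_all add: vM kill lead chain span rel)
  then show ?thesis by blast
qed

lemma cyclic_decomp_imp_has_rcf_Z:
  assumes C: "cyclic_decomp M phi k v a" and M: "zsubmodule M" and phi: "zlinear phi"
    and inv: "\<And>v. v \<in> M \<Longrightarrow> phi v \<in> M"
  shows "has_rcf_Z M phi"
proof -
  \<comment> \<open>\<open>has_rcf_Z\<close> forbids constant annihilators, so the decomposition is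
    replaced by one without zero summands.\<close>
  obtain k v a where C: "cyclic_decomp M phi k v a" and deg: "\<And>i. i < k \<Longrightarrow> degree (a i) \<ge> 1"
    by (rule cyclic_decomp_nonconstant[OF C phi]) (rule that)
  define V where "V = (\<lambda>i. {poly_act phi q (v i) | q. True})"
  have VI: "poly_act phi q (v i) \<in> V i" for q i unfolding V_def by blast
  have plus: "(\<lambda>x. f x + g x) = f + g" and scale: "(\<lambda>x. c * f x) = of_int c * f" for f g :: "'a \<Rightarrow> int" and c by (auto simp: fun_apply)
  have cyc: "is_cyclic_Zx_submodule M phi (V i)" if "i < k" for i
  proof -
    have "v i \<in> M" using cyclic_decompD(1)[OF C that] .
    then have sub: "V i \<subseteq> M" unfolding V_def using poly_act_closed[OF phi M inv] by blast
    have z: "(\<lambda>_. 0) \<in> V i" using VI[of 0 i] by (simp add: zero_fun_def)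
    have vin: "v i \<in> V i" using VI[of 1 i] by simp
    have add: "f + g \<in> V i" if "f \<in> V i" "g \<in> V i" for f g
      using that unfolding V_def by (clarsimp simp: poly_act_add[symmetric]) blast
    have sc: "of_int c * f \<in> V i" if "f \<in> V i" for f c
      using that unfolding V_def by (clarsimp simp: poly_act_smult[symmetric]) blast
    have "phi f \<in> V i" if "f \<in> V i" for f
    proof -
      obtain q where "f = poly_act phi q (v i)" using \<open>f \<in> V i\<close> unfolding V_def by blast
      then have "phi f = poly_act phi ([:0,1:] * q) (v i)" using poly_act_mult[OF phi] poly_act_x[OF phi] by metis
      then show ?thesis using VI by metis
    qed
    then have "is_Zx_submodule M phi (V i)"
      unfolding is_Zx_submodule_def plus scale using sub z add sc by blast
    then show ?thesis unfolding is_cyclic_Zx_submodule_def using vin V_def by blast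
  qed
  have dvd_zero: "poly_act phi q (v i) = 0" if "a i dvd q" "i < k" for q i
  proof -
    from \<open>a i dvd q\<close> obtain h where "q = a i * h" by (rule dvdE)
    then have "q = h * a i" by (simp add: mult.commute)
    then show ?thesis
      using cyclic_decompD(2)[OF C that(2)] zlinear_zero[OF zlinear_poly_act[OF phi]]
      by (simp add: poly_act_mult[OF phi])
  qed
  have ann: "annihilator phi (V i) = {q. a i dvd q}" if i: "i < k" for i
  proof (intro equalityI subsetI CollectI)
    fix q assume "q \<in> annihilator phi (V i)"
    then have "poly_act phi q (v i) = 0" using VI[of 1 i] unfolding annihilator_def by (auto simp: zero_fun_def)
    then show "a i dvd q" by (rule cyclic_decomp_annihilates[OF C i])
  next
    fix q assume "q \<in> {q. a i dvd q}"
    then have d: "a i dvd q" by simp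
    have "poly_act phi q w = (\<lambda>_. 0)" if "w \<in> V i" for w
    proof -
      obtain p where "w = poly_act phi p (v i)" using \<open>w \<in> V i\<close> unfolding V_def by blast
      then have "poly_act phi q w = poly_act phi (q * p) (v i)" using poly_act_mult[OF phi] by metis
      then show ?thesis using dvd_zero[of i "q * p"] d i by (simp add: zero_fun_def)
    qed
    then show "q \<in> annihilator phi (V i)" unfolding annihilator_def by blast
  qed
  have uniq: "\<exists>!vs. (\<forall>i<k. vs i \<in> V i) \<and> (\<forall>i\<ge>k. vs i = (\<lambda>_. 0)) \<and> m = (\<lambda>x. \<Sum>i<k. vs i x)" if m: "m \<in> M" for m
  proof -
    obtain q where q: "m = (\<Sum>i<k. poly_act phi (q i) (v i))" using cyclic_decomp_obtain[OF C m] .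
    let ?vs = "\<lambda>i. if i < k then poly_act phi (q i) (v i) else (\<lambda>_. 0)"
    show ?thesis
    proof (rule ex1I[of _ ?vs])
      show "(\<forall>i<k. ?vs i \<in> V i) \<and> (\<forall>i\<ge>k. ?vs i = (\<lambda>_. 0)) \<and> m = (\<lambda>x. \<Sum>i<k. ?vs i x)"
        unfolding fun_sum_eq q using VI by auto
    next
      fix vs assume vs: "(\<forall>i<k. vs i \<in> V i) \<and> (\<forall>i\<ge>k. vs i = (\<lambda>_. 0)) \<and> m = (\<lambda>x. \<Sum>i<k. vs i x)"
      have "\<forall>i\<in>{..<k}. \<exists>p. vs i = poly_act phi p (v i)" using vs unfolding V_def by blast
      then obtain p where p: "\<And>i. i < k \<Longrightarrow> vs i = poly_act phi (p i) (v i)" unfolding Ball_def by (metis lessThan_iff)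
      have "m = (\<Sum>i<k. poly_act phi (p i) (v i))" using vs p unfolding fun_sum_eq by (auto intro!: sum.cong)
      then have "(\<Sum>i<k. poly_act phi (p i - q i) (v i)) = 0" using q by (simp add: poly_act_diff sum_subtractf)
      then have "a i dvd p i - q i" if "i < k" for i by (rule cyclic_decompD(4)[OF C _ that])
      then have "poly_act phi (p i - q i) (v i) = 0" if "i < k" for i using dvd_zero that by blast
      then have e: "poly_act phi (p i) (v i) = poly_act phi (q i) (v i)" if "i < k" for i
        using that by (simp add: poly_act_diff)
      show "vs = ?vs"
      proof
        fix i show "vs i = ?vs i" using p[of i] e[of i] vs by (cases "i < k") auto
      qed
    qed
  qed
  show ?thesis unfolding has_rcf_Z_def
  proof (intro exI[of _ k] exI[of _ V] exI[of _ a] conjI allI impI ballI)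
    show "a i dvd a (Suc i)" if "Suc i < k" for i using cyclic_decomp_chain[OF C _ that] by simp
    show "\<exists>!vs. (\<forall>i<k. vs i \<in> V i) \<and> (\<forall>i\<ge>k. vs i = (\<lambda>_. 0)) \<and> m = (\<lambda>x. \<Sum>i<k. vs i x)" if "m \<in> M" for m
      by (rule uniq[OF that])
  qed (fact cyc ann deg cyclic_decompD(3)[OF C])+
qed

section \<open>Extending a decomposition along \<open>D\<close>\<close>

text \<open>Pseudo-division scales the dividend by a power of the leading coefficient, which is 1
  here.\<close>

lemma monic_division:
  fixes a q :: "int poly"
  assumes "lead_coeff a = 1"
  obtains h r where "q = a * h + r" "r = 0 \<or> degree r < degree a"
proof -
  obtain h r where "pseudo_divmod q a = (h, r)" by force
  moreover have "a \<noteq> 0" using assms by auto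
  ultimately show ?thesis using pseudo_divmod[of a q h r] assms that[of h r] by auto
qed

text \<open>With \<open>q\<close> reduced modulo \<open>a\<close> the difference has degree below
  that of \<open>a\<close>, so divisibility makes it zero; then compare coefficients at the leading
  term of the monic \<open>b\<close>.\<close>

lemma monic_dvd_imp_dvd_coeff:
  fixes a b q :: "int poly"
  assumes a: "lead_coeff a = 1" and b: "lead_coeff b = 1" and deg: "degree b < degree a"
    and dvd: "a dvd smult c b - smult p q"
  shows "p dvd c"
proof -
  obtain h r where hr: "q = a * h + r" "r = 0 \<or> degree r < degree a" using monic_division[OF a] .
  let ?d = "smult c b - smult p r"
  have e: "?d = (smult c b - smult p q) + a * smult p h" unfolding hr(1) by (simp add: smult_add_right)
  have d: "a dvd ?d" unfolding e by (rule dvd_add[OF dvd dvd_triv_left])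
  have "degree (smult p r) < degree a" using hr(2) deg degree_smult_le[of p r] by auto
  moreover have "degree (smult c b) < degree a" using deg degree_smult_le[of c b] by simp
  ultimately have "degree ?d < degree a" by (simp add: degree_diff_less)
  then have "?d = 0" using dvd_imp_degree_le[OF d] by fastforce
  then have "coeff (smult c b) (degree b) = coeff (smult p r) (degree b)" by simp
  then show ?thesis using b by simp
qed

text \<open>A monic polynomial of degree below that of \<open>a i\<close> stays nonzero modulo
  \<open>a i\<close> and any prime. This serves the tails of the \<open>a i\<close> in
  \<open>lifts_independent_mod\<close> and their cofactors in \<open>card_roots_le\<close>.\<close>

lemma cyclic_decomp_indep_mod:
  assumes C: "cyclic_decomp M phi k v a" and T: "T \<subseteq> {..<k}" and y: "y \<in> M"
    and eq: "(\<Sum>i\<in>T. of_int (c i) * poly_act phi (g i) (v i)) = of_int q * y" and i: "i \<in> T"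
    and g: "lead_coeff (g i) = 1" "degree (g i) < degree (a i)"
  shows "q dvd c i"
proof -
  obtain p where p: "y = (\<Sum>i<k. poly_act phi (p i) (v i))" using cyclic_decomp_obtain[OF C y] .
  have "(\<Sum>i\<in>T. of_int (c i) * poly_act phi (g i) (v i)) = (\<Sum>i\<in>T. poly_act phi (smult (c i) (g i)) (v i))"
    by (simp add: poly_act_smult)
  also have "\<dots> = (\<Sum>i<k. poly_act phi (if i \<in> T then smult (c i) (g i) else 0) (v i))"
    using T by (intro sum.mono_neutral_cong_left) auto
  finally have "(\<Sum>i<k. poly_act phi ((if i \<in> T then smult (c i) (g i) else 0) - smult q (p i)) (v i)) = 0"
    using eq unfolding p by (simp only: poly_act_diff poly_act_smult sum_subtractf sum_distrib_left) simp
  then have "a i dvd (if i \<in> T then smult (c i) (g i) else 0) - smult q (p i)"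
    by (rule cyclic_decompD(4)[OF C]) (use i T in auto)
  then have dvd: "a i dvd smult (c i) (g i) - smult q (p i)" using i by simp
  have "lead_coeff (a i) = 1" using cyclic_decompD(3)[OF C] i T by auto
  then show ?thesis by (rule monic_dvd_imp_dvd_coeff[OF _ g dvd])
qed

text \<open>\<open>M'\<close> and \<open>M\<close> model two consecutive ranks.
  \<open>splitU\<close> covers at once the injectivity of \<open>U\<close>, for
  \<open>p = 0\<close>, and its injectivity modulo \<open>p\<close>.\<close>

locale up_down =
  fixes M' M :: "('a \<Rightarrow> int) set" and U D :: "('a \<Rightarrow> int) \<Rightarrow> ('a \<Rightarrow> int)"
  assumes sub': "zsubmodule M'" and sub: "zsubmodule M"
    and linU: "zlinear U" and linD: "zlinear D"
    and UM: "\<And>y. y \<in> M' \<Longrightarrow> U y \<in> M" and DM: "\<And>x. x \<in> M \<Longrightarrow> D x \<in> M'"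
    and surjD: "\<And>y. y \<in> M' \<Longrightarrow> \<exists>x\<in>M. D x = y"
    and splitU: "\<And>p y z. y \<in> M' \<Longrightarrow> z \<in> M \<Longrightarrow> U y = of_int p * z \<Longrightarrow> \<exists>y'\<in>M'. y = of_int p * y'"
begin

abbreviation "DU \<equiv> D \<circ> U"
abbreviation "UD \<equiv> U \<circ> D"

lemma lin_DU: "zlinear DU" and lin_UD: "zlinear UD"
  using linU linD unfolding zlinear_def by auto

lemma D_poly_act:
  assumes "x \<in> M"
  shows "D (poly_act UD q x) = poly_act DU q (D x)"
  by (rule poly_act_intertwine[OF lin_UD lin_DU linD sub]) (auto simp: UM DM assms)

lemma poly_act_UD_mem: "x \<in> M \<Longrightarrow> poly_act UD q x \<in> M"
  by (rule poly_act_closed[OF lin_UD sub]) (auto simp: UM DM)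

lemma poly_act_DU_mem: "y \<in> M' \<Longrightarrow> poly_act DU q y \<in> M'"
  by (rule poly_act_closed[OF lin_DU sub']) (auto simp: UM DM)

text \<open>Every positive power of \<open>U \<circ> D\<close> has \<open>U\<close> as its last map,
  so apart from the constant coefficient the action factors through the lower rank.\<close>

lemma poly_act_UD_pCons:
  assumes "x \<in> M"
  shows "poly_act UD (pCons c q) x = of_int c * x + U (poly_act DU q (D x))"
  unfolding poly_act_pCons[OF lin_UD] by (simp add: D_poly_act assms)

lemma poly_act_UD_kernel:
  assumes "x \<in> M" "D x = 0"
  shows "poly_act UD q x = of_int (coeff q 0) * x"
proof (cases q)
  case (pCons c h)
  then show ?thesis
    using poly_act_UD_pCons[OF assms(1), of c h] assms(2)
    by (simp add: zlinear_zero[OF zlinear_poly_act[OF lin_DU]] zlinear_zero[OF linU])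
qed

text \<open>Write \<open>a i\<close> as \<open>N i + x * h i\<close>. Then
  \<open>poly_act UD (a i) (w i)\<close> is \<open>N i\<close> times \<open>w i\<close> plus
  \<open>U\<close> of \<open>poly_act DU (h i) (v i)\<close>. As \<open>q\<close> divides every
  \<open>c i * N i\<close>, the relation modulo \<open>q\<close> involves only the second parts;
  \<open>splitU\<close> cancels \<open>U\<close>, and for \<open>q\<close> dividing
  \<open>N i\<close> the polynomial \<open>h i\<close> is monic of lower degree than
  \<open>a i\<close>.\<close>

lemma lifts_independent_mod:
  assumes C: "cyclic_decomp M' DU (s + m) v a" and q: "prime q" and z: "z \<in> M"
    and w: "\<And>i. i < s + m \<Longrightarrow> w i \<in> M \<and> D (w i) = v i"
    and eq: "(\<Sum>i\<in>{s..<s+m}. of_int (c i) * poly_act UD (a i) (w i)) = of_int q * z"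
    and c0: "\<And>i. i \<in> {s..<s+m} \<Longrightarrow> \<not> q dvd coeff (a i) 0 \<Longrightarrow> c i = 0" and i: "i \<in> {s..<s+m}"
  shows "q dvd c i"
proof (cases "c i = 0")
  case False
  let ?R = "{s..<s+m}"
  define N where "N = (\<lambda>i. coeff (a i) 0)"
  have "\<exists>h. a i = pCons (N i) h" for i unfolding N_def by (cases "a i") auto
  then obtain h where h: "\<And>i. a i = pCons (N i) (h i)" by metis
  have "\<exists>t. c i * N i = q * t" if "i \<in> ?R" for i
    using c0[OF that] unfolding N_def by (cases "q dvd coeff (a i) 0") (auto simp: dvd_def)
  then obtain t where t: "\<And>i. i \<in> ?R \<Longrightarrow> c i * N i = q * t i" by metis
  define Y where "Y = (\<Sum>i\<in>?R. of_int (c i) * poly_act DU (h i) (v i))"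
  have vM: "v i \<in> M'" if "i < s + m" for i using cyclic_decompD(1)[OF C that] .
  have YM: "Y \<in> M'" unfolding Y_def
    by (intro zsubmodule_sum[OF sub'] zsubmodule_scale[OF sub'] poly_act_DU_mem vM) auto
  have "of_int (c i) * poly_act UD (a i) (w i) = of_int q * (of_int (t i) * w i) + U (of_int (c i) * poly_act DU (h i) (v i))"
    if "i \<in> ?R" for i
  proof -
    have wi: "w i \<in> M" "D (w i) = v i" using w that by auto
    have "of_int (c i) * poly_act UD (a i) (w i) = of_int (c i * N i) * w i + of_int (c i) * U (poly_act DU (h i) (v i))"
      unfolding h[of i] poly_act_UD_pCons[OF wi(1)] wi(2) by (simp add: algebra_simps)
    also have "of_int (c i * N i) * w i = of_int q * (of_int (t i) * w i)" unfolding t[OF that] by (simp add: mult.assoc)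
    finally show ?thesis by (simp only: zlinear_scale[OF linU])
  qed
  then have "of_int q * z = (\<Sum>i\<in>?R. of_int q * (of_int (t i) * w i) + U (of_int (c i) * poly_act DU (h i) (v i)))"
    unfolding eq[symmetric] by (intro sum.cong) auto
  also have "\<dots> = of_int q * (\<Sum>i\<in>?R. of_int (t i) * w i) + U Y"
    unfolding Y_def by (simp add: sum.distrib sum_distrib_left zlinear_sum[OF linU])
  finally have "U Y = of_int q * (z - (\<Sum>i\<in>?R. of_int (t i) * w i))" by (simp add: algebra_simps)
  moreover have "z - (\<Sum>i\<in>?R. of_int (t i) * w i) \<in> M"
    using w by (intro zsubmodule_diff[OF sub] zsubmodule_sum[OF sub] zsubmodule_scale[OF sub] z) auto
  ultimately obtain y where y: "y \<in> M'" "Y = of_int q * y" using splitU[OF YM] by blast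
  have lead: "lead_coeff (a i) = 1" using cyclic_decompD(3)[OF C] i by simp
  have qN: "q dvd N i" using c0[OF i] False unfolding N_def by blast
  have "h i \<noteq> 0"
  proof
    assume "h i = 0"
    then have "N i = 1" using lead unfolding h[of i] by simp
    then show False using qN q by (simp add: not_prime_unit)
  qed
  then have "lead_coeff (h i) = 1" "degree (h i) < degree (a i)" using lead unfolding h[of i] by auto
  moreover have "?R \<subseteq> {..<s+m}" by auto
  ultimately show ?thesis using y i unfolding Y_def by (intro cyclic_decomp_indep_mod[OF C])
qed simp

text \<open>A lift \<open>w i\<close> of the generator \<open>v i\<close> can be changed by elements of the kernel of \<open>D\<close>, which moves
  \<open>poly_act UD (a i) (w i)\<close> by arbitrary multiples of \<open>coeff (a i) 0\<close>.
  The last \<open>m\<close> of these vectors are turned into a basis of the kernel, the others into zero.\<close>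

lemma cyclic_decomp_step:
  assumes C: "cyclic_decomp M' DU (s + m) v a" and B: "zbasis {x \<in> M. D x = 0} I b" and card: "card I = m"
    and unit: "\<And>i. i < s \<Longrightarrow> \<bar>coeff (a i) 0\<bar> = 1"
    and small: "m > 0 \<Longrightarrow> \<bar>coeff (a s) 0\<bar> = 1 \<or> \<bar>coeff (a s) 0\<bar> = 3"
  shows "\<exists>w. cyclic_decomp M UD (s + m) w (\<lambda>i. if i < s then a i else [:0, 1:] * a i)"
proof -
  let ?R = "{s..<s+m}"
  define K where "K = {x \<in> M. D x = 0}"
  define N where "N = (\<lambda>i. coeff (a i) 0)"
  have BK: "zbasis K I b" using B unfolding K_def .
  have vM: "v i \<in> M'" if "i < s + m" for i using cyclic_decompD(1)[OF C that] .
  then have "\<forall>i\<in>{..<s+m}. \<exists>x. x \<in> M \<and> D x = v i" using surjD by blast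
  then obtain w where w: "\<And>i. i < s + m \<Longrightarrow> w i \<in> M \<and> D (w i) = v i" unfolding Ball_def by (metis lessThan_iff)
  define g where "g = (\<lambda>i. poly_act UD (a i) (w i))"
  have gK: "g i \<in> K" if "i < s + m" for i
    unfolding K_def g_def using w[OF that] cyclic_decompD(2)[OF C that] by (simp add: poly_act_UD_mem D_poly_act)
  have "\<exists>y. (\<forall>i\<in>?R. y i \<in> K) \<and> zbasis K ?R (\<lambda>i. g i + of_int (N i) * y i)"
  proof (rule zbasis_completion[OF BK card])
    show "g i \<in> K" if "i \<in> ?R" for i using gK that by simp
    show "N i dvd N j" if "i \<in> ?R" "j \<in> ?R" "i \<le> j" for i j
    proof -
      have "a i dvd a j" using cyclic_decomp_chain[OF C that(3)] that(2) by simp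
      then obtain h where "a j = a i * h" by (rule dvdE)
      then show ?thesis unfolding N_def by (simp add: coeff_mult)
    qed
    show "\<bar>N s\<bar> = 1 \<or> \<bar>N s\<bar> = 3" if "m > 0" using small[OF that] unfolding N_def .
    show "q dvd c i" if "prime q" "z \<in> K" "(\<Sum>i\<in>?R. of_int (c i) * g i) = of_int q * z"
      "\<And>i. i \<in> ?R \<Longrightarrow> \<not> q dvd N i \<Longrightarrow> c i = 0" "i \<in> ?R" for q c z i
      using that unfolding K_def g_def N_def by (intro lifts_independent_mod[OF C _ _ w]) auto
  qed
  then obtain y where y: "\<And>i. i \<in> ?R \<Longrightarrow> y i \<in> K" and By: "zbasis K ?R (\<lambda>i. g i + of_int (N i) * y i)" by blast
  \<comment> \<open>On the kernel \<open>a i\<close> acts as \<open>N i\<close>. For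
    \<open>i < s\<close> this is 1 or -1, its own inverse, so subtracting \<open>N i\<close> times
    \<open>g i\<close> from the lift removes the value \<open>g i\<close>.\<close>
  define w' where "w' = (\<lambda>i. if i < s then w i - of_int (N i) * g i else w i + y i)"
  have sM: "zsubmodule M" by (rule sub)
  have act_K: "poly_act UD q x = of_int (coeff q 0) * x" if "x \<in> K" for q x
    using that poly_act_UD_kernel unfolding K_def by blast
  have w': "w' i \<in> M" "D (w' i) = v i" if "i < s + m" for i
  proof -
    have "g i \<in> M" "D (g i) = 0" "w i \<in> M" "D (w i) = v i" using gK[OF that] w[OF that] unfolding K_def by auto
    moreover have "y i \<in> M" "D (y i) = 0" if "\<not> i < s" using y[of i] that \<open>i < s + m\<close> unfolding K_def by auto
    ultimately show "w' i \<in> M" "D (w' i) = v i"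
      unfolding w'_def
      by (auto simp: zsubmodule_diff[OF sM] zsubmodule_add[OF sM] zsubmodule_scale[OF sM] zlinear_diff[OF linD] zlinear_add[OF linD]
          zlinear_scale[OF linD])
  qed
  have act1: "poly_act UD (a i) (w' i) = 0" if "i < s" for i
  proof -
    have "N i * N i = 1" using unit[OF that] unfolding N_def by (metis abs_mult_self_eq mult_1)
    then have "of_int (N i) * (of_int (N i) * g i) = g i" by (metis of_int_1 of_int_mult mult.assoc mult_1)
    moreover have "poly_act UD (a i) (w i) = g i" "coeff (a i) 0 = N i" unfolding g_def N_def by simp_all
    ultimately show ?thesis
      using that gK[of i] unfolding w'_def
      by (simp add: zlinear_diff[OF zlinear_poly_act[OF lin_UD]] zlinear_scale[OF zlinear_poly_act[OF lin_UD]] act_K)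
  qed
  have act2: "poly_act UD (a i) (w' i) = g i + of_int (N i) * y i" if "i \<in> ?R" for i
    using that y[OF that] unfolding w'_def
    by (simp add: zlinear_add[OF zlinear_poly_act[OF lin_UD]] act_K g_def N_def)
  have actX: "poly_act UD [:0, 1:] x = 0" if "x \<in> K" for x using act_K[OF that] by simp
  have GK: "g i + of_int (N i) * y i \<in> K" if "i \<in> ?R" for i using zbasis_mem[OF By that] .
  have Dsum: "D (\<Sum>i<s+m. poly_act UD (q i) (w' i)) = (\<Sum>i<s+m. poly_act DU (q i) (v i))" for q
    unfolding zlinear_sum[OF linD] using w' by (intro sum.cong) (auto simp: D_poly_act)
  have sumM: "(\<Sum>i<s+m. poly_act UD (q i) (w' i)) \<in> M" for q
    using w' by (intro zsubmodule_sum[OF sM] poly_act_UD_mem) auto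
  \<comment> \<open>\<open>U \<circ> D\<close> kills the kernel basis, so a combination whose
    coefficients are multiples of the \<open>a i\<close> is an integer combination of that
    basis.\<close>
  have act_sum: "(\<Sum>i<s+m. poly_act UD (h i * a i) (w' i)) = (\<Sum>i\<in>?R. of_int (coeff (h i) 0) * (g i + of_int (N i) * y i))" for h
  proof -
    have "(\<Sum>i<s+m. poly_act UD (h i * a i) (w' i)) = (\<Sum>i<s+m. poly_act UD (h i) (poly_act UD (a i) (w' i)))"
      by (simp add: poly_act_mult[OF lin_UD])
    also have "\<dots> = (\<Sum>i\<in>?R. poly_act UD (h i) (g i + of_int (N i) * y i))"
      by (rule sum.mono_neutral_cong_right) (auto simp: act1 act2 zlinear_zero[OF zlinear_poly_act[OF lin_UD]])
    also have "\<dots> = (\<Sum>i\<in>?R. of_int (coeff (h i) 0) * (g i + of_int (N i) * y i))"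
      by (rule sum.cong) (auto simp: act_K[OF GK])
    finally show ?thesis .
  qed
  have "cyclic_decomp M UD (s + m) w' (\<lambda>i. if i < s then a i else [:0, 1:] * a i)"
    unfolding cyclic_decomp_def
  proof (intro conjI allI impI ballI)
    fix i assume i: "i < s + m"
    show "w' i \<in> M" using w' i by blast
    show "poly_act UD (if i < s then a i else [:0, 1:] * a i) (w' i) = 0"
    proof (cases "i < s")
      case False
      then have "i \<in> ?R" using i by simp
      then have "poly_act UD ([:0, 1:] * a i) (w' i) = 0"
        using actX[OF GK] act2 by (simp only: poly_act_mult[OF lin_UD])
      then show ?thesis using False by simp
    qed (simp add: act1)
    have "lead_coeff (a i) = 1" using cyclic_decompD(3)[OF C i] .
    then show "lead_coeff (if i < s then a i else [:0, 1:] * a i) = 1"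
      using lead_coeff_mult[of "[:0, 1:]" "a i"] by auto
  next
    fix i assume i: "Suc i < s + m"
    have "a i dvd a (Suc i)" using cyclic_decomp_chain[OF C _ i] by simp
    then show "(if i < s then a i else [:0, 1:] * a i) dvd (if Suc i < s then a (Suc i) else [:0, 1:] * a (Suc i))"
      by (auto intro: dvd_mult mult_dvd_mono simp del: mult_pCons_left)
  next
    fix x assume x: "x \<in> M"
    obtain q where q: "D x = (\<Sum>i<s+m. poly_act DU (q i) (v i))" using cyclic_decomp_obtain[OF C DM[OF x]] .
    let ?z = "x - (\<Sum>i<s+m. poly_act UD (q i) (w' i))"
    have "?z \<in> K" unfolding K_def using q by (simp add: zsubmodule_diff[OF sM x sumM] zlinear_diff[OF linD] Dsum)
    then obtain c where c: "?z = (\<Sum>i\<in>?R. of_int (c i) * (g i + of_int (N i) * y i))" by (rule zbasis_obtain[OF By])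
    have "?z = (\<Sum>i<s+m. poly_act UD ([:c i:] * a i) (w' i))" unfolding c act_sum by simp
    then have "x = (\<Sum>i<s+m. poly_act UD (q i + [:c i:] * a i) (w' i))"
      unfolding poly_act_add sum.distrib by (simp add: algebra_simps)
    then show "\<exists>q. x = (\<Sum>i<s+m. poly_act UD (q i) (w' i))" by (intro exI[of _ "\<lambda>i. q i + [:c i:] * a i"])
  next
    fix q i assume eq: "(\<Sum>i<s+m. poly_act UD (q i) (w' i)) = 0" and i: "i < s + m"
    \<comment> \<open>Applying \<open>D\<close> shows that \<open>a i\<close> divides
      \<open>q i\<close>; the quotients then give an integer relation in the kernel basis, whose
      triviality supplies the extra factor \<open>[:0, 1:]\<close>.\<close>
    have "(\<Sum>i<s+m. poly_act DU (q i) (v i)) = 0" using Dsum[of q] eq zlinear_zero[OF linD] by simp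
    then have "a i dvd q i" if "i < s + m" for i by (rule cyclic_decompD(4)[OF C _ that])
    then have "\<forall>i\<in>{..<s+m}. \<exists>h. q i = h * a i" by (auto simp: dvd_def mult.commute)
    then obtain h where h: "\<And>i. i < s + m \<Longrightarrow> q i = h i * a i" unfolding Ball_def by (metis lessThan_iff)
    have "(\<Sum>i<s+m. poly_act UD (h i * a i) (w' i)) = 0"
      unfolding eq[symmetric] by (rule sum.cong) (auto simp: h)
    then have "(\<Sum>i\<in>?R. of_int (coeff (h i) 0) * (g i + of_int (N i) * y i)) = 0" unfolding act_sum .
    then have z: "coeff (h i) 0 = 0" if "i \<in> ?R" for i by (rule zbasis_indep[OF By _ that])
    show "(if i < s then a i else [:0, 1:] * a i) dvd q i"
    proof (cases "i < s")
      case False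
      then have "coeff (h i) 0 = 0" using z i by simp
      then have "[:0, 1:] dvd h i" by (cases "h i") (auto simp: dvd_def intro!: exI[of _ "_ :: int poly"])
      then show ?thesis using False h[OF i] by (simp add: mult_dvd_mono del: mult_pCons_left)
    qed (simp add: h i)
  qed
  then show ?thesis by blast
qed

end

lemma cyclic_decomp_shift:
  assumes C: "cyclic_decomp M phi k v a" and "zlinear phi" "zlinear psi" "zsubmodule M"
    and "\<And>v. v \<in> M \<Longrightarrow> phi v \<in> M" and "\<And>v. v \<in> M \<Longrightarrow> psi v = phi v + of_int r * v"
  shows "cyclic_decomp M psi k v (\<lambda>i. a i \<circ>\<^sub>p [:-r, 1:])"
proof -
  have shift: "poly_act psi q x = poly_act phi (q \<circ>\<^sub>p [:r, 1:]) x" if "x \<in> M" for q x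
    using poly_act_shift[OF assms(2-6) that] by blast
  have inv1: "(q \<circ>\<^sub>p [:-r, 1:]) \<circ>\<^sub>p [:r, 1:] = q" and inv2: "(q \<circ>\<^sub>p [:r, 1:]) \<circ>\<^sub>p [:-r, 1:] = q" for q :: "int poly"
    by (simp_all add: pcompose_assoc[symmetric] pcompose_pCons)
  have dvd: "p \<circ>\<^sub>p [:-r, 1:] dvd q \<circ>\<^sub>p [:-r, 1:]" if "p dvd q" for p q :: "int poly"
    using that by (auto simp: dvd_def pcompose_mult)
  have vM: "v i \<in> M" if "i < k" for i using cyclic_decompD(1)[OF C that] .
  have sum: "(\<Sum>i<k. poly_act psi (q i) (v i)) = (\<Sum>i<k. poly_act phi (q i \<circ>\<^sub>p [:r, 1:]) (v i))" for q
    by (rule sum.cong) (auto simp: shift vM)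
  show ?thesis unfolding cyclic_decomp_def
  proof (intro conjI allI impI ballI)
    fix i assume i: "i < k"
    show "v i \<in> M" by (rule vM[OF i])
    show "poly_act psi (a i \<circ>\<^sub>p [:-r, 1:]) (v i) = 0"
      unfolding shift[OF vM[OF i]] inv1 by (rule cyclic_decompD(2)[OF C i])
    show "lead_coeff (a i \<circ>\<^sub>p [:-r, 1:]) = 1"
      using cyclic_decompD(3)[OF C i] by (simp add: lead_coeff_comp)
  next
    fix i assume "Suc i < k"
    then show "a i \<circ>\<^sub>p [:-r, 1:] dvd a (Suc i) \<circ>\<^sub>p [:-r, 1:]" using cyclic_decomp_chain[OF C] by (intro dvd) simp
  next
    fix x assume "x \<in> M"
    then obtain q where "x = (\<Sum>i<k. poly_act phi (q i) (v i))" by (rule cyclic_decomp_obtain[OF C])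
    then show "\<exists>q. x = (\<Sum>i<k. poly_act psi (q i) (v i))"
      unfolding sum by (intro exI[of _ "\<lambda>i. q i \<circ>\<^sub>p [:-r, 1:]"]) (simp add: inv1)
  next
    fix q i assume "(\<Sum>i<k. poly_act psi (q i) (v i)) = 0" and i: "i < k"
    then have "a i dvd q i \<circ>\<^sub>p [:r, 1:]" unfolding sum by (rule cyclic_decompD(4)[OF C])
    then show "a i \<circ>\<^sub>p [:-r, 1:] dvd q i" using dvd inv2 by metis
  qed
qed

section \<open>Differential posets\<close>

text \<open>One linear factor is cancelled at a time: from \<open>a\<close> if \<open>a\<close>
  vanishes at its root, otherwise from the cofactor, which then vanishes there. No factor repeats,
  so the roots determine \<open>a\<close>.\<close>

lemma monic_dvd_linear_prod:
  fixes a :: "int poly"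
  assumes "finite S" "a dvd (\<Prod>j\<in>S. [:-j, 1:])" "lead_coeff a = 1"
  shows "a = (\<Prod>j\<in>{j\<in>S. poly a j = 0}. [:-j, 1:])"
  using assms
proof (induction S arbitrary: a rule: finite_induct)
  case empty
  then have "a dvd 1" by simp
  then obtain c where "a = [:c:]" by (auto simp: is_unit_poly_iff)
  then show ?case using empty.prems by (simp add: one_pCons)
next
  case (insert j S)
  have ne: "[:-j, 1:] \<noteq> 0" by simp
  show ?case
  proof (cases "poly a j = 0")
    case True
    then obtain b where b: "a = [:-j, 1:] * b" unfolding poly_eq_0_iff_dvd by (rule dvdE)
    have "[:-j, 1:] * b dvd [:-j, 1:] * (\<Prod>j\<in>S. [:-j, 1:])"
      using insert.prems(1) insert.hyps unfolding b by simp
    then have bS: "b dvd (\<Prod>j\<in>S. [:-j, 1:])" using ne unfolding dvd_mult_cancel_left by blast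
    have "lead_coeff b = 1" using insert.prems(2) unfolding b lead_coeff_mult by simp
    then have bp: "b = (\<Prod>j\<in>{j\<in>S. poly b j = 0}. [:-j, 1:])" by (rule insert.IH[OF bS])
    have "{i \<in> Set.insert j S. poly a i = 0} = Set.insert j {i \<in> S. poly b i = 0}"
      using insert.hyps unfolding b by auto
    then have "(\<Prod>j\<in>{i \<in> Set.insert j S. poly a i = 0}. [:-j, 1:]) = [:-j, 1:] * (\<Prod>j\<in>{j\<in>S. poly b j = 0}. [:-j, 1:])"
      using insert.hyps by simp
    then show ?thesis using b bp by simp
  next
    case False
    obtain h where h: "(\<Prod>j\<in>Set.insert j S. [:-j, 1:]) = a * h" using insert.prems(1) by (rule dvdE)
    have "poly (\<Prod>j\<in>Set.insert j S. [:-j, 1:]) j = 0" using insert.hyps by (simp add: poly_prod)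
    then have "poly a j * poly h j = 0" unfolding h by simp
    then have "[:-j, 1:] dvd h" using False by (simp add: poly_eq_0_iff_dvd)
    then obtain h' where h': "h = [:-j, 1:] * h'" by (rule dvdE)
    have "[:-j, 1:] * (\<Prod>j\<in>S. [:-j, 1:]) = [:-j, 1:] * (a * h')"
      using h insert.hyps unfolding h' by (simp add: mult.left_commute)
    then have "(\<Prod>j\<in>S. [:-j, 1:]) = a * h'" using ne unfolding mult_cancel_left by blast
    then have "a = (\<Prod>j\<in>{j\<in>S. poly a j = 0}. [:-j, 1:])" by (intro insert.IH insert.prems) simp
    moreover have "{i \<in> Set.insert j S. poly a i = 0} = {i \<in> S. poly a i = 0}" using False by auto
    ultimately show ?thesis by simp
  qed
qed

lemma abs_coeff_0_linear_prod: "\<bar>coeff (\<Prod>j\<in>S. [:-j, 1:]) 0\<bar> = (\<Prod>j\<in>S. \<bar>j :: int\<bar>)"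
  by (simp add: poly_0_coeff_0[symmetric] poly_prod abs_prod)

lemma sum_swap_card:
  fixes f :: "'b \<Rightarrow> int"
  assumes "finite A" "finite X"
  shows "(\<Sum>z\<in>A. \<Sum>x\<in>{x\<in>X. Q x z}. f x) = (\<Sum>x\<in>X. f x * int (card {z\<in>A. Q x z}))"
proof -
  have "(\<Sum>z\<in>A. \<Sum>x\<in>{x\<in>X. Q x z}. f x) = (\<Sum>z\<in>A. \<Sum>x\<in>X. if Q x z then f x else 0)"
    by (rule sum.cong[OF refl], rule sum.inter_filter[OF assms(2)])
  also have "\<dots> = (\<Sum>x\<in>X. \<Sum>z\<in>A. if Q x z then f x else 0)" by (rule sum.swap)
  also have "\<dots> = (\<Sum>x\<in>X. f x * int (card {z\<in>A. Q x z}))"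
    by (rule sum.cong[OF refl], subst sum.inter_filter[OF assms(1), symmetric]) (simp add: mult.commute)
  finally show ?thesis .
qed

lemma zbasis_fsupp:
  assumes "finite S"
  shows "zbasis (fsupp S) S (\<lambda>x y. if y = x then 1 else 0)"
proof -
  have val: "(\<Sum>x\<in>S. of_int (c x) * (\<lambda>y. if y = x then 1 else 0)) = (\<lambda>y. if y \<in> S then c y else 0)" for c
  proof
    fix y
    have "(\<Sum>x\<in>S. of_int (c x) * (\<lambda>y. if y = x then 1 else (0::int))) y = (\<Sum>x\<in>S. if y = x then c x else 0)"
      unfolding sum_fun_apply by (rule sum.cong) (auto simp: fun_apply)
    then show "(\<Sum>x\<in>S. of_int (c x) * (\<lambda>y. if y = x then 1 else 0)) y = (if y \<in> S then c y else 0)"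
      using assms by simp
  qed
  have "f \<in> range (\<lambda>c y. if y \<in> S then c y else 0)" if "f \<in> fsupp S" for f :: "'a \<Rightarrow> int"
    using that unfolding fsupp_def by (intro range_eqI[of _ _ f]) auto
  moreover have "(\<lambda>y. if y \<in> S then c y else 0) \<in> fsupp S" for c :: "'a \<Rightarrow> int" unfolding fsupp_def by auto
  ultimately have "fsupp S = range (\<lambda>c y. if y \<in> S then c y else (0::int))" by blast
  moreover have "c x = 0" if "(\<lambda>y. if y \<in> S then c y else (0::int)) = 0" "x \<in> S" for c x
    using fun_cong[OF that(1), of x] that(2) by (simp add: fun_apply)
  ultimately show ?thesis unfolding zbasis_def val using assms by blast
qed

lemma fsupp_divide:
  assumes "f \<in> fsupp S" "\<And>x. q dvd f x"
  shows "\<exists>g\<in>fsupp S. f = of_int q * g"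
proof (cases "q = 0")
  case True
  then have "f = of_int q * 0" using assms(2) by (auto simp: fun_apply)
  then show ?thesis using zsubmodule_zero[OF zsubmodule_fsupp] by blast
next
  case False
  let ?g = "\<lambda>x. f x div q"
  have "f = of_int q * ?g" using assms(2) by (auto simp: fun_apply)
  moreover have "?g \<in> fsupp S" using assms(1) unfolding fsupp_def by auto
  ultimately show ?thesis by blast
qed

locale surjective_differential_poset =
  fixes r :: nat and P :: "'a set" and leq :: "'a \<Rightarrow> 'a \<Rightarrow> bool" and rk :: "'a \<Rightarrow> nat"
  assumes diff: "differential_poset r P leq rk"
    and surj_D: "\<forall>n\<ge>1. \<forall>g\<in>ZP P rk (n - 1). \<exists>f\<in>ZP P rk n. Dmap P leq rk n f = g"
begin

abbreviation "R \<equiv> rank_set P rk"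
abbreviation "M \<equiv> ZP P rk"
abbreviation "U \<equiv> Umap P leq rk"
abbreviation "D \<equiv> Dmap P leq rk"
abbreviation "DU \<equiv> DUmap P leq rk"
abbreviation "cov \<equiv> covby P leq"

lemma r_pos: "r \<ge> 1" using diff unfolding differential_poset_def by blast

lemma finite_R: "finite (R n)" using diff unfolding differential_poset_def D1_def by blast

lemma cov_R: "cov x y \<Longrightarrow> x \<in> R n \<Longrightarrow> y \<in> R (Suc n)" "cov x y \<Longrightarrow> y \<in> R (Suc n) \<Longrightarrow> x \<in> R n"
  using diff unfolding differential_poset_def D1_def rank_set_def covby_def by auto

lemma cov_R_0: "cov x y \<Longrightarrow> y \<notin> R 0"
  using diff unfolding differential_poset_def D1_def rank_set_def by auto

lemma sub_M: "zsubmodule (M n)" unfolding ZP_def by (rule zsubmodule_fsupp)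

lemma lin_U: "zlinear (U n)"
  unfolding zlinear_def Umap_def by (auto simp: fun_apply sum.distrib sum_distrib_left)

lemma lin_D: "zlinear (D n)"
  unfolding zlinear_def Dmap_def by (auto simp: fun_apply sum.distrib sum_distrib_left)

lemma lin_DU: "zlinear (DU n)"
  using lin_U lin_D unfolding zlinear_def DUmap_def by auto

lemma U_M: "U n f \<in> M (Suc n)" unfolding ZP_def fsupp_def Umap_def by auto

lemma D_M: "D (Suc n) f \<in> M n" unfolding ZP_def fsupp_def Dmap_def by auto

lemma DU_M: "DU n f \<in> M n" unfolding DUmap_def by (simp add: D_M)

lemma D_0: "D 0 f = 0" unfolding Dmap_def by (auto simp: fun_apply)

lemma adjoint: "(\<Sum>z\<in>R (Suc n). U n f z * g z) = (\<Sum>y\<in>R n. f y * D (Suc n) g y)"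
proof -
  have "(\<Sum>z\<in>R (Suc n). U n f z * g z) = (\<Sum>z\<in>R (Suc n). \<Sum>y\<in>R n. if cov y z then f y * g z else 0)"
    by (rule sum.cong) (simp_all add: Umap_def sum_distrib_right sum.inter_filter[OF finite_R, symmetric])
  also have "\<dots> = (\<Sum>y\<in>R n. \<Sum>z\<in>R (Suc n). if cov y z then f y * g z else 0)" by (rule sum.swap)
  also have "\<dots> = (\<Sum>y\<in>R n. f y * D (Suc n) g y)"
    by (rule sum.cong) (simp_all add: Dmap_def sum_distrib_left sum.inter_filter[OF finite_R, symmetric])
  finally show ?thesis .
qed

text \<open>For a \<open>D\<close>-preimage \<open>h\<close> of the indicator of \<open>x\<close>,
  \<open>adjoint\<close> writes \<open>f x\<close> as the pairing of \<open>U n f\<close> with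
  \<open>h\<close>, which \<open>q\<close> divides.\<close>

lemma split_U:
  assumes f: "f \<in> M n" and eq: "U n f = of_int q * g"
  shows "\<exists>f'\<in>M n. f = of_int q * f'"
proof -
  have "q dvd f x" for x
  proof (cases "x \<in> R n")
    case True
    let ?e = "\<lambda>y. if y = x then 1 else (0::int)"
    have "?e \<in> M n" using True unfolding ZP_def fsupp_def by auto
    then obtain h where h: "D (Suc n) h = ?e" using surj_D[rule_format, of "Suc n" ?e] by auto
    have "f x = (\<Sum>y\<in>R n. f y * D (Suc n) h y)"
      unfolding h using True finite_R by (simp add: if_distrib cong: if_cong)
    also have "\<dots> = (\<Sum>z\<in>R (Suc n). U n f z * h z)" by (rule adjoint[symmetric])
    also have "\<dots> = q * (\<Sum>z\<in>R (Suc n). g z * h z)" unfolding eq by (simp add: fun_apply sum_distrib_left mult.assoc)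
    finally show ?thesis by simp
  next
    case False
    then show ?thesis using f unfolding ZP_def fsupp_def by simp
  qed
  then show ?thesis using fsupp_divide[of f "R n" q] f unfolding ZP_def by blast
qed

sublocale ud: up_down "M n" "M (Suc n)" "U n" "D (Suc n)" for n
proof
  show "\<exists>x\<in>M (Suc n). D (Suc n) x = y" if "y \<in> M n" for y
    using surj_D[rule_format, of "Suc n" y] that by simp
  show "\<exists>y'\<in>M n. y = of_int p * y'" if "y \<in> M n" "z \<in> M (Suc n)" "U n y = of_int p * z" for p y z
    by (rule split_U[OF that(1,3)])
qed (use sub_M lin_U lin_D U_M D_M in auto)

lemma U_inj: "f \<in> M n \<Longrightarrow> U n f = 0 \<Longrightarrow> f = 0"
  using split_U[of f n 0 0] by auto

text \<open>At \<open>y\<close> the coefficient of \<open>f x\<close> counts common upper covers of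
  \<open>x\<close> and \<open>y\<close> on the left and common lower covers on the right. (D2)
  equates the counts for \<open>x \<noteq> y\<close>, (D3) gives the difference \<open>r\<close> for
  \<open>x = y\<close>. At \<open>n = 0\<close> the truncated \<open>n - 1\<close> is harmless,
  because \<open>D 0\<close> is zero.\<close>

lemma commutation:
  assumes f: "f \<in> M n"
  shows "DU n f = U (n - 1) (D n f) + of_int (int r) * f"
proof
  fix y
  show "DU n f y = (U (n - 1) (D n f) + of_int (int r) * f) y"
  proof (cases "y \<in> R n")
    case False
    have "U (n - 1) (D n f) y = 0"
    proof (cases n)
      case 0
      then show ?thesis using zlinear_zero[OF lin_U] by (simp add: D_0 fun_apply)
    next
      case (Suc m)
      then show ?thesis using False by (simp add: Umap_def)
    qed
    moreover have "DU n f y = 0" "f y = 0" using False f DU_M[of n f] unfolding ZP_def fsupp_def by auto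
    ultimately show ?thesis by (simp add: fun_apply)
  next
    case True
    then have yP: "y \<in> P" unfolding rank_set_def by simp
    have up: "DU n f y = (\<Sum>x\<in>R n. f x * int (card {z. cov y z \<and> cov x z}))"
    proof -
      have set: "{z\<in>{z\<in>R (Suc n). cov y z}. cov x z} = {z. cov y z \<and> cov x z}" for x
        using cov_R(1)[OF _ True] by auto
      have "DU n f y = (\<Sum>z\<in>{z\<in>R (Suc n). cov y z}. \<Sum>x\<in>{x\<in>R n. cov x z}. f x)"
        unfolding DUmap_def Dmap_def Umap_def using True by simp
      also have "\<dots> = (\<Sum>x\<in>R n. f x * int (card {z\<in>{z\<in>R (Suc n). cov y z}. cov x z}))"
        by (rule sum_swap_card) (auto simp: finite_R)
      finally show ?thesis unfolding set .
    qed
    have down: "U (n - 1) (D n f) y = (\<Sum>x\<in>R n. f x * int (card {w. cov w y \<and> cov w x}))"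
    proof (cases n)
      case 0
      then have "card {w. cov w y \<and> cov w x} = 0" for x using cov_R_0[of _ y] True by (auto simp: card_eq_0_iff)
      then show ?thesis using 0 zlinear_zero[OF lin_U] by (simp add: D_0 fun_apply)
    next
      case (Suc m)
      have set: "{w\<in>{w\<in>R m. cov w y}. cov w x} = {w. cov w y \<and> cov w x}" for x
        using cov_R(2)[of _ y m] True Suc by auto
      have "U (n - 1) (D n f) y = (\<Sum>w\<in>{w\<in>R m. cov w y}. \<Sum>x\<in>{x\<in>R n. cov w x}. f x)"
        unfolding Dmap_def Umap_def using True Suc by simp
      also have "\<dots> = (\<Sum>x\<in>R n. f x * int (card {w\<in>{w\<in>R m. cov w y}. cov w x}))"
        by (rule sum_swap_card) (auto simp: finite_R)
      finally show ?thesis unfolding set .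
    qed
    have card: "int (card {z. cov y z \<and> cov x z}) = int (card {w. cov w y \<and> cov w x}) + (if x = y then int r else 0)"
      if "x \<in> R n" for x
    proof (cases "x = y")
      case True
      then show ?thesis using diff yP unfolding differential_poset_def D3_def by simp
    next
      case False
      have "x \<in> P" using that unfolding rank_set_def by simp
      then show ?thesis using False diff yP unfolding differential_poset_def D2_def by auto
    qed
    have "DU n f y = (\<Sum>x\<in>R n. f x * int (card {w. cov w y \<and> cov w x}) + (if x = y then f x * int r else 0))"
      unfolding up by (rule sum.cong) (auto simp: card algebra_simps)
    also have "\<dots> = U (n - 1) (D n f) y + int r * f y"
      unfolding down using True finite_R by (simp add: sum.distrib)
    finally show ?thesis by (simp add: fun_apply)
  qed
qed

lemma commutation_Suc: "f \<in> M (Suc n) \<Longrightarrow> DU (Suc n) f = U n (D (Suc n) f) + of_int (int r) * f"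
  using commutation[of f "Suc n"] by simp

text \<open>The rank of the kernel of \<open>D n\<close>, as a natural number. By
  \<open>kernel_basis\<close> the rank sizes do not decrease, so the subtraction is never
  truncated.\<close>

definition dp :: "nat \<Rightarrow> nat" where
  "dp n = (if n = 0 then card (R 0) else card (R n) - card (R (n - 1)))"

text \<open>\<open>D n x\<close> vanishes when its values at the points of the rank below do.
  Preimages of indicator functions, given by surjectivity, are dual to these functionals, so the
  rank drops by the full size of the rank below.\<close>

lemma kernel_basis:
  "\<exists>(J :: 'a set) b. zbasis {x \<in> M n. D n x = 0} J b \<and> card J = dp n \<and> (n > 0 \<longrightarrow> card (R (n - 1)) \<le> card (R n))"
proof (cases n)
  case 0
  have "{x \<in> M n. D n x = 0} = fsupp (R 0)" using D_0 0 unfolding ZP_def by simp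
  then show ?thesis using zbasis_fsupp[OF finite_R, of 0] 0 unfolding dp_def by auto
next
  case (Suc m)
  have "\<exists>(J :: 'a set) b'. zbasis {y \<in> fsupp (R n). \<forall>t\<in>R m. D n y t = 0} J b' \<and> card J + card (R m) = card (R n)"
  proof (rule zbasis_kernel[OF zbasis_fsupp[OF finite_R] finite_R, of "\<lambda>t y. D n y t"])
    show "D n (x + y) t = D n x t + D n y t" for t x y by (simp add: zlinear_add[OF lin_D] fun_apply)
    show "D n (of_int c * x) t = c * D n x t" for t c x by (simp add: zlinear_scale[OF lin_D] fun_apply)
    show "\<exists>g\<in>fsupp (R n). D n g t \<noteq> 0 \<and> (\<forall>s\<in>R m. s \<noteq> t \<longrightarrow> D n g s = 0)" if "t \<in> R m" for t
    proof -
      let ?e = "\<lambda>y. if y = t then 1 else (0::int)"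
      have "?e \<in> M m" using that unfolding ZP_def fsupp_def by auto
      then obtain h where "h \<in> M n" "D n h = ?e" using surj_D[rule_format, of n ?e] Suc by auto
      then show ?thesis unfolding ZP_def by (intro bexI[of _ h]) auto
    qed
  qed
  moreover have "{y \<in> fsupp (R n). \<forall>t\<in>R m. D n y t = 0} = {x \<in> M n. D n x = 0}"
  proof -
    have "D n y = 0" if "\<forall>t\<in>R m. D n y t = 0" for y
    proof
      fix t show "D n y t = 0 t" using that D_M[of m y] Suc unfolding ZP_def fsupp_def by (cases "t \<in> R m") (auto simp: fun_apply)
    qed
    then show ?thesis unfolding ZP_def by (auto simp: fun_apply)
  qed
  ultimately obtain J :: "'a set" and b where "zbasis {x \<in> M n. D n x = 0} J b" "card J + card (R m) = card (R n)" by auto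
  then show ?thesis using Suc unfolding dp_def by (intro exI[of _ J] exI[of _ b]) auto
qed

lemma delta_rank_size_eq: "delta_rank_size P rk (int n) = int (dp n)"
proof (cases n)
  case 0
  then show ?thesis unfolding delta_rank_size_def rank_size_def dp_def by simp
next
  case (Suc m)
  then have "card (R m) \<le> card (R n)" using kernel_basis[of n] by auto
  moreover have rs: "rank_size P rk (int i) = int (card (R i))" for i unfolding rank_size_def by simp
  moreover have "int n - 1 = int m" using Suc by simp
  moreover have "dp n = card (R n) - card (R m)" using Suc unfolding dp_def by simp
  ultimately show ?thesis unfolding delta_rank_size_def by (simp only: of_nat_diff rs)
qed

section \<open>Powers of \<open>U\<close> on the kernel of \<open>D\<close>\<close>

fun Upow :: "nat \<Rightarrow> nat \<Rightarrow> ('a \<Rightarrow> int) \<Rightarrow> ('a \<Rightarrow> int)" where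
  "Upow n 0 f = f" |
  "Upow n (Suc j) f = U (n + j) (Upow n j f)"

lemma Upow_M: "f \<in> M n \<Longrightarrow> Upow n j f \<in> M (n + j)"
  by (induction j) (auto simp: U_M)

lemma lin_Upow: "zlinear (Upow n j)"
proof (induction j)
  case 0
  show ?case unfolding zlinear_def by simp
next
  case (Suc j)
  then show ?case using lin_U[of "n + j"] unfolding zlinear_def by simp
qed

lemma split_Upow:
  assumes "f \<in> M n" "Upow n j f = of_int q * g"
  shows "\<exists>f'\<in>M n. f = of_int q * f'"
  using assms(2)
proof (induction j arbitrary: g)
  case 0
  then have eq: "f = of_int q * g" by simp
  have "q dvd f x" for x unfolding eq fun_apply by simp
  then show ?case using fsupp_divide[of f "R n" q] assms(1) unfolding ZP_def by blast
next
  case (Suc j)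
  then obtain h where "Upow n j f = of_int q * h" using split_U[OF Upow_M[OF assms(1)]] by fastforce
  then show ?case by (rule Suc.IH)
qed

text \<open>The analogue of the derivative of a power: moving \<open>D\<close> past each of the
  \<open>Suc j\<close> factors \<open>U\<close> contributes \<open>r\<close>, until \<open>D\<close>
  meets \<open>f\<close>.\<close>

lemma D_Upow:
  assumes f: "f \<in> M n" "D n f = 0"
  shows "D (n + Suc j) (Upow n (Suc j) f) = of_int (int (r * Suc j)) * Upow n j f"
proof (induction j)
  case 0
  have "D (n + Suc 0) (Upow n (Suc 0) f) = DU n f" unfolding DUmap_def by simp
  also have "\<dots> = of_int (int (r * Suc 0)) * Upow n 0 f"
    using commutation[OF f(1)] f(2) zlinear_zero[OF lin_U] by simp
  finally show ?case .
next
  case (Suc j)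
  have "D (n + Suc (Suc j)) (Upow n (Suc (Suc j)) f) = DU (n + Suc j) (Upow n (Suc j) f)" unfolding DUmap_def by simp
  also have "\<dots> = U (n + j) (D (n + Suc j) (Upow n (Suc j) f)) + of_int (int r) * Upow n (Suc j) f"
    using commutation_Suc[of "Upow n (Suc j) f" "n + j"] Upow_M[OF f(1), of "Suc j"] by simp
  also have "\<dots> = of_int (int (r * Suc j)) * Upow n (Suc j) f + of_int (int r) * Upow n (Suc j) f"
    unfolding Suc.IH by (simp only: zlinear_scale[OF lin_U] Upow.simps)
  also have "\<dots> = of_int (int (r * Suc (Suc j))) * Upow n (Suc j) f" by (simp add: algebra_simps)
  finally show ?case .
qed

text \<open>Modulo a prime divisor \<open>q\<close> of \<open>r * j\<close>, the map \<open>U\<^sup>j\<close> sends the kernel of \<open>D n\<close> injectively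
  into the kernel of \<open>D (n + j)\<close>.\<close>

lemma dp_mono:
  assumes q: "prime (q::nat)" "q dvd r * j"
  shows "dp n \<le> dp (n + j)"
proof (cases j)
  case (Suc i)
  obtain J b where J: "zbasis {x \<in> M n. D n x = 0} (J :: 'a set) b" "card J = dp n" using kernel_basis[of n] by blast
  obtain J' b' where J': "zbasis {x \<in> M (n + j). D (n + j) x = 0} (J' :: 'a set) b'" "card J' = dp (n + j)"
    using kernel_basis[of "n + j"] by blast
  obtain t where t: "r * j = q * t" using q(2) by (rule dvdE)
  have bM: "b x \<in> M n" "D n (b x) = 0" if "x \<in> J" for x using zbasis_mem[OF J(1) that] by auto
  have "\<exists>y\<in>M (n + j). D (n + j) y = of_int (int t) * Upow n i (b x)" if "x \<in> J" for x
  proof -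
    have "of_int (int t) * Upow n i (b x) \<in> M (n + i)" by (rule zsubmodule_scale[OF sub_M Upow_M[OF bM(1)[OF that]]])
    from ud.surjD[OF this] show ?thesis using Suc by simp
  qed
  then obtain y where y: "\<And>x. x \<in> J \<Longrightarrow> y x \<in> M (n + j) \<and> D (n + j) (y x) = of_int (int t) * Upow n i (b x)" by metis
  \<comment> \<open>\<open>D\<close> sends \<open>Upow n j (b x)\<close> to \<open>r * j\<close>,
    that is \<open>q * t\<close>, times the lower power; subtracting \<open>q\<close> times
    \<open>y x\<close> cancels this and changes nothing modulo \<open>q\<close>.\<close>
  define f where "f = (\<lambda>x. Upow n j (b x) - of_int (int q) * y x)"
  have "card J \<le> card J'"
  proof (rule independent_mod_card_le[OF J'(1) zbasis_finite[OF J(1)], of "int q" f])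
    show "1 < int q" using prime_gt_1_nat[OF q(1)] by simp
    show "f x \<in> {x \<in> M (n + j). D (n + j) x = 0}" if x: "x \<in> J" for x
    proof -
      have "D (n + j) (Upow n j (b x)) = of_int (int (q * t)) * Upow n i (b x)"
      proof -
        have "r * Suc i = q * t" using t Suc by simp
        then show ?thesis using D_Upow[OF bM[OF x], of i] unfolding Suc by (simp only:)
      qed
      then have "D (n + j) (f x) = 0"
        unfolding f_def using y[OF x] by (simp add: zlinear_diff[OF lin_D] zlinear_scale[OF lin_D] mult.assoc)
      moreover have "f x \<in> M (n + j)"
        unfolding f_def using y[OF x] Upow_M[OF bM(1)[OF x]] by (intro zsubmodule_diff[OF sub_M] zsubmodule_scale[OF sub_M]) auto
      ultimately show ?thesis by simp
    qed
    fix c z x assume z: "z \<in> {x \<in> M (n + j). D (n + j) x = 0}"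
      and eq: "(\<Sum>x\<in>J. of_int (c x) * f x) = of_int (int q) * z" and x: "x \<in> J"
    let ?s = "\<Sum>x\<in>J. of_int (c x) * b x"
    have "Upow n j ?s = (\<Sum>x\<in>J. of_int (c x) * Upow n j (b x))"
      by (simp only: zlinear_sum[OF lin_Upow] zlinear_scale[OF lin_Upow])
    also have "\<dots> = (\<Sum>x\<in>J. of_int (c x) * f x + of_int (int q) * (of_int (c x) * y x))"
      unfolding f_def by (rule sum.cong) (simp_all add: algebra_simps)
    also have "\<dots> = of_int (int q) * (z + (\<Sum>x\<in>J. of_int (c x) * y x))"
      by (simp only: sum.distrib eq sum_distrib_left distrib_left)
    finally have "Upow n j ?s = of_int (int q) * (z + (\<Sum>x\<in>J. of_int (c x) * y x))" .
    moreover have sK: "?s \<in> M n" "D n ?s = 0" using zbasis_comb[OF J(1), of c] by auto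
    ultimately obtain g where g: "g \<in> M n" "?s = of_int (int q) * g" using split_Upow by blast
    \<comment> \<open>The quotient by \<open>q\<close> lies in the kernel again, so its coordinates
      show that \<open>q\<close> divides the \<open>c x\<close>.\<close>
    have "of_int (int q) * D n g = 0" using sK(2) unfolding g(2) zlinear_scale[OF lin_D] .
    then have "(of_int (int q) * D n g) u = 0" for u by (simp only: zero_fun_apply)
    then have "D n g u = 0" for u using q(1) unfolding fun_apply by simp
    then have "D n g = 0" by (auto simp: fun_apply)
    then have "g \<in> {x \<in> M n. D n x = 0}" using g(1) by simp
    then obtain d where d: "g = (\<Sum>x\<in>J. of_int (d x) * b x)" by (rule zbasis_obtain[OF J(1)])
    have "(\<Sum>x\<in>J. of_int (c x - int q * d x) * b x) = 0"
      using g(2) unfolding d by (simp add: sum_distrib_left sum_subtractf left_diff_distrib mult.assoc)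
    then have "c x - int q * d x = 0" by (rule zbasis_indep[OF J(1) _ x])
    then show "int q dvd c x" by simp
  qed
  then show ?thesis using J(2) J'(2) by simp
qed simp

text \<open>An eigenvector of \<open>DU n\<close> for the eigenvalue \<open>r * j\<close> is mapped by \<open>D\<close> to one of \<open>DU (n - 1)\<close> for
  \<open>r * (j - 1)\<close>, and eventually into the kernel of \<open>D (n + 1 - j)\<close>.\<close>

lemma eigenvector_descent:
  assumes "1 \<le> j" "j \<le> n + 1" and q: "prime q" "r * (n + 1) < q"
  shows "\<exists>F. zlinear F \<and> (\<forall>e\<in>M n. DU n e = of_int (int (r * j)) * e \<longrightarrow>
    F e \<in> {x \<in> M (n + 1 - j). D (n + 1 - j) x = 0} \<and>
    (\<forall>z\<in>M (n + 1 - j). F e = of_int (int q) * z \<longrightarrow> (\<exists>y\<in>M n. e = of_int (int q) * y)))"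
  using assms
proof (induction j arbitrary: n rule: dec_induct)
  case base
  have "D n e = 0" if e: "e \<in> M n" "DU n e = of_int (int (r * 1)) * e" for e
  proof (cases n)
    case (Suc m)
    \<comment> \<open>For the eigenvalue \<open>r\<close> the commutation rule leaves
      \<open>U (D e) = 0\<close>, and \<open>U\<close> is injective.\<close>
    have "U m (D n e) = 0" using commutation[OF e(1)] e(2) Suc by simp
    then show ?thesis using U_inj D_M Suc by blast
  qed (simp add: D_0)
  then show ?case by (intro exI[of _ "\<lambda>x. x"]) (auto simp: zlinear_def)
next
  case (step j)
  then obtain m where n: "n = Suc m" by (cases n) auto
  have "r * (m + 1) < q" using step.prems n by simp
  then obtain F where F: "zlinear F" and FD: "\<And>e. e \<in> M m \<Longrightarrow> DU m e = of_int (int (r * j)) * e \<Longrightarrow>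
    F e \<in> {x \<in> M (m + 1 - j). D (m + 1 - j) x = 0} \<and>
    (\<forall>z\<in>M (m + 1 - j). F e = of_int (int q) * z \<longrightarrow> (\<exists>y\<in>M m. e = of_int (int q) * y))"
    using step.IH[of m] step.prems n by auto
  have idx: "n + 1 - Suc j = m + 1 - j" using n by simp
  show ?case unfolding idx
  proof (intro exI[of _ "\<lambda>x. F (D n x)"] conjI ballI impI)
    show "zlinear (\<lambda>x. F (D n x))" using F lin_D[of n] unfolding zlinear_def by simp
  next
    fix e assume e: "e \<in> M n" and eig: "DU n e = of_int (int (r * Suc j)) * e"
    have UDe: "U m (D n e) = of_int (int (r * j)) * e"
      using commutation[OF e] eig n by (simp add: algebra_simps)
    have DM: "D n e \<in> M m" using D_M n by simp
    have "DU m (D n e) = D n (U m (D n e))" unfolding DUmap_def n by simp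
    also have "\<dots> = of_int (int (r * j)) * D n e" unfolding UDe by (rule zlinear_scale[OF lin_D])
    finally have F1: "F (D n e) \<in> {x \<in> M (m + 1 - j). D (m + 1 - j) x = 0}"
      and F2: "\<And>z. z \<in> M (m + 1 - j) \<Longrightarrow> F (D n e) = of_int (int q) * z \<Longrightarrow> \<exists>y\<in>M m. D n e = of_int (int q) * y"
      using FD[OF DM] by blast+
    show "F (D n e) \<in> {x \<in> M (m + 1 - j). D (m + 1 - j) x = 0}" by (rule F1)
    fix z assume "z \<in> M (m + 1 - j)" "F (D n e) = of_int (int q) * z"
    then obtain y where y: "y \<in> M m" "D n e = of_int (int q) * y" using F2 by blast
    \<comment> \<open>Divisibility climbs back from \<open>D n e\<close> to \<open>e\<close>:
      applying \<open>U\<close> yields \<open>r * j\<close> times \<open>e\<close>, and the prime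
      \<open>q\<close> exceeds \<open>r * j\<close>.\<close>
    have "of_int (int (r * j)) * e = of_int (int q) * U m y"
      using UDe unfolding y(2) zlinear_scale[OF lin_U] by simp
    then have "int (r * j) * e x = int q * U m y x" for x
      using fun_cong[of "of_int (int (r * j)) * e" "of_int (int q) * U m y" x] unfolding fun_apply by blast
    then have "int q dvd int (r * j) * e x" for x by simp
    moreover have "\<not> int q dvd int (r * j)"
    proof
      assume "int q dvd int (r * j)"
      then have "q dvd r * j" by (simp only: of_nat_dvd_iff)
      moreover have "r * j > 0" using r_pos step.hyps by simp
      ultimately have "q \<le> r * j" by (rule dvd_imp_le)
      also have "\<dots> \<le> r * (n + 1)" by (rule mult_le_mono2) (use step.prems in simp)
      finally show False using step.prems by simp
    qed
    moreover have "prime (int q)" using step.prems(2) by simp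
    ultimately have "int q dvd e x" for x using prime_dvd_mult_iff[of "int q" "int (r * j)" "e x"] by blast
    then show "\<exists>y\<in>M n. e = of_int (int q) * y" using fsupp_divide[of e "R n"] e unfolding ZP_def by blast
  qed
qed

text \<open>For every \<open>a i\<close> with root \<open>r * j\<close> the cofactor of that root,
  applied to \<open>v i\<close>, is an eigenvector. Cofactors are monic of lower degree, so these
  vectors are independent modulo every prime; a prime above \<open>r * (n + 1)\<close> lets
  \<open>eigenvector_descent\<close> carry this into the kernel of
  \<open>D (n + 1 - j)\<close>.\<close>

lemma card_roots_le:
  assumes C: "cyclic_decomp (M n) (DU n) k v a" and j: "1 \<le> j" "j \<le> n + 1"
  shows "card {i. i < k \<and> poly (a i) (int (r * j)) = 0} \<le> dp (n + 1 - j)"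
proof -
  obtain q where q: "prime (q::nat)" "r * (n + 1) < q" using bigger_prime by blast
  let ?T = "{i. i < k \<and> poly (a i) (int (r * j)) = 0}"
  obtain F where F: "zlinear F" and F1: "\<And>e. e \<in> M n \<Longrightarrow> DU n e = of_int (int (r * j)) * e \<Longrightarrow>
      F e \<in> {x \<in> M (n + 1 - j). D (n + 1 - j) x = 0}"
    and F2: "\<And>e z. e \<in> M n \<Longrightarrow> DU n e = of_int (int (r * j)) * e \<Longrightarrow> z \<in> M (n + 1 - j) \<Longrightarrow>
      F e = of_int (int q) * z \<Longrightarrow> \<exists>y\<in>M n. e = of_int (int q) * y"
    using eigenvector_descent[OF j q] by blast
  obtain J b where J: "zbasis {x \<in> M (n + 1 - j). D (n + 1 - j) x = 0} (J :: 'a set) b" "card J = dp (n + 1 - j)"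
    using kernel_basis by blast
  have "\<forall>i\<in>?T. \<exists>g. a i = [:-int (r * j), 1:] * g" using poly_eq_0_iff_dvd by (auto simp only: dvd_def)
  then obtain g where g: "\<And>i. i \<in> ?T \<Longrightarrow> a i = [:-int (r * j), 1:] * g i" by metis
  define e where "e = (\<lambda>i. poly_act (DU n) (g i) (v i))"
  have eM: "e i \<in> M n" and eig: "DU n (e i) = of_int (int (r * j)) * e i" if i: "i \<in> ?T" for i
  proof -
    have "v i \<in> M n" using cyclic_decompD(1)[OF C] i by simp
    then show "e i \<in> M n" unfolding e_def by (rule poly_act_closed[OF lin_DU sub_M DU_M])
    have "poly_act (DU n) [:-int (r * j), 1:] (e i) = 0"
      using cyclic_decompD(2)[OF C, of i] i g[OF i] unfolding e_def poly_act_mult[OF lin_DU, symmetric] by simp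
    then show "DU n (e i) = of_int (int (r * j)) * e i"
      by (simp add: poly_act_pCons[OF lin_DU] poly_act_const zlinear_zero[OF lin_DU])
  qed
  have "card ?T \<le> card J"
  proof (rule independent_mod_card_le[OF J(1), of ?T "int q" "\<lambda>i. F (e i)"])
    show "1 < int q" using prime_gt_1_nat[OF q(1)] by simp
    show "F (e i) \<in> {x \<in> M (n + 1 - j). D (n + 1 - j) x = 0}" if "i \<in> ?T" for i
      by (rule F1[OF eM[OF that] eig[OF that]])
    fix c z i assume z: "z \<in> {x \<in> M (n + 1 - j). D (n + 1 - j) x = 0}"
      and eq: "(\<Sum>i\<in>?T. of_int (c i) * F (e i)) = of_int (int q) * z" and i: "i \<in> ?T"
    let ?e = "\<Sum>i\<in>?T. of_int (c i) * e i"
    have "F ?e = of_int (int q) * z" using eq by (simp only: zlinear_sum[OF F] zlinear_scale[OF F])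
    moreover have "?e \<in> M n" using eM by (intro zsubmodule_sum[OF sub_M] zsubmodule_scale[OF sub_M])
    moreover have "DU n ?e = of_int (int (r * j)) * ?e"
      unfolding zlinear_sum[OF lin_DU] zlinear_scale[OF lin_DU] sum_distrib_left
      by (rule sum.cong) (auto simp only: eig mult.left_commute)
    ultimately obtain y where y: "y \<in> M n" "?e = of_int (int q) * y" using F2 z by blast
    have "lead_coeff (a i) = 1" using cyclic_decompD(3)[OF C] i by simp
    then have "lead_coeff (g i) = 1" unfolding g[OF i] lead_coeff_mult by simp
    moreover have "g i \<noteq> 0" using calculation by auto
    then have "degree (g i) < degree (a i)" unfolding g[OF i] by (simp add: degree_mult_eq del: mult_pCons_left)
    ultimately show "int q dvd c i"
      using cyclic_decomp_indep_mod[OF C _ y(1), of ?T c g "int q" i] y(2) i unfolding e_def by auto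
  qed simp
  then show ?thesis using J(2) by simp
qed

text \<open>Eigenvalues rise by \<open>r\<close> with each rank. Shifting the variable by
  \<open>r\<close> turns the product for rank \<open>n + 1\<close> into \<open>[:0, 1:]\<close>
  times that for rank \<open>n\<close>, which acts as \<open>D\<close>, then the old product, then
  \<open>U\<close>.\<close>

lemma DU_annihilated:
  assumes "x \<in> M n"
  shows "poly_act (DU n) (\<Prod>j<Suc n. [:-int (r * Suc j), 1:]) x = 0"
  using assms
proof (induction n arbitrary: x)
  case 0
  have "DU 0 x = of_int (int r) * x" using commutation[OF 0] zlinear_zero[OF lin_U] by (simp add: D_0)
  then show ?case by (simp add: poly_act_pCons[OF lin_DU] poly_act_const zlinear_zero[OF lin_DU])
next
  case (Suc n)
  let ?Q = "\<Prod>j<Suc n. [:-int (r * Suc j), 1:]"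
  have lin: "[:-int (r * Suc j), 1:] \<circ>\<^sub>p [:int r, 1:] = [:-int (r * j), 1:]" for j
    by (simp add: pcompose_pCons algebra_simps)
  have "(\<Prod>j<Suc (Suc n). [:-int (r * Suc j), 1:]) \<circ>\<^sub>p [:int r, 1:] = (\<Prod>j<Suc (Suc n). [:-int (r * j), 1:])"
    unfolding pcompose_prod lin ..
  also have "\<dots> = [:-int (r * 0), 1:] * ?Q" by (rule prod.lessThan_Suc_shift)
  also have "\<dots> = pCons 0 ?Q" by simp
  finally have comp: "(\<Prod>j<Suc (Suc n). [:-int (r * Suc j), 1:]) \<circ>\<^sub>p [:int r, 1:] = pCons 0 ?Q" .
  have "poly_act (DU (Suc n)) (\<Prod>j<Suc (Suc n). [:-int (r * Suc j), 1:]) x = poly_act (U n \<circ> D (Suc n)) (pCons 0 ?Q) x"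
    unfolding comp[symmetric]
    by (rule poly_act_shift[OF ud.lin_UD lin_DU sub_M _ _ Suc.prems]) (auto simp: U_M commutation_Suc)
  also have "\<dots> = U n (poly_act (D (Suc n) \<circ> U n) ?Q (D (Suc n) x))"
    unfolding ud.poly_act_UD_pCons[OF Suc.prems] by simp
  also have "\<dots> = U n (poly_act (DU n) ?Q (D (Suc n) x))" unfolding DUmap_def ..
  also have "\<dots> = 0" unfolding Suc.IH[OF D_M] by (rule zlinear_zero[OF lin_U])
  finally show ?case .
qed

lemma abs_coeff_0_eq:
  assumes C: "cyclic_decomp (M n) (DU n) k v a" and i: "i < k"
  shows "\<bar>coeff (a i) 0\<bar> = (\<Prod>j\<in>{j\<in>{1..n+1}. poly (a i) (int (r * j)) = 0}. int (r * j))"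
proof -
  let ?S = "(\<lambda>j. int (r * j)) ` {1..n+1}"
  have inj: "inj_on (\<lambda>j. int (r * j)) X" for X using r_pos by (auto simp: inj_on_def)
  have "a i dvd (\<Prod>j<Suc n. [:-int (r * Suc j), 1:])"
    by (rule cyclic_decomp_annihilates[OF C i]) (rule DU_annihilated[OF cyclic_decompD(1)[OF C i]])
  then have "a i dvd (\<Prod>j\<in>?S. [:-j, 1:])" 
    unfolding prod.reindex[OF inj] using prod.atLeast1_atMost_eq[of "\<lambda>j. [:-int (r * j), 1:]" "Suc n"] by (simp del: prod.lessThan_Suc)
  then have a: "a i = (\<Prod>j\<in>{j\<in>?S. poly (a i) j = 0}. [:-j, 1:])"
    by (rule monic_dvd_linear_prod[OF _ _ cyclic_decompD(3)[OF C i], rotated]) simp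
  have S: "{j\<in>?S. poly (a i) j = 0} = (\<lambda>j. int (r * j)) ` {j\<in>{1..n+1}. poly (a i) (int (r * j)) = 0}" by auto
  have "\<bar>coeff (a i) 0\<bar> = (\<Prod>j\<in>{j\<in>?S. poly (a i) j = 0}. \<bar>j\<bar>)"
    by (subst a) (rule abs_coeff_0_linear_prod)
  then show ?thesis unfolding S prod.reindex[OF inj] by simp
qed

lemma cyclic_decomp_Suc:
  assumes C: "cyclic_decomp (M n) (DU n) k v a"
    and growth: "if r = 1 then n \<ge> 1 \<longrightarrow> dp (n - 1) < dp (Suc n) else dp n < dp (Suc n)"
  shows "\<exists>k v a. cyclic_decomp (M (Suc n)) (DU (Suc n)) k v a"
proof -
  \<comment> \<open>Padding by the kernel rank \<open>m\<close>: the first \<open>k\<close> of the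
    \<open>k + m\<close> generators will keep their annihilators, the last \<open>m\<close> gain a
    factor \<open>[:0, 1:]\<close>.\<close>
  define m where "m = dp (Suc n)"
  define a' where "a' = (\<lambda>i. if i < m then 1 else a (i - m))"
  define v' where "v' = (\<lambda>i. if i < m then 0 else v (i - m))"
  have C': "cyclic_decomp (M n) (DU n) (k + m) v' a'"
    using cyclic_decomp_pad[OF C sub_M lin_DU, of m] unfolding a'_def v'_def by (simp add: add.commute)
  \<comment> \<open>By the divisor chain a root of \<open>a' i\<close> is a root of all later ones,
    so \<open>k + m - i\<close> polynomials share it.\<close>
  have count: "k + m - i \<le> dp (n + 1 - j)" if "i < k + m" "1 \<le> j" "j \<le> n + 1" "poly (a' i) (int (r * j)) = 0" for i j
  proof -
    have "{i..<k+m} \<subseteq> {i. i < k + m \<and> poly (a' i) (int (r * j)) = 0}"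
    proof
      fix i' assume i': "i' \<in> {i..<k+m}"
      then have "a' i dvd a' i'" using cyclic_decomp_chain[OF C'] by simp
      then have "poly (a' i') (int (r * j)) = 0" using that(4) by (auto simp: dvd_def)
      then show "i' \<in> {i. i < k + m \<and> poly (a' i) (int (r * j)) = 0}" using i' by simp
    qed
    then have "card {i..<k+m} \<le> card {i. i < k + m \<and> poly (a' i) (int (r * j)) = 0}" by (intro card_mono) auto
    also have "\<dots> \<le> dp (n + 1 - j)" by (rule card_roots_le[OF C' that(2,3)])
    finally show ?thesis by simp
  qed
  have prime_r: "\<exists>q::nat. prime q \<and> q dvd t" if "t \<noteq> 1" for t using prime_factor_nat[OF that] .
  have mono: "dp i \<le> dp (i + j)" if "r * j \<noteq> 1" for i j using prime_r[OF that] dp_mono by blast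
  have roots: "r = 1 \<and> (j = 1 \<or> j = 3 \<and> i = k)"
    if i: "i \<le> k" "i < k + m" and j: "1 \<le> j" "j \<le> n + 1" and root: "poly (a' i) (int (r * j)) = 0" for i j
  proof -
    have le: "m + (k - i) \<le> dp (n + 1 - j)" using count[OF i(2) j root] i by simp
    have r1: "r = 1"
    proof (rule ccontr)
      assume r: "r \<noteq> 1"
      \<comment> \<open>\<open>r * (j - 1)\<close> is not 1, so \<open>mono\<close> reaches rank
        \<open>n\<close>, whose difference is strictly below \<open>m\<close>.\<close>
      have "dp (n + 1 - j) \<le> dp n" using mono[of "j - 1" "n + 1 - j"] r j by (auto simp: nat_mult_eq_1_iff)
      then show False using growth r le unfolding m_def by simp
    qed
    have "j = 1 \<or> j = 3 \<and> i = k"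
    proof (rule ccontr)
      assume H: "\<not> (j = 1 \<or> j = 3 \<and> i = k)"
      then have j2: "j \<ge> 2" using j by simp
      then have g: "dp (n - 1) < m" using growth r1 j unfolding m_def by simp
      show False
      proof (cases "j = 3")
        case True
        \<comment> \<open>A jump by \<open>j - 2\<close> would have length 1, so \<open>mono\<close>
          jumps by 3 up to rank \<open>n + 1\<close>. This allows equality, which for
          \<open>i < k\<close> the extra \<open>k - i\<close> polynomials exclude.\<close>
        have "dp (n + 1 - j) \<le> m" using mono[of j "n + 1 - j"] j j2 r1 unfolding m_def by simp
        then show False using le H True i by simp
      next
        case False
        \<comment> \<open>The jump by \<open>j - 2\<close> ends at rank \<open>n - 1\<close>, whose
          difference is strictly below \<open>m\<close> when \<open>r = 1\<close>.\<close>
        have "j - 2 \<noteq> 1" using False j2 by simp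
        then have "dp (n + 1 - j) \<le> dp (n + 1 - j + (j - 2))" using mono[of "j - 2" "n + 1 - j"] r1 by simp
        also have "n + 1 - j + (j - 2) = n - 1" using j j2 by simp
        finally show False using g le by simp
      qed
    qed
    then show ?thesis using r1 by blast
  qed
  have unit: "\<bar>coeff (a' i) 0\<bar> = 1" if i: "i < k" for i
  proof -
    have "int (r * j) = 1" if "j \<in> {j\<in>{1..n+1}. poly (a' i) (int (r * j)) = 0}" for j
      using roots[of i j] i that by auto
    then show ?thesis unfolding abs_coeff_0_eq[OF C' trans_less_add1[OF i]] by (intro prod.neutral ballI)
  qed
  have small: "\<bar>coeff (a' k) 0\<bar> = 1 \<or> \<bar>coeff (a' k) 0\<bar> = 3" if "m > 0"
  proof -
    let ?S = "{j\<in>{1..n+1}. poly (a' k) (int (r * j)) = 0}"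
    have k: "k < k + m" using that by simp
    have S: "r = 1 \<and> (j = 1 \<or> j = 3)" if "j \<in> ?S" for j using roots[of k j] k that by auto
    have "(\<Prod>j\<in>?S. int (r * j)) = (\<Prod>j\<in>?S \<inter> {3}. int (r * j))"
    proof (rule prod.mono_neutral_right)
      show "\<forall>j\<in>?S - ?S \<inter> {3}. int (r * j) = 1"
      proof
        fix j assume "j \<in> ?S - ?S \<inter> {3}"
        then have "j \<in> ?S" "j \<noteq> 3" by blast+
        then show "int (r * j) = 1" using S[of j] by simp
      qed
    qed auto
    also have "\<dots> = 1 \<or> \<dots> = 3"
    proof (cases "3 \<in> ?S")
      case True
      then have "?S \<inter> {3} = {3}" by blast
      moreover have "r = 1" using S[OF True] by blast
      ultimately show ?thesis by simp
    next
      case False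
      then have "?S \<inter> {3} = {}" by blast
      then show ?thesis by simp
    qed
    finally show ?thesis unfolding abs_coeff_0_eq[OF C' k] .
  qed
  obtain J b where J: "zbasis {x \<in> M (Suc n). D (Suc n) x = 0} (J :: 'a set) b" "card J = m"
    using kernel_basis[of "Suc n"] unfolding m_def by blast
  have "cyclic_decomp (M n) (D (Suc n) \<circ> U n) (k + m) v' a'" using C' unfolding DUmap_def .
  from ud.cyclic_decomp_step[OF this J unit small] obtain w where
    "cyclic_decomp (M (Suc n)) (U n \<circ> D (Suc n)) (k + m) w (\<lambda>i. if i < k then a' i else [:0, 1:] * a' i)" by blast
  from cyclic_decomp_shift[OF this ud.lin_UD lin_DU sub_M, of "Suc n" "int r"] show ?thesis
    by (auto simp: U_M commutation_Suc)
qed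

end

section \<open>Smith normal form\<close>

lemma mat_right_inverse_imp_left_inverse:
  fixes A :: "'b::comm_ring_1 mat"
  assumes A: "A \<in> carrier_mat n n" and B: "B \<in> carrier_mat n n" and AB: "A * B = 1\<^sub>m n"
  shows "B * A = 1\<^sub>m n"
proof -
  let ?C = "det B \<cdot>\<^sub>m adj_mat A"
  have adj: "adj_mat A \<in> carrier_mat n n" "adj_mat A * A = det A \<cdot>\<^sub>m 1\<^sub>m n" using adj_mat[OF A] by blast+
  have C: "?C \<in> carrier_mat n n" using adj(1) by simp
  have det: "det A * det B = 1" using det_mult[OF A B] AB by simp
  have CA: "?C * A = 1\<^sub>m n"
  proof -
    have "?C * A = det B \<cdot>\<^sub>m (adj_mat A * A)" using adj(1) A by (rule mult_smult_assoc_mat)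
    also have "\<dots> = (det A * det B) \<cdot>\<^sub>m 1\<^sub>m n" unfolding adj(2) by (auto simp: ac_simps)
    finally show ?thesis unfolding det by auto
  qed
  have "B = ?C * A * B" unfolding CA using B by simp
  also have "\<dots> = ?C * (A * B)" by (rule assoc_mult_mat[OF C A B])
  also have "\<dots> = ?C" unfolding AB by (rule right_mult_one_mat[OF C])
  finally show ?thesis using CA by simp
qed

text \<open>The columns of \<open>R\<close> and \<open>T\<close> are new bases of source and target;
  these may differ, since Smith form allows independent row and column operations.\<close>

lemma has_snf_diagonalised:
  fixes X :: "'b::comm_ring_1 mat"
  assumes X: "X \<in> carrier_mat n n" and R: "R \<in> carrier_mat n n" "R' \<in> carrier_mat n n" "R * R' = 1\<^sub>m n"
    and T: "T \<in> carrier_mat n n" "T' \<in> carrier_mat n n" "T * T' = 1\<^sub>m n"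
    and eq: "X * R = T * mat n n (\<lambda>(i, j). if i = j then d i else 0)"
    and chain: "\<And>i. Suc i < n \<Longrightarrow> d i dvd d (Suc i)"
  shows "has_snf X"
proof -
  let ?Z = "mat n n (\<lambda>(i, j). if i = j then d i else 0)"
  have T'T: "T' * T = 1\<^sub>m n" by (rule mat_right_inverse_imp_left_inverse[OF T])
  have R'R: "R' * R = 1\<^sub>m n" by (rule mat_right_inverse_imp_left_inverse[OF R])
  have Z: "?Z \<in> carrier_mat n n" by simp
  have "T' * X * R = T' * (X * R)" by (rule assoc_mult_mat[OF T(2) X R(1)])
  also have "\<dots> = T' * T * ?Z" unfolding eq by (rule assoc_mult_mat[OF T(2) T(1) Z, symmetric])
  also have "\<dots> = ?Z" unfolding T'T by simp
  finally have Zeq: "T' * X * R = ?Z" .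
  have "invertible_mat T'" unfolding invertible_mat_def inverts_mat_def using T T'T by auto
  moreover have "invertible_mat R" unfolding invertible_mat_def inverts_mat_def using R R'R by auto
  ultimately show ?thesis unfolding has_snf_def
    using X T R chain by (intro exI[of _ T'] exI[of _ R]) (auto simp: Zeq diagonal_mat_def)
qed

text \<open>The \<open>\<int>[x]\<close>-span of a family of functions. The two transition matrices
  are shown to be invertible by letting their columns generate all indicator functions.\<close>

inductive_set pspan :: "('a \<Rightarrow> int poly) set \<Rightarrow> ('a \<Rightarrow> int poly) set" for F where
  pspan_gen: "f \<in> F \<Longrightarrow> f \<in> pspan F" |
  pspan_zero: "(\<lambda>x. 0) \<in> pspan F" |
  pspan_add: "f \<in> pspan F \<Longrightarrow> g \<in> pspan F \<Longrightarrow> (\<lambda>x. f x + g x) \<in> pspan F" |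
  pspan_scale: "f \<in> pspan F \<Longrightarrow> (\<lambda>x. h * f x) \<in> pspan F"

lemma pspan_diff: "f \<in> pspan F \<Longrightarrow> g \<in> pspan F \<Longrightarrow> (\<lambda>x. f x - g x) \<in> pspan F"
  using pspan_add[of f F "\<lambda>x. (-1) * g x"] pspan_scale[of g F "-1"] by simp

lemma pspan_sum: "(\<And>i. i \<in> A \<Longrightarrow> f i \<in> pspan F) \<Longrightarrow> (\<lambda>x. \<Sum>i\<in>A. f i x) \<in> pspan F"
  by (induction A rule: infinite_finite_induct) (auto intro: pspan_zero pspan_add)

lemma pspan_image_obtain:
  assumes "f \<in> pspan (g ` {..<n::nat})"
  shows "\<exists>h. \<forall>x. f x = (\<Sum>c<n. g c x * h c)"
  using assms
proof (induction rule: pspan.induct)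
  case (pspan_gen f)
  then obtain c where c: "c < n" "f = g c" by auto
  have "f x = (\<Sum>c'<n. g c' x * (if c' = c then 1 else 0))" for x
    using c by (simp add: if_distrib cong: if_cong)
  then show ?case by (intro exI[of _ "\<lambda>c'. if c' = c then 1 else 0"]) simp
next
  case pspan_zero
  show ?case by (intro exI[of _ "\<lambda>_. 0"]) simp
next
  case (pspan_add f f')
  then obtain h h' where "\<forall>x. f x = (\<Sum>c<n. g c x * h c)" "\<forall>x. f' x = (\<Sum>c<n. g c x * h' c)" by blast
  then show ?case by (intro exI[of _ "\<lambda>c. h c + h' c"]) (simp add: distrib_left sum.distrib)
next
  case (pspan_scale f p)
  then obtain h where "\<forall>x. f x = (\<Sum>c<n. g c x * h c)" by blast
  then show ?case by (intro exI[of _ "\<lambda>c. p * h c"]) (simp add: sum_distrib_left mult.left_commute)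
qed

lemma pspan_right_inverse:
  assumes es: "distinct es" "length es = n"
    and span: "\<And>y. y \<in> set es \<Longrightarrow> (\<lambda>x. [:if x = y then 1 else 0:]) \<in> pspan (g ` {..<n})"
  shows "\<exists>R'. R' \<in> carrier_mat n n \<and> mat n n (\<lambda>(i, c). g c (es ! i)) * R' = 1\<^sub>m n"
proof -
  have "\<forall>y\<in>set es. \<exists>h. \<forall>x. [:if x = y then 1 else 0:] = (\<Sum>c<n. g c x * h c)"
    using pspan_image_obtain[OF span] by blast
  then obtain h where h: "\<And>y x. y \<in> set es \<Longrightarrow> [:if x = y then 1 else 0:] = (\<Sum>c<n. g c x * h y c)" by metis
  let ?R' = "mat n n (\<lambda>(c, j). h (es ! j) c)"
  have "mat n n (\<lambda>(i, c). g c (es ! i)) * ?R' = 1\<^sub>m n"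
  proof (rule eq_matI)
    fix i j assume "i < dim_row (1\<^sub>m n :: int poly mat)" "j < dim_col (1\<^sub>m n :: int poly mat)"
    then have ij: "i < n" "j < n" by auto
    then have "(mat n n (\<lambda>(i, c). g c (es ! i)) * ?R') $$ (i, j) = (\<Sum>c<n. g c (es ! i) * h (es ! j) c)"
      by (simp add: scalar_prod_def atLeast0LessThan)
    also have "\<dots> = [:if es ! i = es ! j then 1 else 0:]" using h[of "es ! j" "es ! i"] ij es by simp
    also have "\<dots> = 1\<^sub>m n $$ (i, j)" using ij es by (simp add: nth_eq_iff_index_eq one_pCons)
    finally show "(mat n n (\<lambda>(i, c). g c (es ! i)) * ?R') $$ (i, j) = 1\<^sub>m n $$ (i, j)" .
  qed auto
  then show ?thesis by (intro exI[of _ ?R']) auto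
qed

lemma zbasis_card_eq:
  assumes I: "zbasis K I b" and J: "zbasis K J d"
  shows "card I = card J"
proof -
  have le: "card J \<le> card I" if I: "zbasis K I b" and J: "zbasis K J d"
    for I :: "'i set" and J :: "'j set" and b :: "'i \<Rightarrow> 'v::comm_ring_1" and d K
  proof (rule independent_mod_card_le[OF I zbasis_finite[OF J], of 2 d])
    show "d j \<in> K" if "j \<in> J" for j by (rule zbasis_mem[OF J that])
    fix c z j assume z: "z \<in> K" and eq: "(\<Sum>j\<in>J. of_int (c j) * d j) = of_int 2 * z" and j: "j \<in> J"
    obtain e where e: "z = (\<Sum>j\<in>J. of_int (e j) * d j)" using zbasis_obtain[OF J z] .
    have "(\<Sum>j\<in>J. of_int (c j - 2 * e j) * d j) = (\<Sum>j\<in>J. of_int (c j) * d j) - of_int 2 * z"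
      unfolding e sum_distrib_left sum_subtractf[symmetric] by (rule sum.cong) (simp_all add: algebra_simps)
    then have "(\<Sum>j\<in>J. of_int (c j - 2 * e j) * d j) = 0" using eq by simp
    then have "c j - 2 * e j = 0" by (rule zbasis_indep[OF J _ j])
    then show "2 dvd c j" by simp
  qed simp
  show ?thesis using le[OF I J] le[OF J I] by simp
qed

lemma poly_act_monic_reduce:
  assumes phi: "zlinear phi" and a: "lead_coeff a = 1" "degree a \<ge> 1" "poly_act phi a v = 0"
  obtains c where "poly_act phi q v = (\<Sum>j<degree a. of_int (c j) * (phi ^^ j) v)"
proof -
  obtain h p where hp: "q = a * h + p" "p = 0 \<or> degree p < degree a" using monic_division[OF a(1)] .
  have "poly_act phi (h * a) v = 0"
    unfolding poly_act_mult[OF phi] a(3) by (rule zlinear_zero[OF zlinear_poly_act[OF phi]])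
  then have "poly_act phi q v = poly_act phi p v" unfolding hp(1) poly_act_add by (simp add: mult.commute)
  also have "\<dots> = (\<Sum>j\<le>degree a - 1. of_int (coeff p j) * (phi ^^ j) v)"
    using hp(2) by (intro poly_act_eq_sum) auto
  also have "{..degree a - 1} = {..<degree a}" using a(2) by auto
  finally show ?thesis by (rule that)
qed

text \<open>Monic annihilators allow division with remainder, so powers below the degree suffice.
  Comparison with the standard basis gives the sum of the degrees, which makes the transition
  matrices square.\<close>

lemma cyclic_decomp_zbasis:
  assumes C: "cyclic_decomp M phi k v a" and deg: "\<And>i. i < k \<Longrightarrow> degree (a i) \<ge> 1"
    and M: "zsubmodule M" and phi: "zlinear phi" and inv: "\<And>v. v \<in> M \<Longrightarrow> phi v \<in> M"
  shows "zbasis M (Sigma {..<k} (\<lambda>i. {..<degree (a i)})) (\<lambda>(i, j). (phi ^^ j) (v i))" (is "zbasis M ?I ?b")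
proof -
  have comb: "(\<Sum>p\<in>?I. of_int (c p) * ?b p) = (\<Sum>i<k. poly_act phi (\<Sum>j<degree (a i). monom (c (i, j)) j) (v i))" for c
  proof -
    have m: "poly_act phi (monom z j) w = of_int z * (phi ^^ j) w" for z j w
    proof -
      have "poly_act phi (monom z j) w = (\<Sum>l\<le>j. of_int (coeff (monom z j) l) * (phi ^^ l) w)"
        by (rule poly_act_eq_sum) (rule degree_monom_le)
      also have "\<dots> = (\<Sum>l\<le>j. if l = j then of_int z * (phi ^^ l) w else 0)" by (rule sum.cong) auto
      finally show ?thesis by simp
    qed
    have "(\<Sum>p\<in>?I. of_int (c p) * ?b p) = (\<Sum>i<k. \<Sum>j<degree (a i). of_int (c (i, j)) * (phi ^^ j) (v i))"
      by (subst sum.Sigma) (auto intro!: sum.cong)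
    then show ?thesis by (simp only: poly_act_sum m)
  qed
  have pow: "(phi ^^ j) w \<in> M" if "w \<in> M" for j w using that by (induction j) (auto intro: inv)
  have "x \<in> range (\<lambda>c. \<Sum>p\<in>?I. of_int (c p) * ?b p)" if x: "x \<in> M" for x
  proof -
    obtain q where q: "x = (\<Sum>i<k. poly_act phi (q i) (v i))" using cyclic_decomp_obtain[OF C x] .
    have "\<forall>i\<in>{..<k}. \<exists>c. poly_act phi (q i) (v i) = (\<Sum>j<degree (a i). of_int (c j) * (phi ^^ j) (v i))"
    proof
      fix i assume "i \<in> {..<k}"
      then have i: "i < k" by simp
      obtain c where "poly_act phi (q i) (v i) = (\<Sum>j<degree (a i). of_int (c j) * (phi ^^ j) (v i))"
        using poly_act_monic_reduce[OF phi cyclic_decompD(3)[OF C i] deg[OF i] cyclic_decompD(2)[OF C i]] .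
      then show "\<exists>c. poly_act phi (q i) (v i) = (\<Sum>j<degree (a i). of_int (c j) * (phi ^^ j) (v i))" by (intro exI[of _ c])
    qed
    then obtain c where c: "\<And>i. i < k \<Longrightarrow> poly_act phi (q i) (v i) = (\<Sum>j<degree (a i). of_int (c i j) * (phi ^^ j) (v i))"
      unfolding Ball_def by (metis lessThan_iff)
    have "x = (\<Sum>i<k. \<Sum>j<degree (a i). of_int (c i j) * (phi ^^ j) (v i))" unfolding q by (rule sum.cong) (auto simp: c)
    also have "\<dots> = (\<Sum>p\<in>?I. of_int (case_prod c p) * ?b p)" by (subst sum.Sigma) (auto intro!: sum.cong)
    finally show ?thesis by (intro range_eqI[of _ _ "case_prod c"])
  qed
  moreover have "(\<Sum>p\<in>?I. of_int (c p) * ?b p) \<in> M" for c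
    using cyclic_decompD(1)[OF C] by (intro zsubmodule_sum[OF M] zsubmodule_scale[OF M]) (auto intro: pow)
  ultimately have range: "M = range (\<lambda>c. \<Sum>p\<in>?I. of_int (c p) * ?b p)" by blast
  have indep: "c p = 0" if eq: "(\<Sum>p\<in>?I. of_int (c p) * ?b p) = 0" and p: "p \<in> ?I" for c p
  proof -
    obtain i j where ij: "p = (i, j)" "i < k" "j < degree (a i)" using p by auto
    let ?q = "\<Sum>j<degree (a i). monom (c (i, j)) j"
    have "a i dvd ?q" by (rule cyclic_decompD(4)[OF C _ ij(2)]) (use eq comb in simp)
    moreover have "coeff ?q l = (if l < degree (a i) then c (i, l) else 0)" for l
      unfolding coeff_sum by simp
    then have "degree ?q \<le> degree (a i) - 1" by (intro degree_le) auto
    then have "degree ?q < degree (a i)" using deg[OF ij(2)] by simp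
    ultimately have "?q = 0" using dvd_imp_degree_le[of "a i" ?q] by fastforce
    then have "coeff ?q j = 0" by simp
    then show ?thesis using ij unfolding coeff_sum by simp
  qed
  show ?thesis unfolding zbasis_def using range indep by blast
qed

text \<open>The coefficients, as polynomials in \<open>y\<close>, of the quotient of \<open>a(y) - a(-x)\<close> by \<open>y + x\<close> are
  \<open>reflected_tail a (j + 1)\<close>, and \<open>reflected_tail a 0\<close> is \<open>a(-x)\<close>.\<close>

definition reflected_tail :: "int poly \<Rightarrow> nat \<Rightarrow> int poly" where
  "reflected_tail a j = (\<Sum>l\<le>degree a. [:coeff a (j + l):] * [:0, -1:] ^ l)"

text \<open>Horner's recursion at \<open>-x\<close>; it makes the sum in \<open>op_src\<close>
  telescope.\<close>

lemma reflected_tail_rec: "[:0, 1:] * reflected_tail a (Suc j) = [:coeff a j:] - reflected_tail a j"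
proof -
  let ?t = "\<lambda>l. [:coeff a (j + l):] * [:0, -1:] ^ l"
  have "reflected_tail a j = (\<Sum>l\<le>Suc (degree a). ?t l)"
    unfolding reflected_tail_def by (simp add: coeff_eq_0)
  also have "\<dots> = [:coeff a j:] + (\<Sum>l\<le>degree a. ?t (Suc l))" by (simp add: sum.atMost_Suc_shift del: sum.atMost_Suc)
  also have "(\<Sum>l\<le>degree a. ?t (Suc l)) = [:0, -1:] * reflected_tail a (Suc j)"
    unfolding reflected_tail_def sum_distrib_left by (rule sum.cong) (simp_all only: power_Suc mult.left_commute add_Suc_right add_Suc)
  finally show ?thesis by simp
qed

lemma reflected_tail_degree: "reflected_tail a (degree a) = [:lead_coeff a:]"
proof -
  have "reflected_tail a (degree a) = (\<Sum>l\<le>degree a. if l = 0 then [:lead_coeff a:] else 0)"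
    unfolding reflected_tail_def by (rule sum.cong) (auto simp: coeff_eq_0)
  then show ?thesis by simp
qed

lemma reflected_tail_0_dvd: "a dvd b \<Longrightarrow> reflected_tail a 0 dvd reflected_tail b 0"
proof -
  have "reflected_tail p 0 = p \<circ>\<^sub>p [:0, -1:]" for p
    unfolding reflected_tail_def pcompose_altdef poly_altdef by (simp add: degree_map_poly coeff_map_poly)
  moreover assume "a dvd b"
  ultimately show ?thesis by (auto simp: dvd_def pcompose_mult)
qed

text \<open>On the powers of \<open>phi\<close> at a generator, \<open>phi + x\<close> sends
  \<open>w i j\<close> to \<open>w i (Suc j) + x * w i j\<close>. These images, completed by
  \<open>w i 0\<close>, form the target basis. In the source only the last vector of each block
  changes, to the combination with the tails of \<open>a i\<close>, whose image is
  \<open>- a i (-x)\<close> times \<open>w i 0\<close>. So each block becomes diagonal, with entries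
  1 except for one \<open>- a i (-x)\<close>.\<close>

lemma cyclic_decomp_imp_has_snf:
  assumes C: "cyclic_decomp (fsupp (set es)) phi k v a" and deg: "\<And>i. i < k \<Longrightarrow> degree (a i) \<ge> 1"
    and phi: "zlinear phi" and inv: "\<And>v. v \<in> fsupp (set es) \<Longrightarrow> phi v \<in> fsupp (set es)"
    and es: "distinct es"
  shows "has_snf (char_mat_plus (mat (length es) (length es)
    (\<lambda>(i, j). phi (\<lambda>x. if x = es ! j then 1 else 0) (es ! i))))"
proof -
  define n where "n = length es"
  define S where "S = set es"
  define X where "X = char_mat_plus (mat n n (\<lambda>(i, j). phi (\<lambda>x. if x = es ! j then 1 else 0) (es ! i)))"
  define d where "d = (\<lambda>i. degree (a i))"
  define I where "I = Sigma {..<k} (\<lambda>i. {..<d i})"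
  define w where "w = (\<lambda>i j x. [:(phi ^^ j) (v i) x:])"
  have finS: "finite S" unfolding S_def by simp
  have CS: "cyclic_decomp (fsupp S) phi k v a" using C unfolding S_def .
  have basis: "zbasis (fsupp S) I (\<lambda>(i, j). (phi ^^ j) (v i))"
    unfolding I_def d_def by (rule cyclic_decomp_zbasis[OF CS deg zsubmodule_fsupp phi]) (use inv S_def in auto)
  have finI: "finite I" unfolding I_def by simp
  have cardI: "card I = n"
    using zbasis_card_eq[OF basis zbasis_fsupp[OF finS]] distinct_card[OF es] unfolding n_def S_def by simp
  have dpos: "d i \<ge> 1" if "i < k" for i using deg[OF that] unfolding d_def .
  obtain xs1 where xs1: "set xs1 = {p \<in> I. Suc (snd p) < d (fst p)}" "distinct xs1"
    using finite_distinct_list[of "{p \<in> I. Suc (snd p) < d (fst p)}"] finI by auto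
  \<comment> \<open>All entries 1 come first, then the last vector of each block in the order of the
    \<open>a i\<close>, as the divisibility chain requires.\<close>
  define xs where "xs = xs1 @ map (\<lambda>i. (i, d i - 1)) [0..<k]"
  have set_xs: "set xs = I" unfolding xs_def using xs1(1) dpos unfolding I_def by force
  have dist_xs: "distinct xs"
    unfolding xs_def using xs1 dpos by (auto simp: distinct_map inj_on_def)
  have len: "length xs = n" using distinct_card[OF dist_xs] set_xs cardI by simp
  define src where "src = (\<lambda>(i, j) x. if Suc j < d i then w i j x else \<Sum>l<d i. reflected_tail (a i) (Suc l) * w i l x)"
  define tgt where "tgt = (\<lambda>(i, j) x. if Suc j < d i then w i (Suc j) x + [:0, 1:] * w i j x else w i 0 x)"
  define del where "del = (\<lambda>(i, j). if Suc j < d i then 1 else - reflected_tail (a i) 0)"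
  have span: "(\<lambda>x. [:if x = y then 1 else 0:]) \<in> pspan F"
    if wF: "\<And>i j. i < k \<Longrightarrow> j < d i \<Longrightarrow> w i j \<in> pspan F" and y: "y \<in> S" for F y
  proof -
    have "(\<lambda>x. if x = y then 1 else 0) \<in> fsupp S" using y unfolding fsupp_def by auto
    then obtain c where c: "(\<lambda>x. if x = y then 1 else 0) = (\<Sum>p\<in>I. of_int (c p) * (case p of (i, j) \<Rightarrow> (phi ^^ j) (v i)))"
      by (rule zbasis_obtain[OF basis])
    have "[:if x = y then 1 else 0:] = (\<Sum>p\<in>I. [:c p:] * (case p of (i, j) \<Rightarrow> w i j x))" for x
    proof -
      have "(if x = y then 1 else 0) = (\<Sum>p\<in>I. c p * (case p of (i, j) \<Rightarrow> (phi ^^ j) (v i) x))"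
        using fun_cong[OF c, of x] unfolding sum_fun_apply fun_apply by (simp add: case_prod_beta)
      then have "[:if x = y then 1 else 0:] = (\<Sum>p\<in>I. [:c p * (case p of (i, j) \<Rightarrow> (phi ^^ j) (v i) x):])"
        by (simp only: hom_distribs sum_to_poly)
      then show ?thesis unfolding w_def by (simp add: case_prod_beta mult.commute)
    qed
    moreover have "(\<lambda>x. \<Sum>p\<in>I. [:c p:] * (case p of (i, j) \<Rightarrow> w i j x)) \<in> pspan F"
      using wF unfolding I_def by (intro pspan_sum pspan_scale) auto
    ultimately show ?thesis by simp
  qed
  have in_I: "(i, j) \<in> I" if "i < k" "j < d i" for i j using that unfolding I_def by simp
  have src_span: "w i j \<in> pspan (src ` I)" if i: "i < k" and j: "j < d i" for i j
  proof -
    have low: "w i j \<in> pspan (src ` I)" if "Suc j < d i" for j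
    proof (rule pspan_gen)
      have "w i j = src (i, j)" unfolding src_def using that by auto
      then show "w i j \<in> src ` I" by (rule image_eqI) (use in_I[OF i, of j] that in simp)
    qed
    show ?thesis
    proof (cases "Suc j < d i")
      case False
      then have dj: "d i = Suc j" using j by simp
      have "src (i, j) \<in> pspan (src ` I)" using in_I[OF i j] by (intro pspan_gen) blast
      moreover have "(\<lambda>x. \<Sum>l<j. reflected_tail (a i) (Suc l) * w i l x) \<in> pspan (src ` I)"
        using low dj by (intro pspan_sum pspan_scale) simp
      ultimately have "(\<lambda>x. src (i, j) x - (\<Sum>l<j. reflected_tail (a i) (Suc l) * w i l x)) \<in> pspan (src ` I)"
        by (rule pspan_diff)
      moreover have "reflected_tail (a i) (Suc j) = 1"
        using reflected_tail_degree[of "a i"] cyclic_decompD(3)[OF C i] dj unfolding d_def by (simp add: one_pCons)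
      then have "src (i, j) x - (\<Sum>l<j. reflected_tail (a i) (Suc l) * w i l x) = w i j x" for x
        unfolding src_def using dj by simp
      ultimately show ?thesis by simp
    qed (rule low)
  qed
  \<comment> \<open>The recovery starts with \<open>w i 0\<close>, the last target vector of the
    block, and climbs by subtracting \<open>x * w i j\<close> from the next image.\<close>
  have tgt_span: "w i j \<in> pspan (tgt ` I)" if i: "i < k" and j: "j < d i" for i j
    using j
  proof (induction j)
    case 0
    have "w i 0 = tgt (i, d i - 1)" unfolding tgt_def using dpos[OF i] by auto
    moreover have "(i, d i - 1) \<in> I" using in_I[OF i] dpos[OF i] by simp
    ultimately show ?case by (intro pspan_gen image_eqI)
  next
    case (Suc j)
    have "tgt (i, j) \<in> pspan (tgt ` I)" using in_I[OF i, of j] Suc.prems by (intro pspan_gen) auto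
    moreover have "w i j \<in> pspan (tgt ` I)" using Suc by simp
    ultimately have "(\<lambda>x. tgt (i, j) x - [:0, 1:] * w i j x) \<in> pspan (tgt ` I)" by (intro pspan_diff pspan_scale)
    moreover have "tgt (i, j) x - [:0, 1:] * w i j x = w i (Suc j) x" for x unfolding tgt_def using Suc.prems by simp
    ultimately show ?case by simp
  qed
  have img: "(\<lambda>c. f (xs ! c)) ` {..<n} = f ` I" for f :: "nat \<times> nat \<Rightarrow> 'a \<Rightarrow> int poly"
    unfolding set_xs[symmetric] set_conv_nth len by auto
  have "\<exists>R'. R' \<in> carrier_mat n n \<and> mat n n (\<lambda>(i, c). src (xs ! c) (es ! i)) * R' = 1\<^sub>m n"
    by (rule pspan_right_inverse[OF es n_def[symmetric]]) (use span[OF src_span] img[of src] S_def in simp)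
  then obtain R' where R': "R' \<in> carrier_mat n n" "mat n n (\<lambda>(i, c). src (xs ! c) (es ! i)) * R' = 1\<^sub>m n" by blast
  have "\<exists>R'. R' \<in> carrier_mat n n \<and> mat n n (\<lambda>(i, c). tgt (xs ! c) (es ! i)) * R' = 1\<^sub>m n"
    by (rule pspan_right_inverse[OF es n_def[symmetric]]) (use span[OF tgt_span] img[of tgt] S_def in simp)
  then obtain T' where T': "T' \<in> carrier_mat n n" "mat n n (\<lambda>(i, c). tgt (xs ! c) (es ! i)) * T' = 1\<^sub>m n" by blast
  \<comment> \<open>Multiplication by \<open>X\<close>, written on functions of poset elements
    instead of list positions.\<close>
  define op where "op = (\<lambda>F y. (\<Sum>x\<in>S. [:phi (\<lambda>z. if z = x then 1 else 0) y:] * F x) + [:0, 1:] * (F y :: int poly))"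
  have pow: "(phi ^^ j) (v i) \<in> fsupp S" if "i < k" for i j
    using cyclic_decompD(1)[OF CS that] inv unfolding S_def by (induction j) auto
  have op_w: "op (w i j) y = w i (Suc j) y + [:0, 1:] * w i j y" if i: "i < k" for i j y
  proof -
    let ?f = "(phi ^^ j) (v i)"
    have "?f = (\<Sum>x\<in>S. of_int (?f x) * (\<lambda>z. if z = x then 1 else 0))"
    proof
      fix z
      have "(\<Sum>x\<in>S. of_int (?f x) * (\<lambda>z. if z = x then 1 else (0::int))) z = (\<Sum>x\<in>S. if z = x then ?f x else 0)"
        unfolding sum_fun_apply fun_apply by (rule sum.cong) auto
      also have "\<dots> = ?f z" using finS pow[OF i, of j] unfolding fsupp_def by auto
      finally show "?f z = (\<Sum>x\<in>S. of_int (?f x) * (\<lambda>z. if z = x then 1 else 0)) z" by simp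
    qed
    then have "phi ?f = phi (\<Sum>x\<in>S. of_int (?f x) * (\<lambda>z. if z = x then 1 else 0))" by simp
    also have "\<dots> = (\<Sum>x\<in>S. of_int (?f x) * phi (\<lambda>z. if z = x then 1 else 0))"
      by (simp only: zlinear_sum[OF phi] zlinear_scale[OF phi])
    finally have "phi ?f y = (\<Sum>x\<in>S. ?f x * phi (\<lambda>z. if z = x then 1 else 0) y)"
      by (simp add: sum_fun_apply fun_apply)
    then have "[:phi ?f y:] = (\<Sum>x\<in>S. [:?f x * phi (\<lambda>z. if z = x then 1 else 0) y:])"
      by (simp only: hom_distribs sum_to_poly)
    then show ?thesis unfolding op_def w_def by (simp add: mult.commute)
  qed
  have op_src: "op (src p) y = tgt p y * del p" if p: "p \<in> I" for p y
  proof -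
    obtain i j where ij: "p = (i, j)" "i < k" "j < d i" using p unfolding I_def by auto
    show ?thesis
    proof (cases "Suc j < d i")
      case True
      then have "src p = w i j" unfolding src_def ij by auto
      then show ?thesis using op_w[OF ij(2)] True unfolding tgt_def del_def ij by simp
    next
      case False
      let ?s = "reflected_tail (a i)"
      have src: "src p = (\<lambda>x. \<Sum>l<d i. ?s (Suc l) * w i l x)" unfolding src_def ij using False by auto
      have "op (src p) y = (\<Sum>l<d i. ?s (Suc l) * op (w i l) y)"
      proof -
        have "(\<Sum>x\<in>S. [:phi (\<lambda>z. if z = x then 1 else 0) y:] * (\<Sum>l<d i. ?s (Suc l) * w i l x)) =
          (\<Sum>l<d i. ?s (Suc l) * (\<Sum>x\<in>S. [:phi (\<lambda>z. if z = x then 1 else 0) y:] * w i l x))"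
          unfolding sum_distrib_left by (subst sum.swap) (simp add: mult.left_commute del: mult_pCons_left)
        then show ?thesis unfolding src op_def
          by (simp add: distrib_left sum.distrib sum_distrib_left mult.left_commute del: mult_pCons_left)
      qed
      \<comment> \<open>The recursion replaces \<open>x\<close> times a tail by a coefficient minus
        the preceding tail: the tails telescope, and the coefficients assemble \<open>a i\<close>
        applied to \<open>v i\<close>, which is zero.\<close>
      also have "\<dots> = (\<Sum>l<d i. (?s (Suc l) * w i (Suc l) y - ?s l * w i l y) + [:coeff (a i) l:] * w i l y)"
      proof (rule sum.cong)
        fix l
        have "?s (Suc l) * op (w i l) y = ?s (Suc l) * w i (Suc l) y + ([:0, 1:] * ?s (Suc l)) * w i l y"
          unfolding op_w[OF ij(2)] by (simp only: distrib_left mult.left_commute mult.assoc)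
        then show "?s (Suc l) * op (w i l) y = (?s (Suc l) * w i (Suc l) y - ?s l * w i l y) + [:coeff (a i) l:] * w i l y"
          unfolding reflected_tail_rec by (simp only: left_diff_distrib)
      qed simp
      also have "\<dots> = (\<Sum>l<d i. ?s (Suc l) * w i (Suc l) y - ?s l * w i l y) + (\<Sum>l<d i. [:coeff (a i) l:] * w i l y)"
        by (rule sum.distrib)
      also have "(\<Sum>l<d i. ?s (Suc l) * w i (Suc l) y - ?s l * w i l y) = ?s (d i) * w i (d i) y - ?s 0 * w i 0 y"
        by (rule sum_lessThan_telescope)
      also have "?s (d i) = [:coeff (a i) (d i):]" unfolding d_def by (rule reflected_tail_degree)
      also have "[:coeff (a i) (d i):] * w i (d i) y - ?s 0 * w i 0 y + (\<Sum>l<d i. [:coeff (a i) l:] * w i l y) =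
        (\<Sum>l\<le>d i. [:coeff (a i) l:] * w i l y) - ?s 0 * w i 0 y"
        by (simp add: lessThan_Suc_atMost[symmetric] del: mult_pCons_left)
      also have "(\<Sum>l\<le>d i. [:coeff (a i) l:] * w i l y) = [:poly_act phi (a i) (v i) y:]"
        unfolding poly_act_def d_def w_def by (simp add: hom_distribs sum_to_poly mult.commute)
      also have "\<dots> = 0" using cyclic_decompD(2)[OF C ij(2)] by (simp add: fun_apply)
      finally show ?thesis unfolding tgt_def del_def ij using False by simp
    qed
  qed
  have X: "X \<in> carrier_mat n n" unfolding X_def char_mat_plus_def by simp
  have "has_snf X"
  proof (rule has_snf_diagonalised[OF X _ R' _ T'])
    show "X * mat n n (\<lambda>(i, c). src (xs ! c) (es ! i)) =
      mat n n (\<lambda>(i, c). tgt (xs ! c) (es ! i)) * mat n n (\<lambda>(i, j). if i = j then del (xs ! i) else 0)"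
    proof (rule eq_matI)
      fix i c assume "i < dim_row (mat n n (\<lambda>(i, c). tgt (xs ! c) (es ! i)) * mat n n (\<lambda>(i, j). if i = j then del (xs ! i) else 0))"
        "c < dim_col (mat n n (\<lambda>(i, c). tgt (xs ! c) (es ! i)) * mat n n (\<lambda>(i, j). if i = j then del (xs ! i) else 0))"
      then have ic: "i < n" "c < n" by auto
      have xsI: "xs ! c \<in> I" using ic len set_xs nth_mem by metis
      let ?F = "src (xs ! c)"
      let ?e = "\<lambda>j. phi (\<lambda>z. if z = es ! j then 1 else 0) (es ! i)"
      have "(X * mat n n (\<lambda>(i, c). src (xs ! c) (es ! i))) $$ (i, c) =
        (\<Sum>j<n. ([:?e j:] + (if i = j then [:0, 1:] else 0)) * ?F (es ! j))"
        using ic X unfolding X_def char_mat_plus_def by (simp add: scalar_prod_def atLeast0LessThan)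
      also have "\<dots> = (\<Sum>j<n. [:?e j:] * ?F (es ! j)) + (\<Sum>j<n. if i = j then [:0, 1:] * ?F (es ! j) else 0)"
        unfolding sum.distrib[symmetric] by (rule sum.cong) (auto simp: distrib_right simp del: mult_pCons_left)
      also have "(\<Sum>j<n. if i = j then [:0, 1:] * ?F (es ! j) else 0) = [:0, 1:] * ?F (es ! i)" using ic by simp
      also have "(\<Sum>j<n. [:?e j:] * ?F (es ! j)) = (\<Sum>x\<in>S. [:phi (\<lambda>z. if z = x then 1 else 0) (es ! i):] * ?F x)"
        unfolding S_def n_def
        by (rule sum.reindex_bij_betw[OF bij_betw_nth[OF es refl refl], of "\<lambda>x. [:phi (\<lambda>z. if z = x then 1 else 0) (es ! i):] * ?F x"])
      finally have "(X * mat n n (\<lambda>(i, c). src (xs ! c) (es ! i))) $$ (i, c) = op ?F (es ! i)" unfolding op_def .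
      also have "\<dots> = tgt (xs ! c) (es ! i) * del (xs ! c)" by (rule op_src[OF xsI])
      also have "\<dots> = (\<Sum>j<n. tgt (xs ! j) (es ! i) * (if j = c then del (xs ! j) else 0))"
        using ic by (simp add: if_distrib cong: if_cong)
      also have "\<dots> = (mat n n (\<lambda>(i, c). tgt (xs ! c) (es ! i)) * mat n n (\<lambda>(i, j). if i = j then del (xs ! i) else 0)) $$ (i, c)"
        using ic by (simp add: scalar_prod_def atLeast0LessThan)
      finally show "(X * mat n n (\<lambda>(i, c). src (xs ! c) (es ! i))) $$ (i, c) =
        (mat n n (\<lambda>(i, c). tgt (xs ! c) (es ! i)) * mat n n (\<lambda>(i, j). if i = j then del (xs ! i) else 0)) $$ (i, c)" .
    qed (use X in auto)
    show "del (xs ! c) dvd del (xs ! Suc c)" if c: "Suc c < n" for c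
    proof (cases "c < length xs1")
      case True
      then have "xs ! c \<in> set xs1" unfolding xs_def by (simp add: nth_append)
      then have "del (xs ! c) = 1" unfolding xs1(1) del_def by (auto simp: case_prod_beta)
      then show ?thesis by simp
    next
      case False
      define i where "i = c - length xs1"
      have i: "c = length xs1 + i" "Suc i < k" using False c len unfolding i_def xs_def by auto
      have "xs ! c = (i, d i - 1)" "xs ! Suc c = (Suc i, d (Suc i) - 1)" using i unfolding xs_def by (auto simp: nth_append)
      then have "del (xs ! c) = - reflected_tail (a i) 0" "del (xs ! Suc c) = - reflected_tail (a (Suc i)) 0"
        unfolding del_def using dpos[of i] dpos[of "Suc i"] i by auto
      then show ?thesis using reflected_tail_0_dvd[OF cyclic_decomp_chain[OF C, of i "Suc i"]] i by simp
    qed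
  qed auto
  then show ?thesis unfolding X_def n_def .
qed

section \<open>Induction on the rank and both conclusions\<close>

theorem mainTheorem6:
  fixes r :: nat and P :: "'a set" and leq :: "'a \<Rightarrow> 'a \<Rightarrow> bool" and rk :: "'a \<Rightarrow> nat"
  assumes diff: "differential_poset r P leq rk"
    and surj_D: "\<forall>n\<ge>1. \<forall>g\<in>ZP P rk (n - 1). \<exists>f\<in>ZP P rk n. Dmap P leq rk n f = g"
    and growth_rcf: "\<exists>l::nat.
        (\<forall>n::nat. n \<ge> l + 1 \<longrightarrow>
          delta_rank_size P rk (int n) \<ge>
            delta_rank_size P rk (int n - 1 - (if r = 1 then 1 else 0)) + 1)
        \<and> (\<forall>m\<le>l. has_rcf_Z (ZP P rk m) (DUmap P leq rk m))"
  shows "\<forall>n. has_rcf_Z (ZP P rk n) (DUmap P leq rk n) \<and>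
             has_snf (char_mat_plus (DU_matrix P leq rk n))"
proof
  fix n
  interpret surjective_differential_poset r P leq rk using diff surj_D by unfold_locales
  obtain l where growth: "\<And>n. n \<ge> l + 1 \<Longrightarrow> delta_rank_size P rk (int n) \<ge>
        delta_rank_size P rk (int n - 1 - (if r = 1 then 1 else 0)) + 1"
    and rcf: "\<And>m. m \<le> l \<Longrightarrow> has_rcf_Z (M m) (DU m)" using growth_rcf by blast
  have "\<exists>k v a. cyclic_decomp (M n) (DU n) k v a"
  proof (induction n)
    case 0
    show ?case by (rule has_rcf_Z_imp_cyclic_decomp[OF rcf sub_M lin_DU]) simp
  next
    case (Suc n)
    show ?case
    proof (cases "Suc n \<le> l")
      case True
      show ?thesis by (rule has_rcf_Z_imp_cyclic_decomp[OF rcf[OF True] sub_M lin_DU])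
    next
      case False
      have g: "delta_rank_size P rk (int (Suc n)) \<ge>
        delta_rank_size P rk (int (Suc n) - 1 - (if r = 1 then 1 else 0)) + 1"
        using growth[of "Suc n"] False by simp
      have "if r = 1 then n \<ge> 1 \<longrightarrow> dp (n - 1) < dp (Suc n) else dp n < dp (Suc n)"
      proof (cases "r = 1")
        case True
        have "dp (n - 1) < dp (Suc n)" if "n \<ge> 1"
        proof -
          have "int (Suc n) - 1 - (if r = 1 then 1 else 0) = int (n - 1)" using True that by simp
          then show ?thesis using g unfolding delta_rank_size_eq by (simp only: delta_rank_size_eq)
        qed
        then show ?thesis using True by simp
      next
        case False
        then have "int (Suc n) - 1 - (if r = 1 then 1 else 0) = int n" by simp
        then have "dp n < dp (Suc n)" using g unfolding delta_rank_size_eq by (simp only: delta_rank_size_eq)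
        then show ?thesis using False by simp
      qed
      then show ?thesis using Suc.IH cyclic_decomp_Suc by blast
    qed
  qed
  then obtain k0 v0 a0 where C0: "cyclic_decomp (M n) (DU n) k0 v0 a0" by blast
  \<comment> \<open>The blocks of the Smith form must be nonempty, so zero summands are dropped
    first.\<close>
  obtain k v a where C: "cyclic_decomp (M n) (DU n) k v a" and deg: "\<And>i. i < k \<Longrightarrow> degree (a i) \<ge> 1"
    by (rule cyclic_decomp_nonconstant[OF C0 lin_DU]) (rule that)
  have "has_rcf_Z (M n) (DU n)" by (rule cyclic_decomp_imp_has_rcf_Z[OF C sub_M lin_DU DU_M])
  moreover have "has_snf (char_mat_plus (DU_matrix P leq rk n))"
  proof -
    let ?es = "rank_enum P rk n"
    have es: "distinct ?es \<and> set ?es = R n"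
      unfolding rank_enum_def by (rule someI_ex) (use finite_distinct_list[OF finite_R] in blast)
    have Mn: "M n = fsupp (set ?es)" unfolding ZP_def using es by simp
    show ?thesis unfolding DU_matrix_def Let_def
      by (rule cyclic_decomp_imp_has_snf[OF C[unfolded Mn] deg lin_DU]) (use es DU_M Mn in auto)
  qed
  ultimately show "has_rcf_Z (M n) (DU n) \<and> has_snf (char_mat_plus (DU_matrix P leq rk n))" by blast
qed

end
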